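(* Let $G$ be a finite group. Let $S$ be a nonabelian finite simple group such that $\mathrm{Out}(S)=\mathrm{Aut}(S)/\mathrm{Inn}(S)$ is cyclic modulo $p$ for some prime $p$. If exactly one composition factor of $G$ (counted with multiplicity) is isomorphic to $S$, then $\beta(G)$ is not solvable.
   Context: For a prime $p$, a finite group $H$ is called cyclic modulo $p$ (or $p$-hypo-elementary) if $H/O_p(H)$ is cyclic, where $O_p(H)$ is the largest normal $p$-subgroup of $H$. For a finite group $G$ and $N\trianglelefteq G$, define the rational number $m_{G,N}=\frac{1}{|G|}\sum_{X\le G,\ XN=G}|X|\,\mu(X,G)$, where $\mu$ is the Möbius function of the poset of subgroups of $G$. If $N\trianglelefteq G$ is maximal (with respect to inclusion) among normal subgroups with $m_{G,N}\neq 0$, set $\beta(G)=G/N$; this is well defined up to isomorphism. *)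

theory Defs
  imports "HOL-Algebra.Algebra"
begin

function subgroup_mobius :: "('a, 'b) monoid_scheme \<Rightarrow> 'a set \<Rightarrow> int" where
  "subgroup_mobius Gr K =
     (if \<not> finite (carrier Gr) \<or> \<not> K \<subseteq> carrier Gr then 0
      else if K = carrier Gr then 1
      else - (\<Sum>Y \<in> {Y. subgroup Y Gr \<and> K \<subset> Y}. subgroup_mobius Gr Y))"
  by pat_completeness auto
termination
proof (relation "measure (\<lambda>(G, K). card (carrier G) - card K)")
  show "wf (measure (\<lambda>(G, K). card (carrier G) - card K))" by simp
next
  fix G :: "('a, 'b) monoid_scheme" and K Y
  assume a: "\<not> (\<not> finite (carrier G) \<or> \<not> K \<subseteq> carrier G)" "K \<noteq> carrier G"
     and b: "Y \<in> {Y. subgroup Y G \<and> K \<subset> Y}"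
  then have f: "finite (carrier G)" and Ys: "Y \<subseteq> carrier G" and XY: "K \<subset> Y"
    by (auto dest: subgroup.subset)
  then have "card K < card Y" by (meson psubset_card_mono rev_finite_subset)
  moreover have "card Y \<le> card (carrier G)" using f Ys card_mono by blast
  ultimately show "((G, Y), G, K) \<in> measure (\<lambda>(G, K). card (carrier G) - card K)" by simp
qed

declare subgroup_mobius.simps [simp del]

definition m_GN :: "('a, 'b) monoid_scheme \<Rightarrow> 'a set \<Rightarrow> rat" where
  "m_GN G N = (1 / of_nat (order G)) *
     (\<Sum>K \<in> {K. subgroup K G \<and> K <#>\<^bsub>G\<^esub> N = carrier G}.
        of_nat (card K) * of_int (subgroup_mobius G K))"

text \<open>N is a normal subgroup maximal (w.r.t. inclusion) among normal subgroups with
  m_{G,N} nonzero; then beta(G) = G/N.\<close>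

definition beta_kernel :: "('a, 'b) monoid_scheme \<Rightarrow> 'a set \<Rightarrow> bool" where
  "beta_kernel G N \<longleftrightarrow> N \<lhd> G \<and> m_GN G N \<noteq> 0 \<and>
     (\<forall>M. M \<lhd> G \<and> m_GN G M \<noteq> 0 \<and> N \<subseteq> M \<longrightarrow> M = N)"

definition is_p_subgroup :: "nat \<Rightarrow> ('a, 'b) monoid_scheme \<Rightarrow> 'a set \<Rightarrow> bool" where
  "is_p_subgroup p G P \<longleftrightarrow> subgroup P G \<and> finite P \<and> (\<exists>k. card P = p ^ k)"

definition is_O_p :: "nat \<Rightarrow> ('a, 'b) monoid_scheme \<Rightarrow> 'a set \<Rightarrow> bool" where
  "is_O_p p H P \<longleftrightarrow> P \<lhd> H \<and> is_p_subgroup p H P \<and>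
     (\<forall>Q. Q \<lhd> H \<and> is_p_subgroup p H Q \<longrightarrow> Q \<subseteq> P)"

definition cyclic_mod_p :: "nat \<Rightarrow> ('a, 'b) monoid_scheme \<Rightarrow> bool" where
  "cyclic_mod_p p H \<longleftrightarrow> (\<exists>P. is_O_p p H P \<and> cyclic_group (H Mod P))"

definition Inn :: "('a, 'b) monoid_scheme \<Rightarrow> ('a \<Rightarrow> 'a) set" where
  "Inn G = (\<lambda>g. \<lambda>x \<in> carrier G. g \<otimes>\<^bsub>G\<^esub> x \<otimes>\<^bsub>G\<^esub> inv\<^bsub>G\<^esub> g) ` carrier G"

definition OutGroup :: "('a, 'b) monoid_scheme \<Rightarrow> ('a \<Rightarrow> 'a) set monoid" where
  "OutGroup G = AutoGroup G Mod Inn G"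

definition comp_factor :: "('a, 'b) monoid_scheme \<Rightarrow> 'a set list \<Rightarrow> nat \<Rightarrow> 'a set monoid" where
  "comp_factor G Hs i = (G\<lparr>carrier := Hs ! Suc i\<rparr>) Mod (Hs ! i)"

definition composition_series :: "('a, 'b) monoid_scheme \<Rightarrow> 'a set list \<Rightarrow> bool" where
  "composition_series G Hs \<longleftrightarrow> Hs \<noteq> [] \<and> hd Hs = {\<one>\<^bsub>G\<^esub>} \<and> last Hs = carrier G \<and>
     (\<forall>i < length Hs. subgroup (Hs ! i) G) \<and>
     (\<forall>i. Suc i < length Hs \<longrightarrow>
        Hs ! i \<lhd> G\<lparr>carrier := Hs ! Suc i\<rparr> \<and> simple_group (comp_factor G Hs i))"

end

theory Submission
  imports Defs
begin

text \<open>Write \<open>m\<close> for the Moebius function of the subgroup lattice of \<open>G\<close>. Since \<open>S\<close> occurs exactly once as a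
  composition factor, it occurs as a chief factor \<open>M / E\<close>, and conjugation on \<open>M / E\<close> gives a
  homomorphism \<open>\<theta>\<close> from \<open>G\<close> onto a group \<open>A\<close> with \<open>Inn S \<le> A \<le> Aut S\<close>; let \<open>C\<close> be its kernel.

  Suppose that \<open>G / N\<close> is solvable and put \<open>F(U) = |U|\<close> if \<open>U N = G\<close> and \<open>F(U) = 0\<close> otherwise, so that
  \<open>|G|\<close> times the deflation number of \<open>N\<close> is \<open>\<Sum>\<^sub>U m(U) F(U)\<close>. By Weisner's theorem,
  \<open>\<Sum>\<^sub>U m(U) F(U \<inter> Z) = 0\<close> for every proper subgroup \<open>Z\<close>, so \<open>F(U)\<close> may be replaced by
  \<open>F'(U) = \<Sum>\<^bsub>Z \<ge> C\<^esub> m(Z) F(U \<inter> Z)\<close>. By Weisner again \<open>F'(U)\<close> vanishes unless \<open>U C = G = U N\<close>, and then it is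
  a multiple of \<open>\<Sum> m(Z) |Z|\<close> over the \<open>Z \<ge> C\<close> with \<open>\<theta>(Z) J = A\<close>, where \<open>J = \<theta>(U \<inter> N)\<close>. Here \<open>J \<noteq> 1\<close>, as
  otherwise \<open>A\<close> would be a quotient of \<open>G / N\<close>; hence \<open>Inn S \<le> J\<close>, and \<open>A / J\<close> is cyclic modulo \<open>p\<close>.

  That the last sum vanishes is an analogue of a theorem of Baumann: if \<open>A / J\<close> is cyclic modulo \<open>p\<close>, then
  \<open>V \<mapsto> [V J = A] |V|\<close> is a linear combination of functions \<open>V \<mapsto> [\<langle>Q, h\<rangle> \<le> V]\<close> with \<open>Q\<close> a \<open>p\<close>-subgroup
  normalized by \<open>h\<close>; and \<open>\<langle>Q, h\<rangle> \<noteq> A\<close>, because \<open>A\<close> is not cyclic modulo \<open>p\<close>. The linear combination comes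
  from counting, for \<open>h\<close> in a coset of a normal subgroup, the Sylow subgroups normalized by \<open>h\<close>.\<close>

section \<open>Conjugation and counting in finite groups\<close>

text \<open>The condition on Out(S) says nothing about G / N, so the Sylow count cannot be run with
  N itself. Replacing F by F' moves the question into A, where every nontrivial normal subgroup
  contains Inn S; hence A / J is a quotient of a subgroup of Out(S), whatever N was. That S occurs
  exactly once is used to get a chief factor equal to S and not to a power of S.

  Neither V J = A nor |V| looks like a condition <Q, h> \<le> V. Choose L with L / J a normal
  p-subgroup of A / J and A / L generated by the coset of g. For supplements V of J the order |V| is
  proportional to |V \<inter> gL|, which counts elements h. Moreover V is a supplement exactly when
  it meets gL and a Sylow p-subgroup R of V \<inter> L satisfies R J = L. So everything is expressed
  by pairs (R, h) with h normalizing R; what remains is to trade the condition that R is Sylow in V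
  \<inter> L for R \<le> V, a triangular system in the p-subgroups of L.

  The values of m at preimages enter as weights whose sums over all V above some <Q, h> vanish, so
  they are never compared with a Moebius function of A.\<close>

lemma card_fibres:
  assumes "finite A" "\<And>b. b \<in> f ` A \<Longrightarrow> card {a \<in> A. f a = b} = n"
  shows "card A = card (f ` A) * n"
proof -
  have "card A = (\<Sum>b \<in> f ` A. card {a \<in> A. f a = b})"
    using card_eq_sum sum.image_gen[OF assms(1), of "\<lambda>_. 1::nat" f] by auto
  also have "\<dots> = card (f ` A) * n"
    using assms(2) by simp
  finally show ?thesis .
qed

definition conj_set :: "('a, 'b) monoid_scheme \<Rightarrow> 'a \<Rightarrow> 'a set \<Rightarrow> 'a set" where
  "conj_set G a R = (\<lambda>r. a \<otimes>\<^bsub>G\<^esub> r \<otimes>\<^bsub>G\<^esub> inv\<^bsub>G\<^esub> a) ` R"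

text \<open>\<open>C\<close> may be any set, because it will be the part of a coset of a normal
  subgroup that lies in a given subgroup.\<close>

definition normalizer_in :: "('a, 'b) monoid_scheme \<Rightarrow> 'a set \<Rightarrow> 'a set \<Rightarrow> 'a set" where
  "normalizer_in G C R = {c \<in> C. conj_set G c R = R}"

text \<open>Phrased inside the ambient group, since one subgroup is tested against several
  \<open>Y\<close>, in particular against \<open>Y\<close> and a normalizer in \<open>Y\<close>. The
  exponent may be 0, in which case the Sylow subgroup is trivial.\<close>

definition is_sylow :: "nat \<Rightarrow> ('a, 'b) monoid_scheme \<Rightarrow> 'a set \<Rightarrow> 'a set \<Rightarrow> bool" where
  "is_sylow p G Y P \<longleftrightarrow> subgroup P G \<and> P \<subseteq> Y \<and>
     (\<exists>k n. card P = p ^ k \<and> card Y = p ^ k * n \<and> \<not> p dvd n)"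

context group
begin

lemma conj_set_mult:
  assumes "a \<in> carrier G" "b \<in> carrier G" "R \<subseteq> carrier G"
  shows "conj_set G a (conj_set G b R) = conj_set G (a \<otimes> b) R"
proof -
  have "a \<otimes> (b \<otimes> r \<otimes> inv b) \<otimes> inv a = a \<otimes> b \<otimes> r \<otimes> inv (a \<otimes> b)" if "r \<in> R" for r
    using assms that by (auto simp: inv_mult_group m_assoc subset_iff)
  then show ?thesis
    unfolding conj_set_def image_image by (intro image_cong) auto
qed

lemma conj_set_one:
  assumes "R \<subseteq> carrier G"
  shows "conj_set G \<one> R = R"
  unfolding conj_set_def using assms by (force simp: subset_iff image_iff)

lemma conj_set_subset:
  assumes "a \<in> carrier G" "R \<subseteq> carrier G"
  shows "conj_set G a R \<subseteq> carrier G"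
  using assms by (auto simp: conj_set_def)

lemma conj_set_inv:
  assumes "a \<in> carrier G" "R \<subseteq> carrier G"
  shows "conj_set G (inv a) (conj_set G a R) = R" "conj_set G a (conj_set G (inv a) R) = R"
  using assms by (simp_all add: conj_set_mult conj_set_one)

lemma conj_set_mono: "R \<subseteq> Q \<Longrightarrow> conj_set G a R \<subseteq> conj_set G a Q"
  by (auto simp: conj_set_def)

lemma inj_on_conj:
  assumes "a \<in> carrier G" "R \<subseteq> carrier G"
  shows "inj_on (\<lambda>r. a \<otimes> r \<otimes> inv a) R"
  using assms by (auto simp: inj_on_def subset_iff)

lemma card_conj_set:
  assumes "a \<in> carrier G" "R \<subseteq> carrier G"
  shows "card (conj_set G a R) = card R"
  unfolding conj_set_def using inj_on_conj[OF assms] card_image by blast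

lemma conj_set_subgroup:
  assumes "a \<in> carrier G" "subgroup R G"
  shows "subgroup (conj_set G a R) G"
proof (rule subgroupI)
  interpret R: subgroup R G by fact
  show "conj_set G a R \<subseteq> carrier G"
    using assms(1) R.subset by (rule conj_set_subset)
  show "conj_set G a R \<noteq> {}"
    using R.one_closed unfolding conj_set_def by blast
  show "inv x \<in> conj_set G a R" if x: "x \<in> conj_set G a R" for x
  proof -
    obtain r where r: "r \<in> R" "x = a \<otimes> r \<otimes> inv a"
      using x by (auto simp: conj_set_def)
    then have "inv x = a \<otimes> inv r \<otimes> inv a"
      using assms(1) by (simp add: inv_mult_group m_assoc)
    with r(1) show ?thesis
      unfolding conj_set_def by blast
  qed
  show "x \<otimes> y \<in> conj_set G a R" if xy: "x \<in> conj_set G a R" "y \<in> conj_set G a R" for x y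
  proof -
    obtain r s where rs: "r \<in> R" "x = a \<otimes> r \<otimes> inv a" "s \<in> R" "y = a \<otimes> s \<otimes> inv a"
      using xy by (auto simp: conj_set_def)
    have "x \<otimes> y = a \<otimes> r \<otimes> (inv a \<otimes> (a \<otimes> (s \<otimes> inv a)))"
      using rs assms(1) by (simp add: m_assoc)
    also have "\<dots> = a \<otimes> (r \<otimes> s) \<otimes> inv a"
      using rs assms(1) by (simp add: m_assoc inv_solve_left')
    finally show ?thesis
      unfolding conj_set_def using rs R.m_closed by blast
  qed
qed

lemma conj_set_eqI:
  assumes "a \<in> carrier G" "R \<subseteq> carrier G" "finite R" "conj_set G a R \<subseteq> R"
  shows "conj_set G a R = R"
  using card_subset_eq[OF assms(3,4)] card_conj_set[OF assms(1,2)] by simp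

lemma conj_set_self:
  assumes "subgroup R G" "r \<in> R"
  shows "conj_set G r R = R"
proof -
  interpret R: subgroup R G by fact
  have sub: "conj_set G x R \<subseteq> R" if "x \<in> R" for x
    using that by (auto simp: conj_set_def)
  have "R = conj_set G r (conj_set G (inv r) R)"
    using assms(2) R.subset by (simp add: conj_set_inv)
  also have "\<dots> \<subseteq> conj_set G r R"
    using assms(2) by (intro conj_set_mono sub) simp
  finally show ?thesis
    using sub[OF assms(2)] by (simp add: subset_antisym)
qed

lemma normalizer_in_subgroup:
  assumes "subgroup Y G" "R \<subseteq> carrier G"
  shows "subgroup (normalizer_in G Y R) G"
proof (rule subgroupI)
  interpret Y: subgroup Y G by fact
  show "normalizer_in G Y R \<subseteq> carrier G"
    using Y.subset by (auto simp: normalizer_in_def)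
  show "normalizer_in G Y R \<noteq> {}"
    unfolding normalizer_in_def using Y.one_closed conj_set_one[OF assms(2)] by blast
  show "inv x \<in> normalizer_in G Y R" if x: "x \<in> normalizer_in G Y R" for x
  proof -
    have "x \<in> Y" "conj_set G x R = R"
      using x by (simp_all add: normalizer_in_def)
    then show ?thesis
      using conj_set_inv(1)[of x R] assms(2) Y.mem_carrier by (simp add: normalizer_in_def)
  qed
  show "x \<otimes> y \<in> normalizer_in G Y R"
    if xy: "x \<in> normalizer_in G Y R" "y \<in> normalizer_in G Y R" for x y
  proof -
    have "x \<in> Y" "conj_set G x R = R" "y \<in> Y" "conj_set G y R = R"
      using xy by (simp_all add: normalizer_in_def)
    then show ?thesis
      using conj_set_mult[of x y R] assms(2) Y.mem_carrier by (simp add: normalizer_in_def)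
  qed
qed

lemma normal_conj_set:
  assumes "N \<lhd> G" "a \<in> carrier G"
  shows "conj_set G a N = N"
proof -
  interpret N: normal N G by fact
  have sub: "conj_set G x N \<subseteq> N" if "x \<in> carrier G" for x
    using that N.inv_op_closed2 by (auto simp: conj_set_def)
  have "N = conj_set G a (conj_set G (inv a) N)"
    using assms(2) N.subset by (simp add: conj_set_inv)
  also have "\<dots> \<subseteq> conj_set G a N"
    using assms(2) by (intro conj_set_mono sub) simp
  finally show ?thesis
    using sub[OF assms(2)] by (simp add: subset_antisym)
qed

lemma normalI_conj_set:
  assumes "subgroup N G" "\<And>a. a \<in> carrier G \<Longrightarrow> conj_set G a N \<subseteq> N"
  shows "N \<lhd> G"
  unfolding normal_inv_iff using assms by (force simp: conj_set_def)

lemma mem_set_mult_iff: "x \<in> A <#> B \<longleftrightarrow> (\<exists>a \<in> A. \<exists>b \<in> B. x = a \<otimes> b)"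
  by (auto simp: set_mult_def)

lemma subset_set_mult:
  assumes "subgroup N G" "subgroup K G"
  shows "N \<subseteq> N <#> K" "K \<subseteq> N <#> K"
proof -
  interpret N: subgroup N G by fact
  interpret K: subgroup K G by fact
  have "x = x \<otimes> \<one>" if "x \<in> N" for x
    using that by simp
  then show "N \<subseteq> N <#> K"
    unfolding subset_iff mem_set_mult_iff using K.one_closed by blast
  have "x = \<one> \<otimes> x" if "x \<in> K" for x
    using that by simp
  then show "K \<subseteq> N <#> K"
    unfolding subset_iff mem_set_mult_iff using N.one_closed by blast
qed

text \<open>Each fibre of the multiplication map from \<open>H \<times> K\<close> onto
  \<open>H <#> K\<close> is a regular orbit of \<open>H \<inter> K\<close>, where \<open>t\<close>
  sends the pair (h, k) to (h t, t^-1 k).\<close>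

lemma card_set_mult:
  assumes "subgroup H G" "subgroup K G" "finite H" "finite K"
  shows "card H * card K = card (H <#> K) * card (H \<inter> K)"
proof -
  interpret H: subgroup H G by fact
  interpret K: subgroup K G by fact
  let ?f = "\<lambda>(h, k). h \<otimes> k"
  have im: "?f ` (H \<times> K) = H <#> K"
    by (auto simp: set_mult_def)
  have "card {x \<in> H \<times> K. ?f x = b} = card (H \<inter> K)" if "b \<in> ?f ` (H \<times> K)" for b
  proof -
    obtain h k where hk: "h \<in> H" "k \<in> K" "b = h \<otimes> k"
      using \<open>b \<in> _\<close> by auto
    have *: "inv h \<otimes> x \<in> H \<inter> K" "inv (inv h \<otimes> x) \<otimes> k = y"
      if xy: "x \<in> H" "y \<in> K" "x \<otimes> y = h \<otimes> k" for x y
    proof -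
      have "inv (inv h \<otimes> x) \<otimes> k = inv x \<otimes> (h \<otimes> k)"
        using xy(1) hk(1,2) by (simp add: inv_mult_group m_assoc)
      also have "\<dots> = y"
        using xy(1,2) by (simp add: xy(3)[symmetric] m_assoc[symmetric])
      finally show **: "inv (inv h \<otimes> x) \<otimes> k = y" .
      have "inv h \<otimes> x = k \<otimes> inv y"
        using xy(1,2) hk(1,2) unfolding **[symmetric] by (simp add: inv_mult_group m_assoc[symmetric])
      then show "inv h \<otimes> x \<in> H \<inter> K"
        using xy(1,2) hk(1,2) by (metis H.m_closed H.m_inv_closed IntI K.m_closed K.m_inv_closed)
    qed
    have **: "h \<otimes> t \<otimes> (inv t \<otimes> k) = h \<otimes> k" if "t \<in> H" for t
    proof -
      have "h \<otimes> t \<otimes> (inv t \<otimes> k) = h \<otimes> ((t \<otimes> inv t) \<otimes> k)"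
        using that hk(1,2) H.mem_carrier K.mem_carrier by (simp only: m_assoc m_closed inv_closed)
      then show ?thesis
        using that hk(1,2) by simp
    qed
    have "bij_betw (\<lambda>t. (h \<otimes> t, inv t \<otimes> k)) (H \<inter> K) {x \<in> H \<times> K. ?f x = b}"
      unfolding hk(3)
    proof (rule bij_betw_byWitness[where f' = "\<lambda>x. inv h \<otimes> fst x"])
      show "\<forall>t\<in>H \<inter> K. inv h \<otimes> fst (h \<otimes> t, inv t \<otimes> k) = t"
        using hk(1,2) by (auto simp: m_assoc[symmetric])
      show "\<forall>x\<in>{x \<in> H \<times> K. ?f x = h \<otimes> k}. (h \<otimes> (inv h \<otimes> fst x), inv (inv h \<otimes> fst x) \<otimes> k) = x"
        using * hk(1,2) by (auto simp: m_assoc[symmetric])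
      show "(\<lambda>t. (h \<otimes> t, inv t \<otimes> k)) ` (H \<inter> K) \<subseteq> {x \<in> H \<times> K. ?f x = h \<otimes> k}"
        using hk(1,2) ** by auto
      show "(\<lambda>x. inv h \<otimes> fst x) ` {x \<in> H \<times> K. ?f x = h \<otimes> k} \<subseteq> H \<inter> K"
        using * by auto
    qed
    then show ?thesis
      by (rule bij_betw_same_card[symmetric])
  qed
  then have "card (H \<times> K) = card (H <#> K) * card (H \<inter> K)"
    using card_fibres[of "H \<times> K" ?f] assms(3,4) im by auto
  then show ?thesis
    by (simp add: card_cartesian_product)
qed

lemma card_subgroup_dvd:
  assumes "subgroup H G" "subgroup K G" "H \<subseteq> K"
  shows "card H dvd card K"
proof -
  interpret K: group "G\<lparr>carrier := K\<rparr>"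
    using assms(2) subgroup_imp_group by blast
  have "subgroup H (G\<lparr>carrier := K\<rparr>)"
    using assms subgroup_incl by blast
  from K.lagrange[OF this] have "card (rcosets\<^bsub>G\<lparr>carrier := K\<rparr>\<^esub> H) * card H = card K"
    by (simp add: order_def)
  then show ?thesis
    by (metis dvd_triv_right)
qed

end

section \<open>Sylow subgroups and their normalizers\<close>

text \<open>Every orbit outside the fixed points has length a positive power of \<open>p\<close>.
  The action is a bare function with its laws, since it will be instantiated by cosets and by
  conjugation; the extensional version needed for the orbit-stabilizer theorem is built
  inside.\<close>

lemma (in group) p_group_fixed_points:
  fixes act :: "'a \<Rightarrow> 'x \<Rightarrow> 'x"
  assumes "Factorial_Ring.prime p" "order G = p ^ k" "finite E"
    and closed: "\<And>g x. g \<in> carrier G \<Longrightarrow> x \<in> E \<Longrightarrow> act g x \<in> E"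
    and one: "\<And>x. x \<in> E \<Longrightarrow> act \<one> x = x"
    and mult: "\<And>g h x. g \<in> carrier G \<Longrightarrow> h \<in> carrier G \<Longrightarrow> x \<in> E \<Longrightarrow> act (g \<otimes> h) x = act g (act h x)"
  shows "card E mod p = card {x \<in> E. \<forall>g \<in> carrier G. act g x = x} mod p"
proof -
  define F where "F = {x \<in> E. \<forall>g \<in> carrier G. act g x = x}"
  define \<phi> where "\<phi> = (\<lambda>g. \<lambda>x \<in> E. act g x)"
  have inv: "act (inv g) (act g x) = x" "act g (act (inv g) x) = x" if "g \<in> carrier G" "x \<in> E" for g x
    using that mult[of "inv g" g x] mult[of g "inv g" x] one by auto
  have bij: "\<phi> g \<in> Bij E" if "g \<in> carrier G" for g
    unfolding Bij_def \<phi>_def using that closed inv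
    by (auto intro!: bij_betw_byWitness[where f' = "act (inv g)"] simp: bij_betw_restrict_eq)
  have "\<phi> \<in> hom G (BijGroup E)"
    unfolding hom_def
  proof (intro CollectI conjI ballI)
    show "\<phi> \<in> carrier G \<rightarrow> carrier (BijGroup E)"
      using bij by (auto simp: BijGroup_def)
    show "\<phi> (g \<otimes> h) = \<phi> g \<otimes>\<^bsub>BijGroup E\<^esub> \<phi> h" if "g \<in> carrier G" "h \<in> carrier G" for g h
      using that bij by (auto simp: BijGroup_def \<phi>_def compose_def fun_eq_iff closed mult)
  qed
  then interpret A: group_action G E \<phi>
    by (simp add: group_action_def group_hom_def group_hom_axioms_def group_BijGroup)
  let ?C = "orbit G \<phi> ` (E - F)"
  have orb: "orbit G \<phi> x \<subseteq> E - F" if "x \<in> E - F" for x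
  proof
    fix y assume "y \<in> orbit G \<phi> x"
    then obtain g where g: "g \<in> carrier G" "y = act g x"
      using \<open>x \<in> E - F\<close> by (auto simp: orbit_def \<phi>_def)
    have "y \<notin> F"
    proof
      assume "y \<in> F"
      have "act h x = y" if "h \<in> carrier G" for h
      proof -
        have "act h x = act (h \<otimes> inv g) (act g x)"
          using mult[of "h \<otimes> inv g" g x] that g(1) \<open>x \<in> E - F\<close> by (simp add: m_assoc)
        also have "\<dots> = y"
          using \<open>y \<in> F\<close> that g by (simp add: F_def)
        finally show ?thesis .
      qed
      then have "x = y" "\<forall>h \<in> carrier G. act h x = x"
        using one \<open>x \<in> E - F\<close> one_closed by fastforce+
      then show False
        using \<open>x \<in> E - F\<close> by (simp add: F_def)
    qed
    then show "y \<in> E - F"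
      using g closed that by auto
  qed
  have "\<Union> ?C = E - F"
    using orb A.orbit_refl by fast
  moreover have "p dvd card (\<Union> ?C)"
  proof (rule dvd_partition)
    show "finite (\<Union> ?C)"
      using \<open>\<Union> ?C = E - F\<close> \<open>finite E\<close> by simp
    show "\<forall>c\<in>?C. p dvd card c"
    proof clarify
      fix x assume x: "x \<in> E" "x \<notin> F"
      have "card (orbit G \<phi> x) * card (stabilizer G \<phi> x) = p ^ k"
        using A.orbit_stabilizer_theorem[OF x(1)] assms(2) by simp
      then obtain j where j: "card (orbit G \<phi> x) = p ^ j"
        using assms(1) by (metis divides_primepow_nat dvd_triv_left)
      have "j \<noteq> 0"
      proof
        assume "j = 0"
        then obtain z where "orbit G \<phi> x = {z}"
          using j card_1_singletonE by auto
        moreover have "act g x \<in> orbit G \<phi> x" if "g \<in> carrier G" for g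
          using that x by (auto simp: orbit_def \<phi>_def)
        ultimately have "\<forall>g \<in> carrier G. act g x = x"
          using A.orbit_refl[OF x(1)] by auto
        then show False
          using x by (simp add: F_def)
      qed
      then show "p dvd card (orbit G \<phi> x)"
        by (simp add: j)
    qed
    show "\<forall>c1\<in>?C. \<forall>c2\<in>?C. c1 \<noteq> c2 \<longrightarrow> c1 \<inter> c2 = {}"
    proof clarify
      fix x y assume "x \<in> E" "y \<in> E" "orbit G \<phi> x \<noteq> orbit G \<phi> y"
      then show "orbit G \<phi> x \<inter> orbit G \<phi> y = {}"
        using A.disjoint_union[of "orbit G \<phi> x" "orbit G \<phi> y"] by (auto simp: orbits_def)
    qed
  qed
  ultimately have "p dvd card E - card F"
    using \<open>finite E\<close> by (subst card_Diff_subset[symmetric]) (auto simp: F_def)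
  moreover have "card F \<le> card E"
    using \<open>finite E\<close> by (auto simp: F_def intro: card_mono)
  ultimately show ?thesis
    unfolding F_def[symmetric] using mod_eq_dvd_iff_nat by blast
qed

context group
begin

lemma r_coset_eq_iff:
  assumes "subgroup P G" "a \<in> carrier G" "b \<in> carrier G"
  shows "P #> a = P #> b \<longleftrightarrow> a \<otimes> inv b \<in> P"
  using subgroup.rcos_module[OF assms(1) is_group assms(3,2)] rcos_self[OF assms(2,1)]
    repr_independence[OF _ assms(3,1)] by metis

text \<open>\<open>R\<close> acts on the \<open>n\<close> cosets \<open>P #> a\<close> in
  \<open>Y\<close> by right multiplication, and \<open>P #> a\<close> is fixed exactly if the
  conjugate of \<open>R\<close> by \<open>a\<close> lies in \<open>P\<close>; so \<open>m\<close> is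
  the number of fixed cosets. With \<open>P\<close> a Sylow subgroup this gives Sylow conjugacy,
  with \<open>P = R\<close> the normalizer criterion.\<close>

lemma card_cosets_conj_mod:
  assumes p: "Factorial_Ring.prime p" and P: "subgroup P G" and R: "subgroup R G" and Y: "subgroup Y G"
    and "finite Y" "P \<subseteq> Y" "R \<subseteq> Y" "card R = p ^ k" "card Y = card P * n"
  shows "\<exists>m. card {a \<in> Y. conj_set G a R \<subseteq> P} = card P * m \<and> m mod p = n mod p"
proof -
  interpret P: subgroup P G by fact
  interpret R: subgroup R G by fact
  interpret Y: subgroup Y G by fact
  interpret RG: group "G\<lparr>carrier := R\<rparr>"
    using R subgroup_imp_group by blast
  define E where "E = (\<lambda>a. P #> a) ` Y"
  have fibre: "card {a \<in> Y. P #> a = e} = card P" if "e \<in> E" for e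
  proof -
    obtain b where b: "b \<in> Y" "e = P #> b"
      using \<open>e \<in> E\<close> by (auto simp: E_def)
    have "{a \<in> Y. P #> a = e} = e"
    proof
      show "{a \<in> Y. P #> a = e} \<subseteq> e"
        using rcos_self[OF _ P] Y.mem_carrier by blast
      show "e \<subseteq> {a \<in> Y. P #> a = e}"
      proof
        fix a assume a: "a \<in> e"
        then have "a \<in> Y"
          using b \<open>P \<subseteq> Y\<close> by (auto simp: r_coset_def)
        then show "a \<in> {a \<in> Y. P #> a = e}"
          using repr_independence[of a P b] a b P Y.mem_carrier by simp
      qed
    qed
    then show ?thesis
      using card_cosets_equal[OF rcosetsI[OF P.subset Y.mem_carrier[OF b(1)]] P.subset]
        bij_betw_same_card b(2) by force
  qed
  have "card Y = card E * card P"
    using card_fibres[of Y "\<lambda>a. P #> a"] fibre \<open>finite Y\<close> unfolding E_def by blast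
  moreover have P0: "card P > 0"
    using P.finite_imp_card_positive \<open>finite Y\<close> \<open>P \<subseteq> Y\<close> finite_subset P.one_closed card_gt_0_iff by blast
  ultimately have "card E = n"
    using assms(9) by simp
  \<comment> \<open>The inverse turns right multiplication into a left action.\<close>
  define act where "act = (\<lambda>r e. e #> inv r)"
  let ?F = "{e \<in> E. \<forall>r \<in> R. act r e = e}"
  have act: "act r (P #> a) = P #> (a \<otimes> inv r)" if "r \<in> R" "a \<in> Y" for r a
    unfolding act_def using that P.subset Y.mem_carrier coset_mult_assoc by simp
  have "card E mod p = card {e \<in> E. \<forall>r \<in> carrier (G\<lparr>carrier := R\<rparr>). act r e = e} mod p"
  proof (rule RG.p_group_fixed_points[OF p])
    show "order (G\<lparr>carrier := R\<rparr>) = p ^ k"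
      using assms(8) by (simp add: order_def)
    show "finite E"
      using \<open>finite Y\<close> by (simp add: E_def)
    show "act r e \<in> E" if "r \<in> carrier (G\<lparr>carrier := R\<rparr>)" "e \<in> E" for r e
      using that act \<open>R \<subseteq> Y\<close> unfolding E_def by (auto simp: subset_iff)
    show "act \<one>\<^bsub>G\<lparr>carrier := R\<rparr>\<^esub> e = e" if "e \<in> E" for e
      using that act[of \<one>] Y.mem_carrier by (auto simp: E_def)
    show "act (r \<otimes>\<^bsub>G\<lparr>carrier := R\<rparr>\<^esub> s) e = act r (act s e)"
      if rse: "r \<in> carrier (G\<lparr>carrier := R\<rparr>)" "s \<in> carrier (G\<lparr>carrier := R\<rparr>)" "e \<in> E" for r s e
    proof -
      obtain a where a: "a \<in> Y" "e = P #> a"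
        using rse(3) by (auto simp: E_def)
      have "a \<otimes> inv s \<in> Y"
        using a rse(2) \<open>R \<subseteq> Y\<close> by auto
      then show ?thesis
        using rse(1,2) a Y.mem_carrier R.m_closed by (simp add: act inv_mult_group m_assoc)
    qed
  qed
  then have mod: "n mod p = card ?F mod p"
    using \<open>card E = n\<close> by simp
  let ?T = "{a \<in> Y. conj_set G a R \<subseteq> P}"
  have T: "a \<in> ?T \<longleftrightarrow> P #> a \<in> ?F" if "a \<in> Y" for a
  proof -
    have "act r (P #> a) = P #> a \<longleftrightarrow> a \<otimes> inv r \<otimes> inv a \<in> P" if "r \<in> R" for r
      using that \<open>a \<in> Y\<close> Y.mem_carrier by (simp add: act r_coset_eq_iff[OF P])
    then have "(\<forall>r \<in> R. act r (P #> a) = P #> a) \<longleftrightarrow> (\<forall>r \<in> R. a \<otimes> inv r \<otimes> inv a \<in> P)"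
      by simp
    also have "\<dots> \<longleftrightarrow> (\<forall>r \<in> R. a \<otimes> r \<otimes> inv a \<in> P)"
      using R.m_inv_closed R.mem_carrier inv_inv by metis
    finally show ?thesis
      using that by (auto simp: conj_set_def E_def)
  qed
  have im: "(\<lambda>a. P #> a) ` ?T = ?F"
    using T by (auto simp: E_def)
  have fibT: "card {a \<in> ?T. P #> a = e} = card P" if "e \<in> ?F" for e
  proof -
    have "{a \<in> ?T. P #> a = e} = {a \<in> Y. P #> a = e}"
      using T that by blast
    then show ?thesis
      using fibre that by simp
  qed
  have "card ?T = card ((\<lambda>a. P #> a) ` ?T) * card P"
    by (rule card_fibres) (use fibT im \<open>finite Y\<close> in simp_all)
  then have "card ?T = card P * card ?F"
    unfolding im by simp
  with mod show ?thesis
    by (intro exI[of _ "card ?F"]) simp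
qed

section \<open>Existence, conjugacy and normalizers of Sylow subgroups\<close>

lemma is_sylowD:
  assumes "is_sylow p G Y P"
  shows "subgroup P G" "P \<subseteq> Y" "\<exists>k. card P = p ^ k"
  using assms by (auto simp: is_sylow_def)

lemma sylow_exists:
  assumes p: "Factorial_Ring.prime p" and Y: "subgroup Y G" "finite Y"
  shows "\<exists>P. is_sylow p G Y P"
proof -
  interpret Y: group "G\<lparr>carrier := Y\<rparr>"
    using Y subgroup_imp_group by blast
  have "card Y \<noteq> 0"
    using Y(2) subgroup.one_closed[OF Y(1)] by auto
  moreover have "\<not> is_unit p"
    using p not_prime_unit by blast
  ultimately obtain n where n: "card Y = p ^ multiplicity p (card Y) * n" "\<not> p dvd n"
    using multiplicity_decompose' by metis
  obtain P where P: "subgroup P (G\<lparr>carrier := Y\<rparr>)" "card P = p ^ multiplicity p (card Y)"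
    using sylow_thm[OF p Y.is_group, of "multiplicity p (card Y)" n] n(1) Y(2) by (auto simp: order_def)
  then have "subgroup P G" "P \<subseteq> Y"
    using incl_subgroup[OF Y(1) P(1)] subgroup.subset[OF P(1)] by auto
  with P(2) n show ?thesis
    unfolding is_sylow_def by metis
qed

text \<open>The index \<open>n\<close> of a Sylow subgroup is prime to \<open>p\<close>, so the
  number \<open>m\<close> of fixed cosets is prime to \<open>p\<close> as well and cannot be
  0.\<close>

lemma p_subgroup_conj_into_sylow:
  assumes p: "Factorial_Ring.prime p" and Y: "subgroup Y G" "finite Y"
    and P: "is_sylow p G Y P" and R: "subgroup R G" "R \<subseteq> Y" "card R = p ^ k"
  shows "\<exists>a \<in> Y. conj_set G a R \<subseteq> P"
proof -
  obtain j n where n: "card P = p ^ j" "card Y = card P * n" "\<not> p dvd n"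
    using P unfolding is_sylow_def by metis
  obtain m where "card {a \<in> Y. conj_set G a R \<subseteq> P} = card P * m" "m mod p = n mod p"
    using card_cosets_conj_mod[OF p is_sylowD(1)[OF P] R(1) Y is_sylowD(2)[OF P] R(2,3) n(2)] by blast
  moreover from this(2) n(3) have "m \<noteq> 0"
    by (metis dvd_eq_mod_eq_0 dvd_0_right)
  moreover have "card P \<noteq> 0"
    using n(1) p by (simp add: prime_gt_0_nat)
  ultimately have "{a \<in> Y. conj_set G a R \<subseteq> P} \<noteq> {}"
    by (metis card.empty mult_is_0)
  then show ?thesis
    by blast
qed

lemma sylow_card_eq:
  assumes p: "Factorial_Ring.prime p" and "finite Y" and P: "is_sylow p G Y P" and Q: "is_sylow p G Y Q"
  shows "card P = card Q"
proof -
  obtain i n where n: "card P = p ^ i" "card Y = p ^ i * n" "\<not> p dvd n"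
    using P unfolding is_sylow_def by metis
  obtain j m where m: "card Q = p ^ j" "card Y = p ^ j * m" "\<not> p dvd m"
    using Q unfolding is_sylow_def by metis
  have "i = multiplicity p (card Y)" "j = multiplicity p (card Y)"
    using multiplicity_decomposeI[OF n(2,3)] multiplicity_decomposeI[OF m(2,3)] p by auto
  then show ?thesis
    using n m by simp
qed

lemma sylow_conjugate:
  assumes p: "Factorial_Ring.prime p" and Y: "subgroup Y G" "finite Y"
    and P: "is_sylow p G Y P" and Q: "is_sylow p G Y Q"
  shows "\<exists>a \<in> Y. conj_set G a Q = P"
proof -
  obtain k where "card Q = p ^ k"
    using Q by (auto simp: is_sylow_def)
  then obtain a where a: "a \<in> Y" "conj_set G a Q \<subseteq> P"
    using p_subgroup_conj_into_sylow[OF p Y P] is_sylowD[OF Q] by metis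
  have "card (conj_set G a Q) = card P"
    using card_conj_set[OF subgroup.mem_carrier[OF Y(1) a(1)] subgroup.subset[OF is_sylowD(1)[OF Q]]]
      sylow_card_eq[OF p Y(2) P Q] by simp
  moreover have "finite P"
    using finite_subset[OF is_sylowD(2)[OF P] Y(2)] .
  ultimately show ?thesis
    using a card_subset_eq[of P "conj_set G a Q"] by auto
qed

text \<open>The coset count with \<open>P = R\<close> shows that the indices of \<open>R\<close> in
  \<open>Y\<close> and in its normalizer are congruent modulo \<open>p\<close>, so \<open>p\<close>
  divides both or neither. Thus passing to the normalizer of \<open>R\<close> does not affect
  whether \<open>R\<close> is Sylow.\<close>

lemma sylow_normalizer_iff:
  assumes p: "Factorial_Ring.prime p" and Y: "subgroup Y G" "finite Y"
    and R: "subgroup R G" "R \<subseteq> Y" "card R = p ^ k"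
  shows "is_sylow p G (normalizer_in G Y R) R \<longleftrightarrow> is_sylow p G Y R"
proof -
  have Rc: "R \<subseteq> carrier G" and Yc: "Y \<subseteq> carrier G"
    using subgroup.subset[OF R(1)] subgroup.subset[OF Y(1)] .
  have fin: "finite R"
    using finite_subset[OF R(2) Y(2)] .
  obtain n where n: "card Y = card R * n"
    using card_subgroup_dvd[OF R(1) Y(1) R(2)] by (auto elim: dvdE)
  have N: "{a \<in> Y. conj_set G a R \<subseteq> R} = normalizer_in G Y R"
    unfolding normalizer_in_def using conj_set_eqI[OF _ Rc fin] Yc by blast
  obtain m where m: "card (normalizer_in G Y R) = card R * m" "m mod p = n mod p"
    using card_cosets_conj_mod[OF p R(1) R(1) Y R(2) R(2,3) n] unfolding N by blast
  have RN: "R \<subseteq> normalizer_in G Y R"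
    using conj_set_self[OF R(1)] R(2) by (auto simp: normalizer_in_def)
  have "card R > 0"
    using R(3) p by (simp add: prime_gt_0_nat)
  have *: "is_sylow p G W R \<longleftrightarrow> R \<subseteq> W \<and> \<not> p dvd l" if W: "card W = card R * l" for W l
  proof -
    have "l' = l" if "card R = p ^ i" "card W = p ^ i * l'" for i l'
      using that W \<open>card R > 0\<close> by auto
    then show ?thesis
      unfolding is_sylow_def using R W by metis
  qed
  have "p dvd m \<longleftrightarrow> p dvd n"
    using m(2) by (simp add: dvd_eq_mod_eq_0)
  then show ?thesis
    using *[OF n] *[OF m(1)] R(2) RN by blast
qed

lemma conj_sylow:
  assumes "subgroup Y G" "c \<in> carrier G" "conj_set G c Y = Y" "is_sylow p G Y R"
  shows "is_sylow p G Y (conj_set G c R)"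
proof -
  have "subgroup R G" "R \<subseteq> Y"
    using assms(4) is_sylowD by auto
  then have "conj_set G c R \<subseteq> Y" "card (conj_set G c R) = card R" "subgroup (conj_set G c R) G"
    using conj_set_mono[of R Y c] assms(2,3) card_conj_set[of c R] conj_set_subgroup[of c R]
      subgroup.subset[of R G] by auto
  then show ?thesis
    using assms(4) unfolding is_sylow_def by simp
qed

text \<open>Double counting of the pairs \<open>(c, R)\<close> with \<open>c\<close> normalizing \<open>R\<close>: every \<open>c \<in> C\<close> permutes the
  Sylow subgroups of \<open>Y\<close>, and by conjugacy each target is hit equally often.\<close>

lemma card_eq_sum_sylow_normalizers:
  assumes p: "Factorial_Ring.prime p" and Y: "subgroup Y G" "finite Y"
    and C: "C \<subseteq> carrier G" "finite C"
    and YC: "\<And>y c. y \<in> Y \<Longrightarrow> c \<in> C \<Longrightarrow> y \<otimes> c \<in> C"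
    and norm: "\<And>c. c \<in> C \<Longrightarrow> conj_set G c Y = Y"
  shows "card C = (\<Sum>R | is_sylow p G Y R. card (normalizer_in G C R))"
proof -
  interpret Y: subgroup Y G by fact
  let ?S = "{R. is_sylow p G Y R}"
  have "?S \<subseteq> Pow Y"
    by (auto simp: is_sylow_def)
  then have finS: "finite ?S"
    using finite_subset Y(2) by auto
  have cardC: "card C = card ?S * card (normalizer_in G C R)" if R: "R \<in> ?S" for R
  proof -
    have Rc: "R \<subseteq> carrier G"
      using R subgroup.subset[of R G] is_sylowD(1)[of p Y R] by simp
    have fib: "card {c \<in> C. conj_set G c R = Q} = card (normalizer_in G C R)" if Q: "Q \<in> ?S" for Q
    proof -
      have Qc: "Q \<subseteq> carrier G"
        using Q subgroup.subset[of Q G] is_sylowD(1)[of p Y Q] by simp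
      obtain a where a: "a \<in> Y" "conj_set G a Q = R"
        using sylow_conjugate[OF p Y] Q R by blast
      have ac: "a \<in> carrier G"
        using a by simp
      \<comment> \<open>As \<open>a\<close> carries \<open>Q\<close> to \<open>R\<close>, left
        multiplication by \<open>a\<close> turns the elements taking \<open>R\<close> to
        \<open>Q\<close> into those fixing \<open>R\<close>; it preserves \<open>C\<close> because
        \<open>a\<close> is in \<open>Y\<close>.\<close>
      have "bij_betw (\<lambda>c. a \<otimes> c) {c \<in> C. conj_set G c R = Q} (normalizer_in G C R)"
      proof (rule bij_betw_byWitness[where f' = "\<lambda>c. inv a \<otimes> c"])
        show "\<forall>c\<in>{c \<in> C. conj_set G c R = Q}. inv a \<otimes> (a \<otimes> c) = c"
          using C(1) ac by (auto simp: m_assoc[symmetric] subset_iff)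
        show "\<forall>c\<in>normalizer_in G C R. a \<otimes> (inv a \<otimes> c) = c"
          using C(1) ac by (auto simp: m_assoc[symmetric] subset_iff normalizer_in_def)
        show "(\<lambda>c. a \<otimes> c) ` {c \<in> C. conj_set G c R = Q} \<subseteq> normalizer_in G C R"
        proof clarify
          fix c assume c: "c \<in> C" "Q = conj_set G c R"
          have "conj_set G (a \<otimes> c) R = R"
            using conj_set_mult[OF ac _ Rc, of c] c a(2) C(1) by auto
          then show "a \<otimes> c \<in> normalizer_in G C R"
            using YC[OF a(1) c(1)] by (simp add: normalizer_in_def)
        qed
        show "(\<lambda>c. inv a \<otimes> c) ` normalizer_in G C R \<subseteq> {c \<in> C. conj_set G c R = Q}"
        proof clarify
          fix c assume "c \<in> normalizer_in G C R"
          then have c: "c \<in> C" "conj_set G c R = R"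
            by (auto simp: normalizer_in_def)
          have "conj_set G (inv a \<otimes> c) R = conj_set G (inv a) R"
            using conj_set_mult[OF _ _ Rc, of "inv a" c] c C(1) ac by auto
          also have "\<dots> = Q"
            using conj_set_inv(1)[OF ac Qc] a(2) by simp
          finally show "inv a \<otimes> c \<in> C \<and> conj_set G (inv a \<otimes> c) R = Q"
            using YC[of "inv a" c] a(1) c(1) by simp
        qed
      qed
      then show ?thesis
        by (rule bij_betw_same_card)
    qed
    have im: "(\<lambda>c. conj_set G c R) ` C \<subseteq> ?S"
      using conj_sylow[OF Y(1) _ norm] R C(1) by blast
    have "card C = (\<Sum>Q \<in> ?S. card {c \<in> C. conj_set G c R = Q})"
      using sum.group[OF C(2) finS im, of "\<lambda>_. 1::nat"] by simp
    also have "\<dots> = card ?S * card (normalizer_in G C R)"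
      using fib by simp
    finally show ?thesis .
  qed
  have "?S \<noteq> {}"
    using sylow_exists[OF p Y] by blast
  then have "card ?S > 0"
    using finS by (simp add: card_gt_0_iff)
  \<comment> \<open>Summing \<open>cardC\<close> over all \<open>R\<close> leaves the positive
    factor \<open>card ?S\<close> on both sides, which is then cancelled.\<close>
  moreover have "card ?S * (\<Sum>R \<in> ?S. card (normalizer_in G C R)) = card ?S * card C"
  proof -
    have "card ?S * (\<Sum>R \<in> ?S. card (normalizer_in G C R)) = (\<Sum>R \<in> ?S. card C)"
      unfolding sum_distrib_left using cardC by (intro sum.cong refl) metis
    then show ?thesis
      by simp
  qed
  ultimately show ?thesis
    by simp
qed

section \<open>Supplements of normal subgroups with quotient cyclic modulo a prime\<close>

lemma finite_subgroups:
  assumes "finite (carrier G)"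
  shows "finite {U. subgroup U G \<and> P U}"
  by (rule finite_subset[of _ "Pow (carrier G)"]) (use assms subgroup.subset in auto)

lemma l_coset_normal:
  assumes L: "L \<lhd> G" and g: "g \<in> carrier G"
  shows "l_coset G g L \<subseteq> carrier G"
    and "\<And>x c. x \<in> L \<Longrightarrow> c \<in> l_coset G g L \<Longrightarrow> x \<otimes> c \<in> l_coset G g L"
proof -
  interpret L: normal L G by fact
  show "l_coset G g L \<subseteq> carrier G"
    using g by (auto simp: l_coset_def)
  show "x \<otimes> c \<in> l_coset G g L" if x: "x \<in> L" and "c \<in> l_coset G g L" for x c
  proof -
    obtain l where l: "l \<in> L" "c = g \<otimes> l"
      using \<open>c \<in> l_coset G g L\<close> by (auto simp: l_coset_def)
    have "x \<otimes> c = g \<otimes> (inv g \<otimes> x \<otimes> g \<otimes> l)"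
      using l g x by (simp add: m_assoc[symmetric])
    moreover have "inv g \<otimes> x \<otimes> g \<otimes> l \<in> L"
      using L.inv_op_closed1[OF g x] l by blast
    ultimately show ?thesis
      by (auto simp: l_coset_def)
  qed
qed

text \<open>The double count with \<open>D \<inter> L\<close> as \<open>Y\<close> and the part of
  \<open>g L\<close> in \<open>D\<close> as \<open>C\<close>: since \<open>L\<close> is normal, left
  multiplication by \<open>D \<inter> L\<close> preserves this part, and its elements normalize
  \<open>D \<inter> L\<close>. The part may be empty, and then both sides are 0.\<close>

lemma card_coset_sum_sylow:
  assumes fin: "finite (carrier G)" and p: "Factorial_Ring.prime p"
    and L: "L \<lhd> G" and g: "g \<in> carrier G" and D: "subgroup D G"
  shows "card (D \<inter> l_coset G g L) =
    (\<Sum>R | is_sylow p G (D \<inter> L) R. card (normalizer_in G D R \<inter> l_coset G g L))"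
proof -
  interpret L: normal L G by fact
  interpret D: subgroup D G by fact
  have "card (D \<inter> l_coset G g L) =
    (\<Sum>R | is_sylow p G (D \<inter> L) R. card (normalizer_in G (D \<inter> l_coset G g L) R))"
  proof (rule card_eq_sum_sylow_normalizers[OF p])
    show "subgroup (D \<inter> L) G"
      using subgroups_Inter_pair[OF D L.subgroup_axioms] .
    show "finite (D \<inter> L)" "finite (D \<inter> l_coset G g L)"
      using finite_subset[OF D.subset fin] by auto
    show "D \<inter> l_coset G g L \<subseteq> carrier G"
      using D.subset by blast
    show "y \<otimes> c \<in> D \<inter> l_coset G g L" if "y \<in> D \<inter> L" "c \<in> D \<inter> l_coset G g L" for y c
      using that l_coset_normal[OF L g] by blast
    show "conj_set G c (D \<inter> L) = D \<inter> L" if "c \<in> D \<inter> l_coset G g L" for c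
    proof -
      have c: "c \<in> D" "c \<in> carrier G"
        using that by auto
      have "conj_set G c (D \<inter> L) = conj_set G c D \<inter> conj_set G c L"
        unfolding conj_set_def using c by (intro inj_on_image_Int[OF inj_on_conj[of c "carrier G"]]) auto
      then show ?thesis
        using conj_set_self[OF D c(1)] normal_conj_set[OF L c(2)] by simp
    qed
  qed
  also have "\<dots> = (\<Sum>R | is_sylow p G (D \<inter> L) R. card (normalizer_in G D R \<inter> l_coset G g L))"
    by (intro sum.cong refl arg_cong[where f = card]) (auto simp: normalizer_in_def)
  finally show ?thesis .
qed

lemma normalizer_in_Int: "normalizer_in G (U \<inter> D) R = U \<inter> normalizer_in G D R"
  by (auto simp: normalizer_in_def)

text \<open>For \<open>R \<subseteq> U\<close> the group on the left is the normalizer of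
  \<open>R\<close> in \<open>U \<inter> D \<inter> L\<close>, and the normalizer criterion applies;
  otherwise both sides fail.\<close>

lemma sylow_Int_normalizer_iff:
  assumes fin: "finite (carrier G)" and p: "Factorial_Ring.prime p"
    and sub: "subgroup U G" "subgroup D G" "subgroup L G"
    and R: "subgroup R G" "R \<subseteq> D \<inter> L" "card R = p ^ k"
  shows "is_sylow p G (U \<inter> normalizer_in G D R \<inter> L) R \<longleftrightarrow> is_sylow p G (U \<inter> D \<inter> L) R"
proof (cases "R \<subseteq> U")
  case True
  have "subgroup (U \<inter> D \<inter> L) G" "finite (U \<inter> D \<inter> L)"
    using sub subgroups_Inter_pair finite_subset[OF subgroup.subset[OF sub(1)] fin] by auto
  moreover have "U \<inter> normalizer_in G D R \<inter> L = normalizer_in G (U \<inter> D \<inter> L) R"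
    by (auto simp: normalizer_in_def)
  ultimately show ?thesis
    using sylow_normalizer_iff[OF p _ _ R(1) _ R(3), of "U \<inter> D \<inter> L"] True R(2) by auto
next
  case False
  then show ?thesis
    by (auto simp: is_sylow_def)
qed

text \<open>The induction is downward on \<open>|Q|\<close>. Splitting \<open>|U \<inter> D \<inter> gL|\<close> over the Sylow subgroups \<open>R\<close> of
  \<open>U \<inter> D \<inter> L\<close>, which all contain \<open>Q\<close>, the term \<open>R = Q\<close> is the sum in question, and every larger \<open>R\<close>
  contributes the sum for \<open>R\<close> and its normalizer in \<open>D\<close>.\<close>

lemma sum_sylow_weights_zero:
  fixes w :: "'a set \<Rightarrow> int"
  assumes fin: "finite (carrier G)" and p: "Factorial_Ring.prime p"
    and L: "L \<lhd> G" and g: "g \<in> carrier G"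
    and w: "\<And>Q h k. subgroup Q G \<Longrightarrow> card Q = p ^ k \<Longrightarrow> h \<in> carrier G \<Longrightarrow> conj_set G h Q = Q \<Longrightarrow>
      (\<Sum>U | subgroup U G \<and> Q \<subseteq> U \<and> h \<in> U. w U) = 0"
    and D: "subgroup D G" and Q: "subgroup Q G" "card Q = p ^ k" "Q \<subseteq> D" "Q \<subseteq> L"
    and norm: "\<And>d. d \<in> D \<Longrightarrow> conj_set G d Q = Q"
  shows "(\<Sum>U | subgroup U G \<and> is_sylow p G (U \<inter> D \<inter> L) Q.
    w U * int (card (U \<inter> D \<inter> l_coset G g L))) = 0"
  using D Q norm
proof (induction "card L - card Q" arbitrary: D Q k rule: less_induct)
  case less
  interpret L: normal L G by fact
  interpret D: subgroup D G by fact
  interpret Q: subgroup Q G by fact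
  define S where "S = {U. subgroup U G \<and> Q \<subseteq> U}"
  \<comment> \<open>All candidates for \<open>R\<close> are collected independently of
    \<open>U\<close>, so that the sums over \<open>U\<close> and \<open>R\<close> can be
    interchanged.\<close>
  define \<R> where "\<R> = {R. subgroup R G \<and> Q \<subseteq> R \<and> R \<subseteq> D \<inter> L \<and> (\<exists>k. card R = p ^ k)}"
  define T where "T = (\<lambda>R. \<Sum>U | subgroup U G \<and> is_sylow p G (U \<inter> D \<inter> L) R.
    w U * int (card (U \<inter> normalizer_in G D R \<inter> l_coset G g L)))"
  have finS: "finite S" and finR: "finite \<R>"
    unfolding S_def \<R>_def by (rule finite_subgroups[OF fin])+
  have finD: "finite (D \<inter> l_coset G g L)"
    using finite_subset[OF D.subset fin] by simp
  have cardX: "card (U \<inter> D \<inter> l_coset G g L) = (\<Sum>R | R \<in> \<R> \<and> is_sylow p G (U \<inter> D \<inter> L) R.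
      card (U \<inter> normalizer_in G D R \<inter> l_coset G g L))" if U: "U \<in> S" for U
  proof -
    have XD: "subgroup (U \<inter> D) G" and XDL: "subgroup (U \<inter> D \<inter> L) G" and "Q \<subseteq> U"
      using U less.prems(1) subgroups_Inter_pair L.subgroup_axioms by (auto simp: S_def)
    \<comment> \<open>Some conjugate of \<open>Q\<close> under an element of \<open>D\<close> lies
      in \<open>R\<close>, and that conjugate is \<open>Q\<close> itself because \<open>D\<close>
      normalizes \<open>Q\<close>.\<close>
    have "Q \<subseteq> R" if R: "is_sylow p G (U \<inter> D \<inter> L) R" for R
    proof -
      have "finite (U \<inter> D \<inter> L)" "Q \<subseteq> U \<inter> D \<inter> L"
        using finite_subset[OF D.subset fin] less.prems \<open>Q \<subseteq> U\<close> by auto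
      then obtain a where "a \<in> U \<inter> D \<inter> L" "conj_set G a Q \<subseteq> R"
        using p_subgroup_conj_into_sylow[OF p XDL _ R less.prems(2)] less.prems(3) by blast
      then show ?thesis
        using less.prems(6) by simp
    qed
    then have "{R. is_sylow p G (U \<inter> D \<inter> L) R} = {R \<in> \<R>. is_sylow p G (U \<inter> D \<inter> L) R}"
      by (auto simp: \<R>_def is_sylow_def)
    then show ?thesis
      using card_coset_sum_sylow[OF fin p L g XD] by (simp add: normalizer_in_Int)
  qed
  \<comment> \<open>Counting the intersection element by element gives, for each \<open>h\<close> in
    \<open>D\<close> and \<open>g L\<close>, the sum of \<open>w\<close> over all \<open>U\<close>
    above \<open>Q\<close> and \<open>h\<close>. It vanishes by hypothesis, since \<open>h\<close>
    normalizes \<open>Q\<close>.\<close>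
  have "(\<Sum>U \<in> S. w U * int (card (U \<inter> D \<inter> l_coset G g L))) = 0"
  proof -
    have "(\<Sum>U \<in> S. w U * int (card (U \<inter> D \<inter> l_coset G g L))) =
        (\<Sum>U \<in> S. \<Sum>h | h \<in> D \<inter> l_coset G g L \<and> h \<in> U. w U)"
    proof (rule sum.cong[OF refl])
      fix U assume "U \<in> S"
      have "{h. h \<in> D \<inter> l_coset G g L \<and> h \<in> U} = U \<inter> D \<inter> l_coset G g L"
        by blast
      then show "w U * int (card (U \<inter> D \<inter> l_coset G g L)) = (\<Sum>h | h \<in> D \<inter> l_coset G g L \<and> h \<in> U. w U)"
        by simp
    qed
    also have "\<dots> = (\<Sum>h \<in> D \<inter> l_coset G g L. \<Sum>U | U \<in> S \<and> h \<in> U. w U)"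
      by (rule sum.swap_restrict[OF finS finD])
    also have "\<dots> = 0"
    proof (rule sum.neutral, rule ballI)
      fix h assume h: "h \<in> D \<inter> l_coset G g L"
      have "{U. U \<in> S \<and> h \<in> U} = {U. subgroup U G \<and> Q \<subseteq> U \<and> h \<in> U}"
        by (auto simp: S_def)
      then show "(\<Sum>U | U \<in> S \<and> h \<in> U. w U) = 0"
        using w[OF less.prems(2,3), of h] less.prems(6)[of h] h by simp
    qed
    finally show ?thesis .
  qed
  moreover have "(\<Sum>U \<in> S. w U * int (card (U \<inter> D \<inter> l_coset G g L))) = (\<Sum>R \<in> \<R>. T R)"
  proof -
    have "(\<Sum>U \<in> S. w U * int (card (U \<inter> D \<inter> l_coset G g L))) =
        (\<Sum>U \<in> S. \<Sum>R | R \<in> \<R> \<and> is_sylow p G (U \<inter> D \<inter> L) R.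
          w U * int (card (U \<inter> normalizer_in G D R \<inter> l_coset G g L)))"
      by (rule sum.cong[OF refl]) (simp add: cardX sum_distrib_left)
    also have "\<dots> = (\<Sum>R \<in> \<R>. \<Sum>U | U \<in> S \<and> is_sylow p G (U \<inter> D \<inter> L) R.
          w U * int (card (U \<inter> normalizer_in G D R \<inter> l_coset G g L)))"
      by (rule sum.swap_restrict[OF finS finR])
    also have "\<dots> = (\<Sum>R \<in> \<R>. T R)"
    proof (rule sum.cong[OF refl])
      fix R assume "R \<in> \<R>"
      then have "{U. U \<in> S \<and> is_sylow p G (U \<inter> D \<inter> L) R} =
          {U. subgroup U G \<and> is_sylow p G (U \<inter> D \<inter> L) R}"
        by (auto simp: S_def \<R>_def is_sylow_def)
      then show "(\<Sum>U | U \<in> S \<and> is_sylow p G (U \<inter> D \<inter> L) R.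
          w U * int (card (U \<inter> normalizer_in G D R \<inter> l_coset G g L))) = T R"
        by (simp add: T_def)
    qed
    finally show ?thesis .
  qed
  moreover have "T R = 0" if R: "R \<in> \<R> - {Q}" for R
  proof -
    obtain j where R': "subgroup R G" "Q \<subset> R" "R \<subseteq> D \<inter> L" "card R = p ^ j"
      using R by (auto simp: \<R>_def)
    have "card Q < card R" "card R \<le> card L"
      using R' finite_subset[OF L.subset fin] psubset_card_mono[of R Q] card_mono[of L R]
        finite_subset[of R L] by auto
    then have "card L - card R < card L - card Q"
      by simp
    moreover have "subgroup (normalizer_in G D R) G"
      using normalizer_in_subgroup[OF less.prems(1)] subgroup.subset[OF R'(1)] by simp
    moreover have "R \<subseteq> normalizer_in G D R"
      using R' conj_set_self[OF R'(1)] by (auto simp: normalizer_in_def)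
    ultimately have "(\<Sum>U | subgroup U G \<and> is_sylow p G (U \<inter> normalizer_in G D R \<inter> L) R.
      w U * int (card (U \<inter> normalizer_in G D R \<inter> l_coset G g L))) = 0"
      using R' by (intro less.hyps[of R "normalizer_in G D R" j]) (simp_all add: normalizer_in_def)
    \<comment> \<open>In the induction hypothesis \<open>D\<close> is replaced by the normalizer of
      \<open>R\<close> also in the range of summation, while \<open>T R\<close> has
      \<open>U \<inter> D \<inter> L\<close> there; both select the same \<open>U\<close>.\<close>
    moreover have "is_sylow p G (U \<inter> normalizer_in G D R \<inter> L) R \<longleftrightarrow> is_sylow p G (U \<inter> D \<inter> L) R"
      if "subgroup U G" for U
      by (rule sylow_Int_normalizer_iff[OF fin p that less.prems(1) L.subgroup_axioms R'(1,3,4)])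
    then have "{U. subgroup U G \<and> is_sylow p G (U \<inter> normalizer_in G D R \<inter> L) R} =
        {U. subgroup U G \<and> is_sylow p G (U \<inter> D \<inter> L) R}"
      by blast
    ultimately show ?thesis
      by (simp add: T_def)
  qed
  moreover have "Q \<in> \<R>"
    using less.prems by (auto simp: \<R>_def)
  ultimately have "T Q = 0"
    using sum.remove[OF finR, of Q T] sum.neutral[of "\<R> - {Q}" T] by auto
  moreover have "normalizer_in G D Q = D"
    using less.prems(6) by (auto simp: normalizer_in_def)
  ultimately show ?case
    by (simp add: T_def)
qed

text \<open>The index of \<open>R N\<close> in \<open>L\<close> is a power of \<open>p\<close> and divides the index of \<open>R\<close> in \<open>U \<inter> L\<close>, which is
  prime to \<open>p\<close>.\<close>

lemma sylow_supplement:
  assumes fin: "finite (carrier G)" and p: "Factorial_Ring.prime p"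
    and N: "N \<lhd> G" and L: "L \<lhd> G" "N \<subseteq> L" "card L = card N * p ^ k"
    and U: "subgroup U G" "U <#> N = carrier G" and R: "is_sylow p G (U \<inter> L) R"
  shows "R <#> N = L"
proof -
  interpret N: normal N G by fact
  interpret L: normal L G by fact
  interpret U: subgroup U G by fact
  have R': "subgroup R G" "R \<subseteq> U" "R \<subseteq> L"
    using R by (auto simp: is_sylow_def)
  interpret R: subgroup R G by fact
  have finH: "finite H" if "H \<subseteq> carrier G" for H
    using finite_subset[OF that fin] .
  have fins: "finite N" "finite L" "finite U" "finite R"
    using finH N.subset L.subset U.subset R.subset by auto
  obtain j n where n: "card R = p ^ j" "card (U \<inter> L) = card R * n" "\<not> p dvd n"
    using R unfolding is_sylow_def by metis
  have XL: "subgroup (U \<inter> L) G" and XN: "subgroup (U \<inter> N) G" and RN: "subgroup (R \<inter> N) G"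
    using subgroups_Inter_pair U L.subgroup_axioms N.subgroup_axioms R'(1) by auto
  have sRN: "subgroup (R <#> N) G"
    using mult_norm_subgroup[OF N R'(1)] commut_normal[OF R'(1) N] by simp
  have RNL: "R <#> N \<subseteq> L"
    using R'(3) L(2) by (auto simp: set_mult_def)
  \<comment> \<open>Dedekind's modular law for \<open>N \<subseteq> L\<close>.\<close>
  have XLN: "(U \<inter> L) <#> N = L"
  proof
    show "(U \<inter> L) <#> N \<subseteq> L"
      using L(2) by (auto simp: set_mult_def)
    show "L \<subseteq> (U \<inter> L) <#> N"
    proof
      fix l assume l: "l \<in> L"
      then have "l \<in> U <#> N"
        using U(2) L.subset by auto
      then obtain x n where xn: "x \<in> U" "n \<in> N" "l = x \<otimes> n"
        by (auto simp: set_mult_def)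
      have "x = l \<otimes> inv n"
        using xn by (simp add: m_assoc)
      then have "x \<in> L"
        using l xn(2) L(2) by auto
      with xn show "l \<in> (U \<inter> L) <#> N"
        by (auto simp: set_mult_def)
    qed
  qed
  have 1: "card (U \<inter> L) * card N = card L * card (U \<inter> N)"
  proof -
    have "U \<inter> L \<inter> N = U \<inter> N"
      using L(2) by blast
    then show ?thesis
      using card_set_mult[OF XL N.subgroup_axioms] fins XLN by simp
  qed
  have 2: "card R * card N = card (R <#> N) * card (R \<inter> N)"
    using card_set_mult[OF R'(1) N.subgroup_axioms] fins by simp
  obtain r where r: "card (U \<inter> N) = card (R \<inter> N) * r"
    using card_subgroup_dvd[OF RN XN] R'(2) by (auto elim: dvdE)
  obtain t where t: "card L = card (R <#> N) * t"
    using card_subgroup_dvd[OF sRN L.subgroup_axioms RNL] by (auto elim: dvdE)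
  obtain s where s: "card (R <#> N) = card N * s"
    using card_subgroup_dvd[OF N.subgroup_axioms sRN subset_set_mult(2)[OF R'(1) N.subgroup_axioms]]
    by (auto elim: dvdE)
  have pos: "card N > 0" "card R > 0"
    using fins N.subgroup_axioms R.subgroup_axioms subgroup_nonempty[of G] by (auto simp: card_gt_0_iff)
  have "card N * (s * t) = card N * p ^ k"
    using L(3) s t by (metis mult.assoc)
  then have "s * t = p ^ k"
    using pos by simp
  then obtain i where i: "t = p ^ i"
    using p by (metis divides_primepow_nat dvd_triv_right)
  \<comment> \<open>The two product formulas split the index \<open>n\<close> of \<open>R\<close> in
    \<open>U \<inter> L\<close> into the index \<open>t\<close> of \<open>R <#> N\<close> in
    \<open>L\<close> and the index \<open>r\<close> of \<open>R \<inter> N\<close> in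
    \<open>U \<inter> N\<close>.\<close>
  have "card R * card N * n = card L * card (U \<inter> N)"
    using 1 unfolding n(2) by (simp only: mult_ac)
  also have "\<dots> = card (R <#> N) * card (R \<inter> N) * (t * r)"
    unfolding t r by (simp only: mult_ac)
  also have "\<dots> = card R * card N * (t * r)"
    by (simp only: 2)
  finally have "n = t * r"
    using pos by simp
  then have "\<not> p dvd t"
    using n(3) by (metis dvd_mult2)
  then have "t = 1"
    using i by (metis dvd_power not_gr_zero power_0)
  then show ?thesis
    using card_subset_eq[OF fins(2) RNL] t by simp
qed

text \<open>The analogue of Baumann's theorem, for arbitrary weights with vanishing sums above each
  admissible pair \<open>Q\<close>, \<open>h\<close>. Working in the coset \<open>g L\<close> keeps
  the condition on \<open>U <#> N\<close> out of the recursion: it becomes the condition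
  \<open>R <#> N = L\<close> on the Sylow subgroup alone.\<close>

theorem sum_weights_supplements_zero:
  fixes w :: "'a set \<Rightarrow> int"
  assumes fin: "finite (carrier G)" and p: "Factorial_Ring.prime p"
    and N: "N \<lhd> G" and L: "L \<lhd> G" "N \<subseteq> L" "card L = card N * p ^ k"
    and g: "g \<in> carrier G" and gen: "\<And>K. subgroup K G \<Longrightarrow> L \<subseteq> K \<Longrightarrow> g \<in> K \<Longrightarrow> K = carrier G"
    and w: "\<And>Q h k. subgroup Q G \<Longrightarrow> card Q = p ^ k \<Longrightarrow> h \<in> carrier G \<Longrightarrow> conj_set G h Q = Q \<Longrightarrow>
      (\<Sum>U | subgroup U G \<and> Q \<subseteq> U \<and> h \<in> U. w U) = 0"
  shows "(\<Sum>U | subgroup U G \<and> U <#> N = carrier G. w U * int (card U)) = 0"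
proof -
  interpret N: normal N G by fact
  interpret L: normal L G by fact
  define S where "S = {U. subgroup U G \<and> U <#> N = carrier G}"
  define \<R> where "\<R> = {R. subgroup R G \<and> R \<subseteq> L \<and> R <#> N = L \<and> (\<exists>k. card R = p ^ k)}"
  define T where "T = (\<lambda>R. \<Sum>U | subgroup U G \<and> is_sylow p G (U \<inter> L) R.
    w U * int (card (U \<inter> normalizer_in G (carrier G) R \<inter> l_coset G g L)))"
  have finS: "finite S" and finR: "finite \<R>"
    unfolding S_def \<R>_def by (rule finite_subgroups[OF fin])+
  have finL: "finite L" and finN: "finite N"
    using finite_subset[OF L.subset fin] finite_subset[OF N.subset fin] .
  have cardX: "card (U \<inter> l_coset G g L) = (\<Sum>R | R \<in> \<R> \<and> is_sylow p G (U \<inter> L) R.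
      card (U \<inter> normalizer_in G (carrier G) R \<inter> l_coset G g L))" if U: "U \<in> S" for U
  proof -
    have U': "subgroup U G" "U <#> N = carrier G"
      using U by (auto simp: S_def)
    have "R <#> N = L" if R: "is_sylow p G (U \<inter> L) R" for R
      by (rule sylow_supplement[OF fin p N L U' R])
    then have "{R. is_sylow p G (U \<inter> L) R} = {R \<in> \<R>. is_sylow p G (U \<inter> L) R}"
      by (auto simp: \<R>_def is_sylow_def)
    moreover have "normalizer_in G U R = U \<inter> normalizer_in G (carrier G) R" for R
      using subgroup.subset[OF U'(1)] by (auto simp: normalizer_in_def)
    ultimately show ?thesis
      using card_coset_sum_sylow[OF fin p L(1) g U'(1)] by simp
  qed
  have "(\<Sum>U \<in> S. w U * int (card (U \<inter> l_coset G g L))) =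
      (\<Sum>U \<in> S. \<Sum>R | R \<in> \<R> \<and> is_sylow p G (U \<inter> L) R.
        w U * int (card (U \<inter> normalizer_in G (carrier G) R \<inter> l_coset G g L)))"
    by (rule sum.cong[OF refl]) (simp add: cardX sum_distrib_left)
  also have "\<dots> = (\<Sum>R \<in> \<R>. \<Sum>U | U \<in> S \<and> is_sylow p G (U \<inter> L) R.
        w U * int (card (U \<inter> normalizer_in G (carrier G) R \<inter> l_coset G g L)))"
    by (rule sum.swap_restrict[OF finS finR])
  also have "\<dots> = (\<Sum>R \<in> \<R>. T R)"
  proof (rule sum.cong[OF refl])
    fix R assume R: "R \<in> \<R>"
    \<comment> \<open>\<open>T R\<close> also admits \<open>U\<close> that are not supplements, but
      these avoid \<open>g L\<close>: if \<open>U\<close> meets \<open>g L\<close>, then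
      \<open>U <#> N\<close> contains both \<open>R <#> N = L\<close> and \<open>g\<close>, and is
      everything by \<open>gen\<close>.\<close>
    show "(\<Sum>U | U \<in> S \<and> is_sylow p G (U \<inter> L) R.
        w U * int (card (U \<inter> normalizer_in G (carrier G) R \<inter> l_coset G g L))) = T R"
      unfolding T_def
    proof (rule sum.mono_neutral_left[OF finite_subgroups[OF fin]])
      show "{U. U \<in> S \<and> is_sylow p G (U \<inter> L) R} \<subseteq> {U. subgroup U G \<and> is_sylow p G (U \<inter> L) R}"
        by (auto simp: S_def)
      show "\<forall>U \<in> {U. subgroup U G \<and> is_sylow p G (U \<inter> L) R} - {U. U \<in> S \<and> is_sylow p G (U \<inter> L) R}.
        w U * int (card (U \<inter> normalizer_in G (carrier G) R \<inter> l_coset G g L)) = 0"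
      proof
        fix U assume "U \<in> {U. subgroup U G \<and> is_sylow p G (U \<inter> L) R} - {U. U \<in> S \<and> is_sylow p G (U \<inter> L) R}"
        then have U: "subgroup U G" "is_sylow p G (U \<inter> L) R" and nS: "U \<notin> S"
          by auto
        interpret U: subgroup U G by fact
        have "U \<inter> l_coset G g L = {}"
        proof (rule ccontr)
          assume "U \<inter> l_coset G g L \<noteq> {}"
          then obtain l where l: "l \<in> L" "g \<otimes> l \<in> U"
            by (auto simp: l_coset_def)
          have sUN: "subgroup (U <#> N) G"
            using mult_norm_subgroup[OF N U(1)] commut_normal[OF U(1) N] by simp
          have "R \<subseteq> U"
            using U(2) by (auto simp: is_sylow_def)
          then have LXN: "L \<subseteq> U <#> N"
            using R mono_set_mult[of R U N N G] by (auto simp: \<R>_def)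
          have "g \<otimes> l \<in> U <#> N"
            using l(2) subset_set_mult(1)[OF U(1) N.subgroup_axioms] by blast
          moreover have "g = (g \<otimes> l) \<otimes> inv l"
            using g l by (simp add: m_assoc)
          ultimately have "g \<in> U <#> N"
            using l(1) LXN subgroup.m_closed[OF sUN] subgroup.m_inv_closed[OF sUN] by (metis subsetD)
          then have "U \<in> S"
            using gen[OF sUN LXN] U(1) by (simp add: S_def)
          then show False
            using nS by simp
        qed
        then have "U \<inter> normalizer_in G (carrier G) R \<inter> l_coset G g L = {}"
          by blast
        then show "w U * int (card (U \<inter> normalizer_in G (carrier G) R \<inter> l_coset G g L)) = 0"
          by simp
      qed
    qed
  qed
  also have "\<dots> = 0"
  proof (rule sum.neutral, rule ballI)
    fix R assume "R \<in> \<R>"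
    then obtain j where R: "subgroup R G" "R \<subseteq> L" "card R = p ^ j"
      by (auto simp: \<R>_def)
    have Rc: "R \<subseteq> carrier G"
      using subgroup.subset[OF R(1)] .
    let ?D = "normalizer_in G (carrier G) R"
    have D: "subgroup ?D G" "R \<subseteq> ?D"
      using normalizer_in_subgroup[OF subgroup_self Rc] conj_set_self[OF R(1)] Rc
      by (auto simp: normalizer_in_def)
    have "(\<Sum>U | subgroup U G \<and> is_sylow p G (U \<inter> ?D \<inter> L) R. w U * int (card (U \<inter> ?D \<inter> l_coset G g L))) = 0"
      by (rule sum_sylow_weights_zero[OF fin p L(1) g w D(1) R(1,3) D(2) R(2)])
        (auto simp: normalizer_in_def)
    moreover have "is_sylow p G (U \<inter> ?D \<inter> L) R \<longleftrightarrow> is_sylow p G (U \<inter> L) R" if U: "subgroup U G" for U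
    proof -
      have "U \<inter> carrier G = U" "R \<subseteq> carrier G \<inter> L"
        using subgroup.subset[OF U] Rc R(2) by auto
      then show ?thesis
        using sylow_Int_normalizer_iff[OF fin p U subgroup_self L.subgroup_axioms R(1) _ R(3)] by simp
    qed
    then have "{U. subgroup U G \<and> is_sylow p G (U \<inter> ?D \<inter> L) R} =
        {U. subgroup U G \<and> is_sylow p G (U \<inter> L) R}"
      by blast
    ultimately show "T R = 0"
      by (simp add: T_def)
  qed
  finally have *: "(\<Sum>U \<in> S. w U * int (card (U \<inter> l_coset G g L))) = 0" .
  \<comment> \<open>Write g = x n with x in \<open>U\<close> and n in \<open>N\<close>. As
    \<open>N \<subseteq> L\<close>, the part of \<open>g L\<close> in \<open>U\<close> is the coset
    of \<open>U \<inter> L\<close> by x, so it has the size of \<open>U \<inter> L\<close>; the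
    product formula for \<open>U <#> L\<close> does the rest.\<close>
  have "card U * card L = card (U \<inter> l_coset G g L) * card (carrier G)" if "U \<in> S" for U
  proof -
    have U: "subgroup U G" "U <#> N = carrier G"
      using that by (auto simp: S_def)
    interpret U: subgroup U G by fact
    have "U <#> L = carrier G"
    proof
      show "U <#> L \<subseteq> carrier G"
        using U.subset L.subset by (rule setmult_subset_G)
      show "carrier G \<subseteq> U <#> L"
        using U(2) mono_set_mult[of U U N L G] L(2) by simp
    qed
    then have "card U * card L = card (carrier G) * card (U \<inter> L)"
      using card_set_mult[OF U(1) L.subgroup_axioms finite_subset[OF U.subset fin] finL] by simp
    moreover have "g \<in> U <#> N"
      using U(2) g by simp
    then obtain x n where xn: "x \<in> U" "n \<in> N" "g = x \<otimes> n"
      by (auto simp: set_mult_def)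
    have "bij_betw (\<lambda>l. x \<otimes> l) (U \<inter> L) (U \<inter> l_coset G g L)"
    proof (rule bij_betw_byWitness[where f' = "\<lambda>c. inv x \<otimes> c"])
      show "\<forall>l\<in>U \<inter> L. inv x \<otimes> (x \<otimes> l) = l" "\<forall>c\<in>U \<inter> l_coset G g L. x \<otimes> (inv x \<otimes> c) = c"
        using xn(1) by (auto simp: m_assoc[symmetric])
      show "(\<lambda>l. x \<otimes> l) ` (U \<inter> L) \<subseteq> U \<inter> l_coset G g L"
      proof clarify
        fix l assume l: "l \<in> U" "l \<in> L"
        have "x \<otimes> l = g \<otimes> (inv n \<otimes> l)"
        proof -
          have "n \<otimes> (inv n \<otimes> l) = l"
            using xn(2) l(2) by (simp add: m_assoc[symmetric])
          then show ?thesis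
            using xn l by (simp add: m_assoc)
        qed
        moreover have "inv n \<otimes> l \<in> L"
          using xn(2) L(2) l(2) by auto
        moreover have "x \<otimes> l \<in> U"
          using l(1) xn(1) by simp
        ultimately show "x \<otimes> l \<in> U \<inter> l_coset G g L"
          unfolding l_coset_def by blast
      qed
      show "(\<lambda>c. inv x \<otimes> c) ` (U \<inter> l_coset G g L) \<subseteq> U \<inter> L"
      proof clarify
        fix c assume c: "c \<in> U" "c \<in> l_coset G g L"
        then obtain l where l: "l \<in> L" "c = g \<otimes> l"
          by (auto simp: l_coset_def)
        have "inv x \<otimes> c = n \<otimes> l"
          using xn l by (simp add: m_assoc[symmetric])
        moreover have "n \<otimes> l \<in> L"
          using xn(2) L(2) l(1) by auto
        moreover have "inv x \<otimes> c \<in> U"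
          using c(1) xn(1) by simp
        ultimately show "inv x \<otimes> c \<in> U \<inter> L"
          by simp
      qed
    qed
    then have "card (U \<inter> l_coset G g L) = card (U \<inter> L)"
      using bij_betw_same_card by fastforce
    ultimately show ?thesis
      by simp
  qed
  then have "int (card U) * int (card L) = int (card (U \<inter> l_coset G g L)) * int (card (carrier G))" if "U \<in> S" for U
    using that by (metis of_nat_mult)
  then have "(\<Sum>U \<in> S. w U * int (card U)) * int (card L) =
      (\<Sum>U \<in> S. w U * int (card (U \<inter> l_coset G g L))) * int (card (carrier G))"
    unfolding sum_distrib_right by (intro sum.cong refl) (simp add: mult.assoc)
  moreover have "card L > 0"
    using finL L.subgroup_axioms subgroup_nonempty[of G] by (auto simp: card_gt_0_iff)
  ultimately show ?thesis
    using * by (simp add: S_def)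
qed

end

section \<open>Sums over the Moebius function\<close>

context group
begin

lemma mobius_carrier:
  assumes "finite (carrier G)"
  shows "subgroup_mobius G (carrier G) = 1"
  using assms by (subst subgroup_mobius.simps) simp

lemma sum_mobius_above:
  assumes fin: "finite (carrier G)" and K: "subgroup K G" "K \<noteq> carrier G"
  shows "(\<Sum>U | subgroup U G \<and> K \<subseteq> U. subgroup_mobius G U) = 0"
proof -
  have eq: "{U. subgroup U G \<and> K \<subseteq> U} = insert K {U. subgroup U G \<and> K \<subset> U}"
    using K(1) by auto
  have "subgroup_mobius G K = - (\<Sum>U | subgroup U G \<and> K \<subset> U. subgroup_mobius G U)"
    using fin K subgroup.subset[OF K(1)] by (subst subgroup_mobius.simps) simp
  then show ?thesis
    unfolding eq using finite_subgroups[OF fin] by simp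
qed

lemma sum_mobius_above_subset:
  assumes fin: "finite (carrier G)" and B: "B \<subseteq> carrier G" "generate G B \<noteq> carrier G"
  shows "(\<Sum>U | subgroup U G \<and> B \<subseteq> U. subgroup_mobius G U) = 0"
proof -
  have "{U. subgroup U G \<and> B \<subseteq> U} = {U. subgroup U G \<and> generate G B \<subseteq> U}"
    using generate_subgroup_incl[of B] generate.incl[of _ B G] by blast
  then show ?thesis
    using sum_mobius_above[OF fin generate_is_subgroup[OF B(1)] B(2)] by simp
qed

text \<open>A version of Weisner's theorem, relative to the interval above \<open>C\<close>.\<close>

lemma sum_mobius_Int_fibre:
  assumes fin: "finite (carrier G)" and C: "subgroup C G"
    and T: "subgroup T G" "T \<noteq> carrier G" and Y: "subgroup Y G" "C \<subseteq> Y" "Y \<subseteq> T"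
  shows "(\<Sum>U | subgroup U G \<and> C \<subseteq> U \<and> U \<inter> T = Y. subgroup_mobius G U) = 0"
  using Y
proof (induction "card T - card Y" arbitrary: Y rule: less_induct)
  case less
  define f where "f = (\<lambda>Y. \<Sum>U | subgroup U G \<and> C \<subseteq> U \<and> U \<inter> T = Y. subgroup_mobius G U)"
  define VV where "VV = {V. subgroup V G \<and> Y \<subseteq> V \<and> V \<subseteq> T}"
  have finVV: "finite VV"
    unfolding VV_def by (rule finite_subgroups[OF fin])
  have finT: "finite T"
    using finite_subset[OF subgroup.subset[OF T(1)] fin] .
  have "Y \<noteq> carrier G"
    using less.prems(3) T subgroup.subset[OF T(1)] by auto
  \<comment> \<open>The subgroups above \<open>Y\<close> are sorted by their intersection with
    \<open>T\<close>; the induction hypothesis removes every class except that of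
    \<open>Y\<close>.\<close>
  then have "0 = (\<Sum>U | subgroup U G \<and> Y \<subseteq> U. subgroup_mobius G U)"
    using sum_mobius_above[OF fin less.prems(1)] by simp
  also have "\<dots> = (\<Sum>V \<in> VV. \<Sum>U \<in> {U \<in> {U. subgroup U G \<and> Y \<subseteq> U}. U \<inter> T = V}. subgroup_mobius G U)"
    using less.prems(3) subgroups_Inter_pair[OF _ T(1)]
    by (intro sum.group[symmetric] finite_subgroups[OF fin] finVV) (auto simp: VV_def)
  also have "\<dots> = (\<Sum>V \<in> VV. f V)"
    unfolding f_def using less.prems by (intro sum.cong refl) (auto simp: VV_def)
  also have "\<dots> = f Y"
  proof -
    have "f V = 0" if V: "V \<in> VV - {Y}" for V
    proof -
      have V': "subgroup V G" "Y \<subset> V" "V \<subseteq> T"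
        using V by (auto simp: VV_def)
      have "card Y < card V" "card V \<le> card T"
        using V' finT psubset_card_mono[of V Y] card_mono[of T V] finite_subset[of V T] by auto
      then show ?thesis
        unfolding f_def using V' less.prems(2) by (intro less.hyps) auto
    qed
    moreover have "Y \<in> VV"
      using less.prems by (simp add: VV_def)
    ultimately show ?thesis
      using sum.remove[OF finVV, of Y f] sum.neutral[of "VV - {Y}" f] by auto
  qed
  finally show ?case
    by (simp add: f_def)
qed

text \<open>The factor \<Phi> is constant on the fibres of intersection with \<open>T\<close>, and
  on each fibre the Moebius values sum to 0. This is the form in which Weisner's theorem is used
  below.\<close>

lemma sum_mobius_Int:
  fixes \<Phi> :: "'a set \<Rightarrow> int"
  assumes fin: "finite (carrier G)" and C: "subgroup C G"
    and T: "subgroup T G" "T \<noteq> carrier G" "C \<subseteq> T"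
  shows "(\<Sum>U | subgroup U G \<and> C \<subseteq> U. subgroup_mobius G U * \<Phi> (U \<inter> T)) = 0"
proof -
  define S where "S = {U. subgroup U G \<and> C \<subseteq> U}"
  have finS: "finite S"
    unfolding S_def by (rule finite_subgroups[OF fin])
  have "(\<Sum>U \<in> S. subgroup_mobius G U * \<Phi> (U \<inter> T)) =
      (\<Sum>V \<in> (\<lambda>U. U \<inter> T) ` S. \<Sum>U \<in> {U \<in> S. U \<inter> T = V}. subgroup_mobius G U * \<Phi> (U \<inter> T))"
    by (rule sum.image_gen[OF finS])
  also have "\<dots> = 0"
  proof (rule sum.neutral, rule ballI)
    fix V assume "V \<in> (\<lambda>U. U \<inter> T) ` S"
    then have V: "subgroup V G" "C \<subseteq> V" "V \<subseteq> T"
      using subgroups_Inter_pair[OF _ T(1)] T(3) by (auto simp: S_def)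
    have "{U \<in> S. U \<inter> T = V} = {U. subgroup U G \<and> C \<subseteq> U \<and> U \<inter> T = V}"
      by (auto simp: S_def)
    moreover have "(\<Sum>U \<in> {U \<in> S. U \<inter> T = V}. subgroup_mobius G U * \<Phi> (U \<inter> T)) =
        (\<Sum>U \<in> {U \<in> S. U \<inter> T = V}. subgroup_mobius G U) * \<Phi> V"
      unfolding sum_distrib_right by (intro sum.cong refl) auto
    ultimately show "(\<Sum>U \<in> {U \<in> S. U \<inter> T = V}. subgroup_mobius G U * \<Phi> (U \<inter> T)) = 0"
      using sum_mobius_Int_fibre[OF fin C T(1,2) V] by simp
  qed
  finally show ?thesis
    by (simp add: S_def)
qed

end

section \<open>Moving supplement sums along an epimorphism\<close>

context group_hom
begin

definition preimage :: "'c set \<Rightarrow> 'a set" where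
  "preimage V = {g \<in> carrier G. h g \<in> V}"

lemma subgroup_preimage:
  assumes "subgroup V H"
  shows "subgroup (preimage V) G"
proof -
  interpret V: subgroup V H by fact
  show ?thesis
    by (rule G.subgroupI) (use V.one_closed in \<open>auto simp: preimage_def intro!: exI[of _ "\<one>\<^bsub>G\<^esub>"]\<close>)
qed

lemma kernel_subset_preimage:
  assumes "subgroup V H"
  shows "kernel G H h \<subseteq> preimage V"
  using subgroup.one_closed[OF assms] by (auto simp: kernel_def preimage_def)

lemma image_preimage:
  assumes "h ` carrier G = carrier H" "V \<subseteq> carrier H"
  shows "h ` preimage V = V"
proof
  show "h ` preimage V \<subseteq> V"
    by (auto simp: preimage_def)
  show "V \<subseteq> h ` preimage V"
  proof
    fix x assume "x \<in> V"
    moreover from this obtain g where "g \<in> carrier G" "x = h g"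
      using assms by blast
    ultimately show "x \<in> h ` preimage V"
      by (simp add: preimage_def)
  qed
qed

lemma preimage_image:
  assumes U: "subgroup U G" "kernel G H h \<subseteq> U"
  shows "preimage (h ` U) = U"
proof
  interpret U: subgroup U G by fact
  show "U \<subseteq> preimage (h ` U)"
    by (auto simp: preimage_def)
  show "preimage (h ` U) \<subseteq> U"
  proof
    fix g assume "g \<in> preimage (h ` U)"
    then obtain u where u: "g \<in> carrier G" "u \<in> U" "h g = h u"
      by (auto simp: preimage_def)
    then have "inv\<^bsub>G\<^esub> u \<otimes>\<^bsub>G\<^esub> g \<in> kernel G H h"
      by (simp add: kernel_def)
    then have "u \<otimes>\<^bsub>G\<^esub> (inv\<^bsub>G\<^esub> u \<otimes>\<^bsub>G\<^esub> g) \<in> U"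
      using U(2) u(2) by blast
    then show "g \<in> U"
      using u by (simp add: G.m_assoc[symmetric])
  qed
qed

lemma card_preimage:
  assumes fin: "finite (carrier G)" and surj: "h ` carrier G = carrier H" and V: "subgroup V H"
  shows "card (preimage V) = card V * card (kernel G H h)"
proof -
  interpret V: subgroup V H by fact
  have im: "h ` preimage V = V"
    by (rule image_preimage[OF surj V.subset])
  have "card (preimage V) = card (h ` preimage V) * card (kernel G H h)"
  proof (rule card_fibres)
    show "finite (preimage V)"
      using fin by (simp add: preimage_def)
    show "card {a \<in> preimage V. h a = b} = card (kernel G H h)" if b: "b \<in> h ` preimage V" for b
    proof -
      obtain a where a: "a \<in> carrier G" "h a = b" "b \<in> V"
        using b by (auto simp: preimage_def)
      have "bij_betw (\<lambda>c. a \<otimes>\<^bsub>G\<^esub> c) (kernel G H h) {x \<in> preimage V. h x = b}"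
        by (rule bij_betw_byWitness[where f' = "\<lambda>x. inv\<^bsub>G\<^esub> a \<otimes>\<^bsub>G\<^esub> x"])
          (use a in \<open>auto simp: kernel_def preimage_def G.m_assoc[symmetric]\<close>)
      then show ?thesis
        using bij_betw_same_card by fastforce
    qed
  qed
  then show ?thesis
    by (simp add: im)
qed

text \<open>The hypotheses separate the two sources of vanishing: \<open>J\<close> will come from
  the Sylow count in the image, and \<open>no\<close> from the solvability of the quotient by
  \<open>N\<close>. The weights on subgroups of \<open>H\<close> are Moebius values in
  \<open>G\<close>, so the reindexing along \<open>preimage\<close> is a plain bijection.\<close>

lemma sum_mobius_supplements_zero:
  assumes fin: "finite (carrier G)" and surj: "h ` carrier G = carrier H"
    and N: "N \<lhd> G"
    and J: "\<And>J. J \<lhd> H \<Longrightarrow> J \<noteq> {\<one>\<^bsub>H\<^esub>} \<Longrightarrow>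
      (\<Sum>V | subgroup V H \<and> V <#>\<^bsub>H\<^esub> J = carrier H. subgroup_mobius G (preimage V) * int (card V)) = 0"
    and no: "\<And>U. subgroup U G \<Longrightarrow> U <#> N = carrier G \<Longrightarrow> h ` U = carrier H \<Longrightarrow> \<not> U \<inter> N \<subseteq> kernel G H h"
  shows "(\<Sum>U | subgroup U G \<and> U <#> N = carrier G. subgroup_mobius G U * int (card U)) = 0"
proof -
  interpret N: normal N G by fact
  let ?\<mu> = "subgroup_mobius G"
  let ?C = "kernel G H h"
  define S where "S = {U. subgroup U G}"
  define SC where "SC = {U. subgroup U G \<and> ?C \<subseteq> U}"
  define F where "F = (\<lambda>U. if U <#> N = carrier G then int (card U) else 0)"
  have finS: "finite S" and finSC: "finite SC"
    unfolding S_def SC_def using G.finite_subgroups[OF fin, of "\<lambda>_. True"] G.finite_subgroups[OF fin] by simp_all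
  have C: "subgroup ?C G"
    by (rule subgroup_kernel)
  have G_SC: "carrier G \<in> SC"
    using G.subgroup_self by (auto simp: SC_def kernel_def)
  have inner: "(\<Sum>Z \<in> SC. ?\<mu> Z * F (U \<inter> Z)) = 0" if U: "subgroup U G" for U
  proof -
    interpret U: subgroup U G by fact
    consider "h ` U \<noteq> carrier H" | "U <#> N \<noteq> carrier G" | "h ` U = carrier H" "U <#> N = carrier G"
      by blast
    then show ?thesis
    proof cases
      case 1
      \<comment> \<open>\<open>?T\<close> is the product of \<open>U\<close> with the kernel, here a
        proper subgroup. Since \<open>U \<subseteq> ?T\<close>, the set \<open>U \<inter> Z\<close>
        depends on \<open>Z\<close> only through \<open>Z \<inter> ?T\<close>, and Weisner's theorem
        applies above the kernel.\<close>
      let ?T = "preimage (h ` U)"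
      have hU: "subgroup (h ` U) H"
        by (rule subgroup_img_is_subgroup[OF U])
      have "?T \<noteq> carrier G"
        using 1 surj image_preimage[OF surj subgroup.subset[OF hU]] by metis
      moreover have "U \<subseteq> ?T"
        by (auto simp: preimage_def)
      then have "U \<inter> Z = U \<inter> (Z \<inter> ?T)" for Z
        by blast
      ultimately show ?thesis
        using G.sum_mobius_Int[OF fin C subgroup_preimage[OF hU] _ kernel_subset_preimage[OF hU],
            of "\<lambda>Y. F (U \<inter> Y)"] by (simp add: SC_def)
    next
      case 2
      have "(U \<inter> Z) <#> N \<noteq> carrier G" for Z
      proof
        assume "(U \<inter> Z) <#> N = carrier G"
        then have "carrier G \<subseteq> U <#> N"
          using mono_set_mult[of "U \<inter> Z" U N N G] by auto
        then show False
          using 2 G.setmult_subset_G[OF U.subset N.subset] by blast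
      qed
      then show ?thesis
        by (simp add: F_def)
    next
      case 3
      define J' where "J' = h ` (U \<inter> N)"
      have UN: "subgroup (U \<inter> N) G"
        by (rule G.subgroups_Inter_pair[OF U N.subgroup_axioms])
      \<comment> \<open>\<open>U \<inter> N\<close> is normal in \<open>U\<close>, and
        \<open>U\<close> maps onto \<open>H\<close>.\<close>
      have J'_normal: "J' \<lhd> H"
      proof (rule H.normalI_conj_set)
        show "subgroup J' H"
          unfolding J'_def by (rule subgroup_img_is_subgroup[OF UN])
        show "conj_set H a J' \<subseteq> J'" if a: "a \<in> carrier H" for a
        proof -
          obtain u where u: "u \<in> U" "a = h u"
            using a 3(1) by blast
          have "a \<otimes>\<^bsub>H\<^esub> h n \<otimes>\<^bsub>H\<^esub> inv\<^bsub>H\<^esub> a \<in> J'" if n: "n \<in> U" "n \<in> N" for n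
          proof -
            have "a \<otimes>\<^bsub>H\<^esub> h n \<otimes>\<^bsub>H\<^esub> inv\<^bsub>H\<^esub> a = h (u \<otimes> n \<otimes> inv u)"
              using u n by simp
            moreover have "u \<otimes> n \<otimes> inv u \<in> U \<inter> N"
              using u n N.inv_op_closed2 by simp
            ultimately show ?thesis
              unfolding J'_def by blast
          qed
          then show ?thesis
            by (auto simp: conj_set_def J'_def)
        qed
      qed
      have "J' \<noteq> {\<one>\<^bsub>H\<^esub>}"
      proof
        assume J1: "J' = {\<one>\<^bsub>H\<^esub>}"
        have "U \<inter> N \<subseteq> ?C"
        proof
          fix x assume x: "x \<in> U \<inter> N"
          then have "h x \<in> J'"
            by (auto simp: J'_def)
          then show "x \<in> ?C"
            using J1 x by (simp add: kernel_def)
        qed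
        then show False
          using no[OF U 3(2,1)] by blast
      qed
      define S' where "S' = {V. subgroup V H \<and> V <#>\<^bsub>H\<^esub> J' = carrier H}"
      \<comment> \<open>Modulo the kernel, which lies in \<open>Z\<close>, a decomposition of
        \<open>h u\<close> for \<open>u\<close> in \<open>U\<close> lifts to u = z n with n in
        \<open>U \<inter> N\<close> and z = u n^-1 in \<open>U \<inter> Z\<close>. So being a
        supplement of \<open>N\<close> is visible in \<open>H\<close>.\<close>
      have eq: "(U \<inter> Z) <#> N = carrier G \<longleftrightarrow> h ` Z <#>\<^bsub>H\<^esub> J' = carrier H" if Z: "Z \<in> SC" for Z
      proof -
        have Z': "subgroup Z G" "?C \<subseteq> Z"
          using Z by (auto simp: SC_def)
        interpret Z: subgroup Z G by fact
        have hZ: "subgroup (h ` Z) H"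
          by (rule subgroup_img_is_subgroup[OF Z'(1)])
        show ?thesis
        proof
          assume L: "(U \<inter> Z) <#> N = carrier G"
          show "h ` Z <#>\<^bsub>H\<^esub> J' = carrier H"
          proof
            show "h ` Z <#>\<^bsub>H\<^esub> J' \<subseteq> carrier H"
              by (auto simp: set_mult_def J'_def)
            show "carrier H \<subseteq> h ` Z <#>\<^bsub>H\<^esub> J'"
            proof
              fix a assume "a \<in> carrier H"
              then obtain u where u: "u \<in> U" "a = h u"
                using 3(1) by blast
              then have "u \<in> (U \<inter> Z) <#> N"
                using L by simp
              then obtain z n where zn: "z \<in> U" "z \<in> Z" "n \<in> N" "u = z \<otimes> n"
                by (auto simp: set_mult_def)
              then have "n = inv z \<otimes> u"
                by (simp add: G.m_assoc[symmetric])
              then have "n \<in> U"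
                using zn(1) u(1) by simp
              then have "h n \<in> J'"
                using zn(3) by (simp add: J'_def)
              moreover have "a = h z \<otimes>\<^bsub>H\<^esub> h n"
                using u zn by simp
              ultimately show "a \<in> h ` Z <#>\<^bsub>H\<^esub> J'"
                using zn(2) unfolding set_mult_def by blast
            qed
          qed
        next
          assume R: "h ` Z <#>\<^bsub>H\<^esub> J' = carrier H"
          show "(U \<inter> Z) <#> N = carrier G"
          proof
            show "(U \<inter> Z) <#> N \<subseteq> carrier G"
              using G.setmult_subset_G[OF _ N.subset, of "U \<inter> Z"] U.subset by blast
            show "carrier G \<subseteq> (U \<inter> Z) <#> N"
            proof
              fix g assume "g \<in> carrier G"
              then have "g \<in> U <#> N"
                using 3(2) by simp
              then obtain u m where um: "u \<in> U" "m \<in> N" "g = u \<otimes> m"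
                by (auto simp: set_mult_def)
              have "h u \<in> h ` Z <#>\<^bsub>H\<^esub> J'"
                using R um(1) by simp
              then obtain z n where zn: "z \<in> Z" "n \<in> U" "n \<in> N" "h u = h z \<otimes>\<^bsub>H\<^esub> h n"
                unfolding set_mult_def J'_def by blast
              have "h (u \<otimes> inv n) = h z"
                using zn um(1) by (simp add: H.m_assoc)
              then have "u \<otimes> inv n \<in> preimage (h ` Z)"
                using um(1) zn(1,2) by (simp add: preimage_def)
              then have "u \<otimes> inv n \<in> U \<inter> Z"
                using preimage_image[OF Z'] um(1) zn(2) by simp
              moreover have "n \<otimes> m \<in> N"
                using zn(3) um(2) by simp
              moreover have "g = (u \<otimes> inv n) \<otimes> (n \<otimes> m)"
              proof -
                have "inv n \<otimes> (n \<otimes> m) = m"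
                  using zn(3) um(2) by (simp add: G.m_assoc[symmetric])
                then show ?thesis
                  using um zn(3) by (simp add: G.m_assoc)
              qed
              ultimately show "g \<in> (U \<inter> Z) <#> N"
                unfolding set_mult_def by blast
            qed
          qed
        qed
      qed
      \<comment> \<open>\<open>U\<close> maps onto \<open>H\<close> and \<open>Z\<close> contains
        the kernel, so \<open>U <#> Z\<close> is all of \<open>G\<close>.\<close>
      have card: "int (card (U \<inter> Z)) * int (card (carrier G)) = int (card U) * int (card Z)" if Z: "Z \<in> SC" for Z
      proof -
        have Z': "subgroup Z G" "?C \<subseteq> Z"
          using Z by (auto simp: SC_def)
        interpret Z: subgroup Z G by fact
        have "U <#> Z = carrier G"
        proof
          show "U <#> Z \<subseteq> carrier G"
            by (rule G.setmult_subset_G[OF U.subset Z.subset])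
          show "carrier G \<subseteq> U <#> Z"
          proof
            fix g assume g: "g \<in> carrier G"
            then obtain u where u: "u \<in> U" "h g = h u"
              using 3(1) surj by blast
            then have "inv u \<otimes> g \<in> ?C"
              using g by (simp add: kernel_def)
            then have "inv u \<otimes> g \<in> Z"
              using Z'(2) by blast
            moreover have "g = u \<otimes> (inv u \<otimes> g)"
              using g u(1) by (simp add: G.m_assoc[symmetric])
            ultimately show "g \<in> U <#> Z"
              using u(1) unfolding set_mult_def by blast
          qed
        qed
        then show ?thesis
          using G.card_set_mult[OF U Z'(1)] finite_subset[OF _ fin] U.subset Z.subset
          by (simp flip: of_nat_mult add: mult.commute)
      qed
      \<comment> \<open>Multiplying by the order of \<open>G\<close> clears the denominator in the
        formula for the order of \<open>U \<inter> Z\<close>; \<open>card U\<close> then comes out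
        as a constant factor.\<close>
      have "(\<Sum>Z \<in> SC. ?\<mu> Z * F (U \<inter> Z)) * int (card (carrier G)) =
          (\<Sum>Z \<in> SC. if h ` Z <#>\<^bsub>H\<^esub> J' = carrier H then ?\<mu> Z * (int (card U) * int (card Z)) else 0)"
        unfolding sum_distrib_right
        by (intro sum.cong refl) (simp add: F_def eq card mult.assoc)
      also have "\<dots> = (\<Sum>Z \<in> {Z \<in> SC. h ` Z <#>\<^bsub>H\<^esub> J' = carrier H}. ?\<mu> Z * (int (card U) * int (card Z)))"
        by (rule sum.inter_filter[symmetric, OF finSC])
      also have "\<dots> = (\<Sum>V \<in> S'. ?\<mu> (preimage V) * (int (card U) * int (card (preimage V))))"
      proof (rule sum.reindex_bij_witness[where i = preimage and j = "\<lambda>Z. h ` Z"])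
        show "preimage (h ` Z) = Z" if "Z \<in> {Z \<in> SC. h ` Z <#>\<^bsub>H\<^esub> J' = carrier H}" for Z
          using that preimage_image by (simp add: SC_def)
        then show "?\<mu> (preimage (h ` Z)) * (int (card U) * int (card (preimage (h ` Z)))) =
            ?\<mu> Z * (int (card U) * int (card Z))" if "Z \<in> {Z \<in> SC. h ` Z <#>\<^bsub>H\<^esub> J' = carrier H}" for Z
          using that by simp
        show "h ` Z \<in> S'" if "Z \<in> {Z \<in> SC. h ` Z <#>\<^bsub>H\<^esub> J' = carrier H}" for Z
          using that subgroup_img_is_subgroup by (simp add: SC_def S'_def)
        show hp: "h ` preimage V = V" if "V \<in> S'" for V
          using that image_preimage[OF surj subgroup.subset] by (simp add: S'_def)
        show "preimage V \<in> {Z \<in> SC. h ` Z <#>\<^bsub>H\<^esub> J' = carrier H}" if V: "V \<in> S'" for V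
          using V hp[OF V] subgroup_preimage kernel_subset_preimage by (simp add: S'_def SC_def)
      qed
      also have "\<dots> = (\<Sum>V \<in> S'. ?\<mu> (preimage V) * int (card V)) * (int (card U) * int (card ?C))"
        unfolding sum_distrib_right
        by (intro sum.cong refl) (simp add: S'_def card_preimage[OF fin surj])
      also have "\<dots> = 0"
        using J[OF J'_normal \<open>J' \<noteq> {\<one>\<^bsub>H\<^esub>}\<close>] by (simp add: S'_def)
      finally show ?thesis
        using fin G.one_closed by auto
    qed
  qed
  have outer: "(\<Sum>U \<in> S. ?\<mu> U * F (U \<inter> Z)) = 0" if Z: "Z \<in> SC - {carrier G}" for Z
  proof -
    have "subgroup Z G" "Z \<noteq> carrier G" "{\<one>} \<subseteq> Z"
      using Z subgroup.one_closed by (auto simp: SC_def)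
    moreover have "S = {U. subgroup U G \<and> {\<one>} \<subseteq> U}"
      using subgroup.one_closed by (auto simp: S_def)
    ultimately show ?thesis
      using G.sum_mobius_Int[OF fin G.triv_subgroup, of Z F] by simp
  qed
  \<comment> \<open>On the right the term for Z = G is the left side, because the Moebius value at G
    is 1; all other terms vanish by \<open>outer\<close>.\<close>
  have "(\<Sum>U \<in> S. ?\<mu> U * F U) = (\<Sum>Z \<in> SC. ?\<mu> Z * (\<Sum>U \<in> S. ?\<mu> U * F (U \<inter> Z)))"
  proof -
    have "(\<Sum>U \<in> S. ?\<mu> U * F (U \<inter> carrier G)) = (\<Sum>U \<in> S. ?\<mu> U * F U)"
      by (intro sum.cong refl) (simp add: S_def Int_absorb2[OF subgroup.subset])
    then show ?thesis
      using sum.remove[OF finSC G_SC, of "\<lambda>Z. ?\<mu> Z * (\<Sum>U \<in> S. ?\<mu> U * F (U \<inter> Z))"]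
        sum.neutral[of "SC - {carrier G}" "\<lambda>Z. ?\<mu> Z * (\<Sum>U \<in> S. ?\<mu> U * F (U \<inter> Z))"] outer
      by (simp add: G.mobius_carrier[OF fin])
  qed
  also have "\<dots> = (\<Sum>Z \<in> SC. \<Sum>U \<in> S. ?\<mu> U * (?\<mu> Z * F (U \<inter> Z)))"
    by (simp add: sum_distrib_left mult.left_commute)
  also have "\<dots> = (\<Sum>U \<in> S. \<Sum>Z \<in> SC. ?\<mu> U * (?\<mu> Z * F (U \<inter> Z)))"
    by (rule sum.swap)
  also have "\<dots> = 0"
    using inner by (simp add: S_def flip: sum_distrib_left)
  finally have "(\<Sum>U \<in> S. ?\<mu> U * F U) = 0" .
  moreover have "(\<Sum>U \<in> S. ?\<mu> U * F U) = (\<Sum>U \<in> S. if U <#> N = carrier G then ?\<mu> U * int (card U) else 0)"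
    by (intro sum.cong refl) (simp add: F_def)
  moreover have "\<dots> = (\<Sum>U \<in> {U \<in> S. U <#> N = carrier G}. ?\<mu> U * int (card U))"
    by (rule sum.inter_filter[symmetric, OF finS])
  ultimately show ?thesis
    by (simp add: S_def)
qed

end

section \<open>Maximal normal and subnormal subgroups\<close>

text \<open>Normality relative to the ambient group, so that products and intersections can be
  formed across different \<open>M\<close> without changing carriers.\<close>

definition norm_in :: "('a, 'b) monoid_scheme \<Rightarrow> 'a set \<Rightarrow> 'a set \<Rightarrow> bool" where
  "norm_in G N M \<longleftrightarrow> subgroup N G \<and> subgroup M G \<and> N \<subseteq> M \<and>
     (\<forall>m \<in> M. \<forall>n \<in> N. m \<otimes>\<^bsub>G\<^esub> n \<otimes>\<^bsub>G\<^esub> inv\<^bsub>G\<^esub> m \<in> N)"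

definition max_norm_in :: "('a, 'b) monoid_scheme \<Rightarrow> 'a set \<Rightarrow> 'a set \<Rightarrow> bool" where
  "max_norm_in G N M \<longleftrightarrow> norm_in G N M \<and> N \<noteq> M \<and>
     (\<forall>K. norm_in G K M \<longrightarrow> N \<subseteq> K \<longrightarrow> K = N \<or> K = M)"

inductive subnormal_in :: "('a, 'b) monoid_scheme \<Rightarrow> 'a set \<Rightarrow> 'a set \<Rightarrow> bool"
  for G M where
    refl: "subnormal_in G M M"
  | step: "subnormal_in G M K \<Longrightarrow> norm_in G K' K \<Longrightarrow> subnormal_in G M K'"

context group
begin

lemma norm_in_carrier_iff: "norm_in G N (carrier G) \<longleftrightarrow> N \<lhd> G"
  unfolding norm_in_def normal_inv_iff
  using subgroup_self subgroup.subset[of N G] by auto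

lemma norm_in_refl: "subgroup M G \<Longrightarrow> norm_in G M M"
  by (auto simp: norm_in_def subgroup.m_closed subgroup.m_inv_closed)

lemma norm_in_Int:
  assumes "norm_in G N M" "subgroup B G"
  shows "norm_in G (B \<inter> N) (B \<inter> M)"
  using assms subgroups_Inter_pair[OF assms(2)] subgroup.m_closed[OF assms(2)] subgroup.m_inv_closed[OF assms(2)]
  unfolding norm_in_def by (simp add: subset_iff)

lemma subnormal_in_Int:
  assumes "subnormal_in G M K" "subgroup B G" "B \<subseteq> M"
  shows "subnormal_in G B (B \<inter> K)"
  using assms(1)
proof induction
  case refl
  then show ?case
    using subnormal_in.refl[of G B] assms(3) by (simp add: Int_absorb2)
next
  case (step K K')
  then show ?case
    using subnormal_in.step[OF _ norm_in_Int[OF _ assms(2)]] by simp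
qed

lemma norm_in_imp_subnormal: "norm_in G N M \<Longrightarrow> subnormal_in G M N"
  by (rule subnormal_in.step[OF subnormal_in.refl])

lemma subnormal_in_subgroup:
  assumes "subnormal_in G M K" "subgroup M G"
  shows "subgroup K G" "K \<subseteq> M"
  using assms by (induction) (auto simp: norm_in_def)

text \<open>Writing \<open>m = n k\<close>, conjugation by \<open>n\<close> moves an element \<open>k'\<close> of \<open>K'\<close> within its coset \<open>N k'\<close>.\<close>

lemma norm_in_set_mult:
  assumes N: "norm_in G N M" and K: "norm_in G K' K" and M: "N <#> K = M"
  shows "norm_in G (N <#> K') M"
proof -
  interpret N: subgroup N G using N by (simp add: norm_in_def)
  interpret M: subgroup M G using N by (simp add: norm_in_def)
  interpret K: subgroup K G using K by (simp add: norm_in_def)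
  interpret K': subgroup K' G using K by (simp add: norm_in_def)
  have NM: "N \<subseteq> M" and nN: "\<And>m n. m \<in> M \<Longrightarrow> n \<in> N \<Longrightarrow> m \<otimes> n \<otimes> inv m \<in> N"
    using N by (auto simp: norm_in_def)
  have KK: "K' \<subseteq> K" and nK: "\<And>m n. m \<in> K \<Longrightarrow> n \<in> K' \<Longrightarrow> m \<otimes> n \<otimes> inv m \<in> K'"
    using K by (auto simp: norm_in_def)
  have KM: "K \<subseteq> M"
    using subset_set_mult(2)[OF N.subgroup_axioms K.subgroup_axioms] M by simp
  have K'M: "K' \<subseteq> M"
    using KK KM by blast
  have I: "n \<otimes> k \<in> N <#> K'" if "n \<in> N" "k \<in> K'" for n k
    using that unfolding mem_set_mult_iff by blast
  have sub: "N <#> K' \<subseteq> M"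
    using NM K'M M.m_closed unfolding subset_iff mem_set_mult_iff by blast
  have mult: "x \<otimes> y \<in> N <#> K'" if xy: "x \<in> N <#> K'" "y \<in> N <#> K'" for x y
  proof -
    obtain n k where nk: "n \<in> N" "k \<in> K'" "x = n \<otimes> k"
      using xy(1) by (auto simp: mem_set_mult_iff)
    obtain n' k' where nk': "n' \<in> N" "k' \<in> K'" "y = n' \<otimes> k'"
      using xy(2) by (auto simp: mem_set_mult_iff)
    have "k \<otimes> n' \<otimes> inv k \<in> N"
      using nN nk(2) nk'(1) K'M by blast
    then have "(n \<otimes> (k \<otimes> n' \<otimes> inv k)) \<otimes> (k \<otimes> k') \<in> N <#> K'"
      using nk nk' by (intro I) auto
    moreover have "inv k \<otimes> (k \<otimes> k') = k'"
      using nk nk' by (simp add: m_assoc[symmetric])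
    then have "(n \<otimes> (k \<otimes> n' \<otimes> inv k)) \<otimes> (k \<otimes> k') = x \<otimes> y"
      using nk nk' by (simp add: m_assoc)
    ultimately show ?thesis
      by simp
  qed
  have inv: "inv x \<in> N <#> K'" if x: "x \<in> N <#> K'" for x
  proof -
    obtain n k where nk: "n \<in> N" "k \<in> K'" "x = n \<otimes> k"
      using x by (auto simp: mem_set_mult_iff)
    have "inv k \<otimes> inv n \<otimes> inv (inv k) \<in> N"
      using nN[of "inv k" "inv n"] nk K'M by auto
    then have "(inv k \<otimes> inv n \<otimes> k) \<otimes> inv k \<in> N <#> K'"
      using nk by (intro I) auto
    moreover have "(inv k \<otimes> inv n \<otimes> k) \<otimes> inv k = inv x"
      using nk by (simp add: inv_mult_group m_assoc)
    ultimately show ?thesis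
      by simp
  qed
  have sg: "subgroup (N <#> K') G"
  proof (rule subgroupI)
    show "N <#> K' \<subseteq> carrier G"
      using sub M.subset by blast
    show "N <#> K' \<noteq> {}"
      using I[OF N.one_closed K'.one_closed] by blast
  qed (use mult inv in auto)
  have NS: "N \<subseteq> N <#> K'"
    using I[OF _ K'.one_closed] by fastforce
  have cj: "m \<otimes> x \<otimes> inv m \<in> N <#> K'" if m: "m \<in> M" and x: "x \<in> N <#> K'" for m x
  proof -
    obtain n k where nk: "n \<in> N" "k \<in> K" "m = n \<otimes> k"
      using m M by (auto simp: mem_set_mult_iff)
    obtain n' k' where nk': "n' \<in> N" "k' \<in> K'" "x = n' \<otimes> k'"
      using x by (auto simp: mem_set_mult_iff)
    have km: "k \<in> M"
      using nk(2) KM by blast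
    have "k \<otimes> n' \<otimes> inv k \<in> N"
      using nN km nk'(1) by blast
    moreover have "k \<otimes> k' \<otimes> inv k \<in> K'"
      using nK nk(2) nk'(2) by blast
    ultimately have 1: "(k \<otimes> n' \<otimes> inv k) \<otimes> (k \<otimes> k' \<otimes> inv k) \<in> N <#> K'"
      by (rule I)
    have *: "inv k \<otimes> (k \<otimes> (k' \<otimes> inv k)) = k' \<otimes> inv k"
      using nk nk' by (simp add: m_assoc[symmetric])
    have "(k \<otimes> n' \<otimes> inv k) \<otimes> (k \<otimes> k' \<otimes> inv k) = k \<otimes> x \<otimes> inv k"
      using nk nk' * by (simp add: m_assoc)
    then have 2: "k \<otimes> x \<otimes> inv k \<in> N <#> K'"
      using 1 by simp
    have 3: "n \<in> N <#> K'" "inv n \<in> N <#> K'"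
      using nk(1) NS by auto
    then have "n \<otimes> (k \<otimes> x \<otimes> inv k) \<otimes> inv n \<in> N <#> K'"
      by (intro mult[OF mult[OF 3(1) 2] 3(2)])
    moreover have "n \<otimes> (k \<otimes> x \<otimes> inv k) \<otimes> inv n = m \<otimes> x \<otimes> inv m"
      using nk x sub M.subset by (simp add: inv_mult_group m_assoc subset_iff)
    ultimately show ?thesis
      by simp
  qed
  show ?thesis
    unfolding norm_in_def using sg M.subgroup_axioms sub cj by blast
qed

text \<open>For normal \<open>K\<close> this is maximality of \<open>N\<close>. In general one
  descends the chain from \<open>M\<close> to \<open>K\<close>: as long as the product with
  \<open>N\<close> is \<open>M\<close>, the product of \<open>N\<close> with the next term is again
  normal in \<open>M\<close>, so maximality decides between \<open>N\<close> and
  \<open>M\<close>.\<close>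

lemma subnormal_in_max_norm_in:
  assumes N: "max_norm_in G N M" and K: "subnormal_in G M K"
  shows "K \<subseteq> N \<or> N <#> K = M"
  using K
proof induction
  case refl
  have s: "subgroup N G" "subgroup M G" "N \<subseteq> M"
    using N by (auto simp: max_norm_in_def norm_in_def)
  have "N <#> M \<subseteq> M"
    using s(3) subgroup.m_closed[OF s(2)] unfolding subset_iff mem_set_mult_iff by blast
  then show ?case
    using subset_set_mult(2)[OF s(1,2)] by blast
next
  case (step K K')
  have s: "subgroup N G" "subgroup K' G" "K' \<subseteq> K"
    using N step.hyps by (auto simp: max_norm_in_def norm_in_def)
  show ?case
  proof (cases "K \<subseteq> N")
    case True
    then show ?thesis
      using s(3) by blast
  next
    case False
    then have "norm_in G (N <#> K') M"
      using step.IH step.hyps N norm_in_set_mult by (auto simp: max_norm_in_def)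
    then have "N <#> K' = N \<or> N <#> K' = M"
      using N subset_set_mult(1)[OF s(1,2)] by (auto simp: max_norm_in_def)
    then show ?thesis
      using subset_set_mult(2)[OF s(1,2)] by blast
  qed
qed

lemma max_norm_in_exists:
  assumes fin: "finite (carrier G)" and M: "subgroup M G" "M \<noteq> {\<one>}"
  shows "\<exists>E. max_norm_in G E M"
proof -
  define \<E> where "\<E> = {E. norm_in G E M \<and> E \<noteq> M}"
  have finM: "finite M"
    using finite_subset[OF subgroup.subset[OF M(1)] fin] .
  have "\<E> \<subseteq> Pow M"
    by (auto simp: \<E>_def norm_in_def)
  then have "finite \<E>"
    using finM finite_subset by auto
  moreover have "{\<one>} \<in> \<E>"
    using M triv_subgroup subgroup.one_closed[OF M(1)] subgroup.mem_carrier[OF M(1)]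
    by (auto simp: \<E>_def norm_in_def)
  ultimately have "Max (card ` \<E>) \<in> card ` \<E>" and ge: "\<And>F. F \<in> \<E> \<Longrightarrow> card F \<le> Max (card ` \<E>)"
    by (auto intro: Max_in)
  then obtain E where E: "E \<in> \<E>" "\<And>F. F \<in> \<E> \<Longrightarrow> card F \<le> card E"
    by auto
  have "K = E \<or> K = M" if K: "norm_in G K M" "E \<subseteq> K" for K
  proof (rule disjCI)
    assume "K \<noteq> M"
    then have "card K \<le> card E"
      using E(2) K(1) by (simp add: \<E>_def)
    moreover have "finite K"
      using K(1) finM finite_subset[of K M] by (simp add: norm_in_def)
    ultimately show "K = E"
      using card_seteq[OF _ K(2)] by simp
  qed
  then show ?thesis
    using E(1) by (auto simp: max_norm_in_def \<E>_def)
qed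

lemma norm_in_conj_set:
  assumes "norm_in G N M" "M \<lhd> G" and g: "g \<in> carrier G"
  shows "norm_in G (conj_set G g N) M"
proof -
  have N: "subgroup N G" "subgroup M G" "N \<subseteq> M" and n: "\<And>m n. m \<in> M \<Longrightarrow> n \<in> N \<Longrightarrow> m \<otimes> n \<otimes> inv m \<in> N"
    using assms(1) by (auto simp: norm_in_def)
  interpret N: subgroup N G by fact
  interpret M: normal M G by fact
  have "m \<otimes> x \<otimes> inv m \<in> conj_set G g N" if m: "m \<in> M" and x: "x \<in> conj_set G g N" for m x
  proof -
    obtain y where y: "y \<in> N" "x = g \<otimes> y \<otimes> inv g"
      using x by (auto simp: conj_set_def)
    have mc: "m \<in> carrier G"
      using m by simp
    have "inv g \<otimes> m \<otimes> g \<in> M"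
      using M.inv_op_closed1[OF g m] .
    then have "(inv g \<otimes> m \<otimes> g) \<otimes> y \<otimes> inv (inv g \<otimes> m \<otimes> g) \<in> N"
      using n y(1) by blast
    moreover have "g \<otimes> ((inv g \<otimes> m \<otimes> g) \<otimes> y \<otimes> inv (inv g \<otimes> m \<otimes> g)) \<otimes> inv g = m \<otimes> x \<otimes> inv m"
    proof -
      have *: "g \<otimes> (inv g \<otimes> z) = z" if "z \<in> carrier G" for z
        using that g by (simp add: m_assoc[symmetric])
      show ?thesis
        using y mc g by (simp add: inv_mult_group m_assoc *)
    qed
    ultimately show ?thesis
      unfolding conj_set_def by (intro image_eqI) (rule sym)
  qed
  moreover have "conj_set G g N \<subseteq> M"
    using normal_conj_set[OF assms(2) g] conj_set_mono[OF N(3)] by metis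
  ultimately show ?thesis
    unfolding norm_in_def using conj_set_subgroup[OF g N(1)] N(2) by blast
qed

lemma max_norm_in_conj_set:
  assumes N: "max_norm_in G N M" and M: "M \<lhd> G" and g: "g \<in> carrier G"
  shows "max_norm_in G (conj_set G g N) M"
  unfolding max_norm_in_def
proof (intro conjI allI impI)
  have N': "norm_in G N M" "N \<noteq> M" and max: "\<And>K. norm_in G K M \<Longrightarrow> N \<subseteq> K \<Longrightarrow> K = N \<or> K = M"
    using N by (auto simp: max_norm_in_def)
  have Nc: "N \<subseteq> carrier G" and Mc: "M \<subseteq> carrier G"
    using N'(1) subgroup.subset[of N G] subgroup.subset[of M G] by (simp_all add: norm_in_def)
  have gi: "inv g \<in> carrier G"
    using g by simp
  show "norm_in G (conj_set G g N) M"
    using norm_in_conj_set[OF N'(1) M g] .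
  show "conj_set G g N \<noteq> M"
    using conj_set_inv(1)[OF g Nc] normal_conj_set[OF M gi] N'(2) by metis
  show "K = conj_set G g N \<or> K = M" if K: "norm_in G K M" "conj_set G g N \<subseteq> K" for K
  proof -
    have Kc: "K \<subseteq> carrier G"
      using K(1) subgroup.subset[of K G] by (simp add: norm_in_def)
    have "N \<subseteq> conj_set G (inv g) K"
      using conj_set_mono[OF K(2), of "inv g"] conj_set_inv(1)[OF g Nc] by simp
    then have "conj_set G (inv g) K = N \<or> conj_set G (inv g) K = M"
      using max norm_in_conj_set[OF K(1) M gi] by blast
    then show ?thesis
      using conj_set_inv(2)[OF g Kc] normal_conj_set[OF M g] by metis
  qed
qed

end

section \<open>The chief factor isomorphic to the simple group\<close>

text \<open>This says that \<open>M\<close> modulo \<open>E\<close> is isomorphic to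
  \<open>S\<close>, by a map on elements. Avoiding cosets lets the same \<open>f\<close> be
  restricted to subgroups and extended along products.\<close>

definition epi_kernel :: "('a, 'b) monoid_scheme \<Rightarrow> ('c, 'd) monoid_scheme \<Rightarrow> 'a set \<Rightarrow> 'a set \<Rightarrow> ('a \<Rightarrow> 'c) \<Rightarrow> bool" where
  "epi_kernel G S M E f \<longleftrightarrow> f \<in> hom (G\<lparr>carrier := M\<rparr>) S \<and> f ` M = carrier S \<and>
     {m \<in> M. f m = \<one>\<^bsub>S\<^esub>} = E"

locale group_and_simple = group G + S: simple_group S
  for G :: "('a, 'b) monoid_scheme" (structure) and S :: "('c, 'd) monoid_scheme"
begin

lemma epi_kernel_hom:
  assumes "epi_kernel G S M E f" "subgroup M G"
  shows "group_hom (G\<lparr>carrier := M\<rparr>) S f"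
  using assms subgroup_imp_group[OF assms(2)]
  by (simp add: epi_kernel_def group_hom_def group_hom_axioms_def)

lemma epi_kernelD:
  assumes f: "epi_kernel G S M E f" and M: "subgroup M G"
  shows "\<And>x y. x \<in> M \<Longrightarrow> y \<in> M \<Longrightarrow> f (x \<otimes> y) = f x \<otimes>\<^bsub>S\<^esub> f y"
    and "\<And>x. x \<in> M \<Longrightarrow> f (inv x) = inv\<^bsub>S\<^esub> f x"
    and "\<And>x. x \<in> M \<Longrightarrow> f x \<in> carrier S"
    and "\<And>x. x \<in> M \<Longrightarrow> f x = \<one>\<^bsub>S\<^esub> \<longleftrightarrow> x \<in> E"
    and "f ` M = carrier S" and "E \<subseteq> M"
proof -
  interpret f: group_hom "G\<lparr>carrier := M\<rparr>" S f
    using epi_kernel_hom[OF f M] .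
  show "f (x \<otimes> y) = f x \<otimes>\<^bsub>S\<^esub> f y" if "x \<in> M" "y \<in> M" for x y
    using f.hom_mult[of x y] that by simp
  show "f (inv x) = inv\<^bsub>S\<^esub> f x" if "x \<in> M" for x
    using f.hom_inv[of x] that m_inv_consistent[OF M that] by simp
  show "f x \<in> carrier S" if "x \<in> M" for x
    using f.hom_closed[of x] that by simp
  show "f x = \<one>\<^bsub>S\<^esub> \<longleftrightarrow> x \<in> E" if "x \<in> M" for x
    using f that by (auto simp: epi_kernel_def)
  show "f ` M = carrier S" "E \<subseteq> M"
    using f by (auto simp: epi_kernel_def)
qed

text \<open>The second isomorphism theorem without a change of map: \<open>f\<close> kills
  \<open>E\<close>, so \<open>Y\<close> already covers \<open>S\<close>.\<close>

lemma epi_kernel_restrict: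
  assumes f: "epi_kernel G S M E f" and M: "subgroup M G" and Y: "Y \<subseteq> M" "E <#> Y = M"
  shows "epi_kernel G S Y (Y \<inter> E) f"
proof -
  note D = epi_kernelD[OF f M]
  have YM: "y \<in> M" if "y \<in> Y" for y
    using that Y(1) by blast
  have "f ` Y = carrier S"
  proof
    show "f ` Y \<subseteq> carrier S"
      using D(3) YM by blast
    show "carrier S \<subseteq> f ` Y"
    proof
      fix s assume "s \<in> carrier S"
      then obtain m where m: "m \<in> M" "s = f m"
        using D(5) by blast
      then obtain e y where ey: "e \<in> E" "y \<in> Y" "m = e \<otimes> y"
        using Y(2) mem_set_mult_iff[of m E Y] by blast
      have "e \<in> M" "f e = \<one>\<^bsub>S\<^esub>"
        using ey(1) D(4,6) by auto
      then have "s = f y"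
        using m ey D(1)[of e y] D(3)[of y] YM[of y] by simp
      then show "s \<in> f ` Y"
        using ey(2) by blast
    qed
  qed
  moreover have "f (x \<otimes> y) = f x \<otimes>\<^bsub>S\<^esub> f y" if "x \<in> Y" "y \<in> Y" for x y
    using D(1) YM that by simp
  ultimately show ?thesis
    using D(3,4) YM by (auto simp: epi_kernel_def hom_def)
qed

text \<open>The image of a normal subgroup of \<open>M\<close> is normal in \<open>S\<close>, hence
  trivial or everything; above the kernel, the image determines the subgroup.\<close>

lemma epi_kernel_max:
  assumes f: "epi_kernel G S M E f" and M: "subgroup M G"
  shows "max_norm_in G E M"
proof -
  note D = epi_kernelD[OF f M]
  interpret M: subgroup M G by fact
  have one: "\<one> \<in> E"
    using D(1)[of \<one> \<one>] D(3,4)[of \<one>] M.one_closed by simp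
  have norm: "norm_in G E M"
    unfolding norm_in_def
  proof (intro conjI ballI)
    show "subgroup E G"
    proof (rule subgroupI)
      show "E \<subseteq> carrier G"
        using D(6) M.subset by blast
      show "E \<noteq> {}"
        using one by blast
      show "inv x \<in> E" if x: "x \<in> E" for x
        using x D(2)[of x] D(4)[of x] D(4)[of "inv x"] D(6) by auto
      show "x \<otimes> y \<in> E" if xy: "x \<in> E" "y \<in> E" for x y
        using xy D(1)[of x y] D(4)[of x] D(4)[of y] D(4)[of "x \<otimes> y"] D(6) by auto
    qed
    show "m \<otimes> n \<otimes> inv m \<in> E" if mn: "m \<in> M" "n \<in> E" for m n
    proof -
      have n: "n \<in> M" "f n = \<one>\<^bsub>S\<^esub>"
        using mn(2) D(4,6) by auto
      have "f (m \<otimes> n \<otimes> inv m) = \<one>\<^bsub>S\<^esub>"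
        using mn(1) n D(1)[of "m \<otimes> n" "inv m"] D(1)[of m n] D(2)[of m] D(3)[of m] by simp
      then show ?thesis
        using D(4)[of "m \<otimes> n \<otimes> inv m"] mn(1) n(1) by simp
    qed
  qed (use M D(6) in auto)
  have "E \<noteq> M"
  proof
    assume "E = M"
    then have "f ` M \<subseteq> {\<one>\<^bsub>S\<^esub>}"
      using D(4) by auto
    then have "carrier S = {\<one>\<^bsub>S\<^esub>}"
      using D(5) S.one_closed by auto
    then show False
      using S.simple_not_triv by blast
  qed
  moreover have "K = E \<or> K = M" if K: "norm_in G K M" "E \<subseteq> K" for K
  proof -
    have K': "subgroup K G" "K \<subseteq> M" "\<And>m k. m \<in> M \<Longrightarrow> k \<in> K \<Longrightarrow> m \<otimes> k \<otimes> inv m \<in> K"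
      using K(1) by (auto simp: norm_in_def)
    interpret K: subgroup K G by fact
    have "f ` K \<lhd> S"
    proof (rule S.normalI_conj_set)
      show "subgroup (f ` K) S"
      proof (rule S.subgroupI)
        show "f ` K \<subseteq> carrier S"
          using D(3) K'(2) by blast
        show "f ` K \<noteq> {}"
          using K.one_closed by blast
        show "inv\<^bsub>S\<^esub> a \<in> f ` K" if "a \<in> f ` K" for a
        proof -
          obtain k where k: "k \<in> K" "a = f k"
            using \<open>a \<in> f ` K\<close> by blast
          have "inv\<^bsub>S\<^esub> a = f (inv k)"
            using k D(2)[of k] subsetD[OF K'(2)] by simp
          moreover have "inv k \<in> K"
            using k by simp
          ultimately show ?thesis
            by blast
        qed
        show "a \<otimes>\<^bsub>S\<^esub> b \<in> f ` K" if "a \<in> f ` K" "b \<in> f ` K" for a b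
        proof -
          obtain k l where k: "k \<in> K" "a = f k" "l \<in> K" "b = f l"
            using \<open>a \<in> f ` K\<close> \<open>b \<in> f ` K\<close> by blast
          have "a \<otimes>\<^bsub>S\<^esub> b = f (k \<otimes> l)"
            using k D(1)[of k l] subsetD[OF K'(2)] by simp
          moreover have "k \<otimes> l \<in> K"
            using k by simp
          ultimately show ?thesis
            by blast
        qed
      qed
      show "conj_set S a (f ` K) \<subseteq> f ` K" if a: "a \<in> carrier S" for a
      proof -
        have "a \<in> f ` M"
          using a D(5) by simp
        then obtain m where m: "m \<in> M" "a = f m"
          by blast
        have "a \<otimes>\<^bsub>S\<^esub> f k \<otimes>\<^bsub>S\<^esub> inv\<^bsub>S\<^esub> a \<in> f ` K" if k: "k \<in> K" for k
        proof -
          have "k \<in> M"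
            using k K'(2) by blast
          then have "a \<otimes>\<^bsub>S\<^esub> f k \<otimes>\<^bsub>S\<^esub> inv\<^bsub>S\<^esub> a = f (m \<otimes> k \<otimes> inv m)"
            using m D(1)[of "m \<otimes> k" "inv m"] D(1)[of m k] D(2)[of m] by simp
          then show ?thesis
            using K'(3)[OF m(1) k] by blast
        qed
        then show ?thesis
          by (auto simp: conj_set_def)
      qed
    qed
    then have "f ` K = carrier S \<or> f ` K = {\<one>\<^bsub>S\<^esub>}"
      by (rule S.no_real_normal_subgroup)
    then show ?thesis
    proof
      assume fK: "f ` K = {\<one>\<^bsub>S\<^esub>}"
      have "K \<subseteq> E"
      proof
        fix k assume k: "k \<in> K"
        then have "f k = \<one>\<^bsub>S\<^esub>"
          using fK by blast
        then show "k \<in> E"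
          using D(4)[of k] k K'(2) by blast
      qed
      then show ?thesis
        using K(2) by blast
    next
      assume fK: "f ` K = carrier S"
      have "M \<subseteq> K"
      proof
        fix m assume m: "m \<in> M"
        then have "f m \<in> f ` K"
          using D(3) fK by simp
        then obtain k where k: "k \<in> K" "f m = f k"
          by blast
        have kM: "k \<in> M"
          using k(1) K'(2) by blast
        have "f (inv k \<otimes> m) = \<one>\<^bsub>S\<^esub>"
          using D(1)[of "inv k" m] D(2)[of k] D(3)[of k] k m kM by simp
        then have "inv k \<otimes> m \<in> K"
          using D(4)[of "inv k \<otimes> m"] K(2) kM m by auto
        then have "k \<otimes> (inv k \<otimes> m) \<in> K"
          using k(1) by simp
        then show "m \<in> K"
          using kM m by (simp add: m_assoc[symmetric])
      qed
      then show ?thesis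
        using K'(2) by blast
    qed
  qed
  ultimately show ?thesis
    using norm by (auto simp: max_norm_in_def)
qed

text \<open>The second isomorphism theorem in the other direction: \<open>f\<close> is extended by
  killing \<open>V\<close>. The kernel of the extension is proper, normal and contains
  \<open>V\<close>, so by maximality it is exactly \<open>V\<close>; this is why the inclusion
  \<open>triv\<close> suffices in place of an equality.\<close>

lemma epi_kernel_extend:
  assumes V: "max_norm_in G V W" and Y: "subgroup Y G" "V <#> Y = W"
    and f: "epi_kernel G S Y D f" and triv: "Y \<inter> V \<subseteq> D"
  shows "\<exists>F. epi_kernel G S W V F \<and> (\<forall>y \<in> Y. F y = f y)"
proof -
  have V': "subgroup V G" "subgroup W G" "V \<subseteq> W" and nV: "\<And>w v. w \<in> W \<Longrightarrow> v \<in> V \<Longrightarrow> w \<otimes> v \<otimes> inv w \<in> V"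
    and "V \<noteq> W" and max: "\<And>K. norm_in G K W \<Longrightarrow> V \<subseteq> K \<Longrightarrow> K = V \<or> K = W"
    using V by (auto simp: max_norm_in_def norm_in_def)
  interpret V: subgroup V G by fact
  interpret W: subgroup W G by fact
  interpret Y: subgroup Y G by fact
  note D = epi_kernelD[OF f Y(1)]
  have YW: "Y \<subseteq> W"
    using subset_set_mult(2)[OF V'(1) Y(1)] Y(2) by simp
  \<comment> \<open>Any decomposition w = v y may be chosen: two choices of y differ by an element
    of \<open>Y \<inter> V\<close>, which \<open>f\<close> kills.\<close>
  define F where "F = (\<lambda>w. f (SOME y. y \<in> Y \<and> (\<exists>v \<in> V. w = v \<otimes> y)))"
  have F: "F (v \<otimes> y) = f y" if vy: "v \<in> V" "y \<in> Y" for v y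
  proof -
    define y' where "y' = (SOME y'. y' \<in> Y \<and> (\<exists>v' \<in> V. v \<otimes> y = v' \<otimes> y'))"
    have "y' \<in> Y \<and> (\<exists>v' \<in> V. v \<otimes> y = v' \<otimes> y')"
      unfolding y'_def by (rule someI[of _ y]) (use vy in blast)
    then obtain v' where y': "y' \<in> Y" "v' \<in> V" "v \<otimes> y = v' \<otimes> y'"
      by blast
    have "y = inv v \<otimes> (v \<otimes> y)"
      using vy by (simp add: m_assoc[symmetric])
    then have "y \<otimes> inv y' = inv v \<otimes> (v' \<otimes> y') \<otimes> inv y'"
      using y'(3) by simp
    also have "\<dots> = inv v \<otimes> v'"
      using vy y'(1,2) by (simp add: m_assoc)
    finally have "y \<otimes> inv y' = inv v \<otimes> v'" .
    moreover have "inv v \<otimes> v' \<in> V"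
      using vy y' by simp
    ultimately have "y \<otimes> inv y' \<in> V"
      by simp
    moreover have "y \<otimes> inv y' \<in> Y"
      using vy(2) y'(1) by simp
    ultimately have "y \<otimes> inv y' \<in> D"
      using triv by blast
    then have "f y \<otimes>\<^bsub>S\<^esub> inv\<^bsub>S\<^esub> f y' = \<one>\<^bsub>S\<^esub>"
      using D(4)[of "y \<otimes> inv y'"] D(1)[of y "inv y'"] D(2)[of y'] vy(2) y'(1) by simp
    then have "f y = f y'"
      using S.inv_equality[of "f y" "inv\<^bsub>S\<^esub> f y'"] D(3)[of y] D(3)[of y'] vy(2) y'(1) by simp
    then show ?thesis
      by (simp add: F_def y'_def)
  qed
  have W_ex: "\<exists>v \<in> V. \<exists>y \<in> Y. w = v \<otimes> y" if "w \<in> W" for w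
    using that unfolding Y(2)[symmetric] mem_set_mult_iff .
  have Fy: "F y = f y" if "y \<in> Y" for y
    using F[OF V.one_closed that] that by simp
  have Fv: "F v = \<one>\<^bsub>S\<^esub>" if "v \<in> V" for v
    using F[OF that Y.one_closed] that D(1)[of \<one> \<one>] D(3)[of \<one>] by simp
  have hom: "F (w \<otimes> w') = F w \<otimes>\<^bsub>S\<^esub> F w'" if w: "w \<in> W" "w' \<in> W" for w w'
  proof -
    obtain v y v' y' where *: "v \<in> V" "y \<in> Y" "w = v \<otimes> y" "v' \<in> V" "y' \<in> Y" "w' = v' \<otimes> y'"
      using W_ex w by metis
    have "y \<otimes> v' \<otimes> inv y \<in> V"
      using nV * YW by blast
    then have "F ((v \<otimes> (y \<otimes> v' \<otimes> inv y)) \<otimes> (y \<otimes> y')) = f (y \<otimes> y')"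
      using * by (intro F) auto
    moreover have "(v \<otimes> (y \<otimes> v' \<otimes> inv y)) \<otimes> (y \<otimes> y') = w \<otimes> w'"
    proof -
      have "inv y \<otimes> (y \<otimes> y') = y'"
        using * by (simp add: m_assoc[symmetric])
      then show ?thesis
        using * by (simp add: m_assoc)
    qed
    ultimately show ?thesis
      using * F D(1) by simp
  qed
  have Fc: "F w \<in> carrier S" if "w \<in> W" for w
    using W_ex[OF that] F D(3) by auto
  have "F ` W = carrier S"
  proof
    show "F ` W \<subseteq> carrier S"
      using Fc by blast
    have "carrier S = F ` Y"
      using D(5) Fy by force
    then show "carrier S \<subseteq> F ` W"
      using YW by blast
  qed
  then have epi: "epi_kernel G S W {w \<in> W. F w = \<one>\<^bsub>S\<^esub>} F"
    using hom Fc by (auto simp: epi_kernel_def hom_def)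
  then have "max_norm_in G {w \<in> W. F w = \<one>\<^bsub>S\<^esub>} W"
    using epi_kernel_max V'(2) by blast
  then have "{w \<in> W. F w = \<one>\<^bsub>S\<^esub>} = V"
    using max[of "{w \<in> W. F w = \<one>\<^bsub>S\<^esub>}"] Fv V'(3) by (auto simp: max_norm_in_def)
  then show ?thesis
    using epi Fy by auto
qed

lemma epi_kernel_conj_set:
  assumes f: "epi_kernel G S M E f" and M: "M \<lhd> G" and g: "g \<in> carrier G"
  shows "\<exists>f'. epi_kernel G S M (conj_set G g E) f'"
proof -
  interpret M: normal M G by fact
  note D = epi_kernelD[OF f M.subgroup_axioms]
  define f' where "f' = (\<lambda>m. f (inv g \<otimes> m \<otimes> g))"
  have c: "inv g \<otimes> m \<otimes> g \<in> M" "g \<otimes> m \<otimes> inv g \<in> M" if "m \<in> M" for m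
    using M.inv_op_closed1[OF g that] M.inv_op_closed2[OF g that] .
  have cc: "inv g \<otimes> (g \<otimes> m \<otimes> inv g) \<otimes> g = m" "g \<otimes> (inv g \<otimes> m \<otimes> g) \<otimes> inv g = m" if "m \<in> M" for m
  proof -
    have "inv g \<otimes> (g \<otimes> m) = m" "g \<otimes> (inv g \<otimes> m) = m"
      using that g by (simp_all add: m_assoc[symmetric])
    then show "inv g \<otimes> (g \<otimes> m \<otimes> inv g) \<otimes> g = m" "g \<otimes> (inv g \<otimes> m \<otimes> g) \<otimes> inv g = m"
      using that g by (simp_all add: m_assoc)
  qed
  have "f' (x \<otimes> y) = f' x \<otimes>\<^bsub>S\<^esub> f' y" if xy: "x \<in> M" "y \<in> M" for x y
  proof -
    have "g \<otimes> (inv g \<otimes> (y \<otimes> g)) = y \<otimes> g"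
      using xy g by (simp add: m_assoc[symmetric])
    then have "inv g \<otimes> (x \<otimes> y) \<otimes> g = (inv g \<otimes> x \<otimes> g) \<otimes> (inv g \<otimes> y \<otimes> g)"
      using xy g by (simp add: m_assoc)
    then show ?thesis
      using D(1) c xy by (simp add: f'_def)
  qed
  moreover have "f' ` M = carrier S"
  proof
    show "f' ` M \<subseteq> carrier S"
      using c D(3) by (auto simp: f'_def)
    show "carrier S \<subseteq> f' ` M"
    proof
      fix s assume "s \<in> carrier S"
      then obtain m where "m \<in> M" "s = f m"
        using D(5) by blast
      then have "s = f' (g \<otimes> m \<otimes> inv g)" "g \<otimes> m \<otimes> inv g \<in> M"
        using cc c by (simp_all add: f'_def)
      then show "s \<in> f' ` M"
        by blast
    qed
  qed
  moreover have "{m \<in> M. f' m = \<one>\<^bsub>S\<^esub>} = conj_set G g E"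
  proof
    show "{m \<in> M. f' m = \<one>\<^bsub>S\<^esub>} \<subseteq> conj_set G g E"
    proof clarify
      fix m assume m: "m \<in> M" "f' m = \<one>\<^bsub>S\<^esub>"
      then have "inv g \<otimes> m \<otimes> g \<in> E"
        using D(4) c by (simp add: f'_def)
      then show "m \<in> conj_set G g E"
        using cc(2)[OF m(1)] unfolding conj_set_def by (metis image_eqI)
    qed
    show "conj_set G g E \<subseteq> {m \<in> M. f' m = \<one>\<^bsub>S\<^esub>}"
    proof
      fix x assume "x \<in> conj_set G g E"
      then obtain e where e: "e \<in> E" "x = g \<otimes> e \<otimes> inv g"
        by (auto simp: conj_set_def)
      then have "e \<in> M" "f e = \<one>\<^bsub>S\<^esub>"
        using D(4,6) by auto
      then show "x \<in> {m \<in> M. f' m = \<one>\<^bsub>S\<^esub>}"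
        using e(2) c cc by (simp add: f'_def)
    qed
  qed
  moreover have "f' x \<in> carrier S" if "x \<in> M" for x
    using c[OF that] D(3) by (simp add: f'_def)
  ultimately have "epi_kernel G S M (conj_set G g E) f'"
    by (simp add: epi_kernel_def hom_def)
  then show ?thesis
    by blast
qed

end

section \<open>Comparing subnormal subgroups with a series having one factor
  \<open>S\<close>\<close>

locale unique_simple_factor = group_and_simple G S
  for G :: "('a, 'b) monoid_scheme" (structure) and S :: "('c, 'd) monoid_scheme" +
  fixes h :: "nat \<Rightarrow> 'a set" and n i :: nat
  assumes fin: "finite (carrier G)"
    and h0: "h 0 = {\<one>}" and hn: "h n = carrier G"
    and h_max: "\<And>j. j < n \<Longrightarrow> max_norm_in G (h j) (h (Suc j))"
    and i: "i < n" "\<exists>f. epi_kernel G S (h (Suc i)) (h i) f"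
    and unique: "\<And>j f. j < n \<Longrightarrow> epi_kernel G S (h (Suc j)) (h j) f \<Longrightarrow> j = i"
begin

lemma h_subgroup: "j \<le> n \<Longrightarrow> subgroup (h j) G"
  using hn subgroup_self h_max[of j] by (cases "j = n") (auto simp: max_norm_in_def norm_in_def)

lemma h_step: "j < n \<Longrightarrow> norm_in G (h j) (h (Suc j))"
  using h_max[of j] by (simp add: max_norm_in_def)

lemma h_subnormal: "j \<le> n \<Longrightarrow> subnormal_in G (carrier G) (h j)"
proof (induction rule: inc_induct)
  case base
  then show ?case
    using hn subnormal_in.refl[of G "carrier G"] by simp
next
  case (step j)
  then show ?case
    using subnormal_in.step h_step by blast
qed

text \<open>For subnormal \<open>M\<close> this says that \<open>M\<close> has a composition factor isomorphic to \<open>S\<close>; otherwise \<open>M\<close> avoids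
  the factor \<open>h (Suc i) / h i\<close>.\<close>

definition covers :: "'a set \<Rightarrow> bool" where
  "covers M \<longleftrightarrow> \<not> M \<inter> h (Suc i) \<subseteq> h i"

text \<open>The step of the Jordan-Hoelder argument that matches the simple quotient of
  \<open>M\<close> by \<open>E\<close> with a factor of the series: \<open>j\<close> is where
  \<open>M \<inter> h j\<close> first leaves \<open>E\<close>. The next intersection is subnormal in
  \<open>M\<close>, so it supplements \<open>E\<close>.\<close>

lemma jump:
  assumes M: "subnormal_in G (carrier G) M" and E: "max_norm_in G E M"
  shows "\<exists>j < n. M \<inter> h j \<subseteq> E \<and> E <#> (M \<inter> h (Suc j)) = M \<and> \<not> M \<inter> h (Suc j) \<subseteq> h j"
proof -
  have E': "subgroup E G" "subgroup M G" "E \<subseteq> M" "E \<noteq> M"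
    using E by (auto simp: max_norm_in_def norm_in_def)
  define P where "P = (\<lambda>j. \<not> M \<inter> h j \<subseteq> E)"
  have "P n"
    using E' subgroup.subset[OF E'(2)] by (auto simp: P_def hn)
  moreover have "\<not> P 0"
    using subgroup.one_closed[OF E'(1)] by (auto simp: P_def h0)
  ultimately obtain j where j: "j < n" "\<not> P j" "P (Suc j)"
    using ex_least_nat_less[of P n] by auto
  have "subnormal_in G M (M \<inter> h (Suc j))"
    using subnormal_in_Int[OF h_subnormal E'(2) subgroup.subset[OF E'(2)], of "Suc j"] j(1) by simp
  then have "E <#> (M \<inter> h (Suc j)) = M"
    using subnormal_in_max_norm_in[OF E] j(3) by (auto simp: P_def)
  moreover have "\<not> M \<inter> h (Suc j) \<subseteq> h j"
    using j(2,3) by (auto simp: P_def)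
  ultimately show ?thesis
    using j by (auto simp: P_def)
qed

text \<open>With \<open>j\<close> from \<open>jump\<close>, restrict \<open>f\<close> to the
  intersection of \<open>M\<close> with \<open>h (Suc j)\<close> and extend it to
  \<open>h (Suc j)\<close>. This makes factor \<open>j\<close> isomorphic to \<open>S\<close>, so j
  = i. The extension agrees with \<open>f\<close> on the intersection, hence kills the part of
  \<open>E\<close> in \<open>h (Suc i)\<close>, which therefore lies in \<open>h i\<close>.\<close>

lemma factor_imp_covers:
  assumes M: "subnormal_in G (carrier G) M" and f: "epi_kernel G S M E f"
  shows "covers M" "\<not> covers E"
proof -
  have Ms: "subgroup M G"
    using subnormal_in_subgroup[OF M subgroup_self] by simp
  note D = epi_kernelD[OF f Ms]
  have E: "max_norm_in G E M"
    using epi_kernel_max[OF f Ms] .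
  obtain j where j: "j < n" "M \<inter> h j \<subseteq> E" "E <#> (M \<inter> h (Suc j)) = M" "\<not> M \<inter> h (Suc j) \<subseteq> h j"
    using jump[OF M E] by blast
  let ?W = "h (Suc j)" and ?V = "h j" and ?Y = "M \<inter> h (Suc j)"
  have W: "subgroup ?W G" and V: "subgroup ?V G" and VW: "?V \<subseteq> ?W"
    using h_subgroup[of j] h_subgroup[of "Suc j"] h_step[of j] j(1) by (auto simp: norm_in_def)
  have Y: "subgroup ?Y G"
    using subgroups_Inter_pair[OF Ms W] .
  have "subnormal_in G ?W (?W \<inter> M)"
    using subnormal_in_Int[OF M W subgroup.subset[OF W]] .
  then have VY: "?V <#> ?Y = ?W"
    using subnormal_in_max_norm_in[OF h_max[OF j(1)], of ?Y] j(4) by (simp add: Int_commute)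
  have "epi_kernel G S ?Y (?Y \<inter> E) f"
    by (rule epi_kernel_restrict[OF f Ms _ j(3)]) blast
  moreover have "?Y \<inter> ?V \<subseteq> ?Y \<inter> E"
    using j(2) by blast
  ultimately obtain F where F: "epi_kernel G S ?W ?V F" "\<And>y. y \<in> ?Y \<Longrightarrow> F y = f y"
    using epi_kernel_extend[OF h_max[OF j(1)] Y VY] by blast
  then have ji: "j = i"
    using unique j(1) by blast
  then show "covers M"
    using j(4) by (simp add: covers_def)
  have "e \<in> ?V" if e: "e \<in> E" "e \<in> ?W" for e
  proof -
    have "e \<in> ?Y"
      using e D(6) by blast
    then have "F e = \<one>\<^bsub>S\<^esub>"
      using F(2)[of e] D(4)[of e] e(1) by simp
    then show ?thesis
      using epi_kernelD(4)[OF F(1) W e(2)] by simp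
  qed
  then show "\<not> covers E"
    using ji by (auto simp: covers_def)
qed

text \<open>The same transfer backwards: the epimorphism on \<open>h (Suc i)\<close> is restricted
  to the intersection with \<open>M\<close> and extended to \<open>M\<close>.\<close>

lemma covers_imp_factor:
  assumes M: "subnormal_in G (carrier G) M" and E: "max_norm_in G E M"
    and c: "covers M" "\<not> covers E"
  shows "\<exists>f. epi_kernel G S M E f"
proof -
  let ?W = "h (Suc i)" and ?U = "h i" and ?Y = "M \<inter> h (Suc i)"
  obtain f where f: "epi_kernel G S ?W ?U f"
    using i(2) by blast
  have W: "subgroup ?W G"
    using h_subgroup[of "Suc i"] i(1) by simp
  note D = epi_kernelD[OF f W]
  have E': "subgroup E G" "subgroup M G" "E \<subseteq> M"
    using E by (auto simp: max_norm_in_def norm_in_def)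
  have Y: "subgroup ?Y G"
    using subgroups_Inter_pair[OF E'(2) W] .
  have "subnormal_in G M ?Y"
    using subnormal_in_Int[OF h_subnormal E'(2) subgroup.subset[OF E'(2)], of "Suc i"] i(1) by simp
  moreover have "\<not> ?Y \<subseteq> E"
    using c by (auto simp: covers_def)
  ultimately have EY: "E <#> ?Y = M"
    using subnormal_in_max_norm_in[OF E] by blast
  have "subnormal_in G ?W (?W \<inter> M)"
    using subnormal_in_Int[OF M W subgroup.subset[OF W]] .
  then have UY: "?U <#> ?Y = ?W"
    using subnormal_in_max_norm_in[OF h_max[OF i(1)], of ?Y] c(1) by (simp add: Int_commute covers_def)
  have "epi_kernel G S ?Y (?Y \<inter> ?U) f"
    by (rule epi_kernel_restrict[OF f W _ UY]) blast
  moreover have "?Y \<inter> E \<subseteq> ?Y \<inter> ?U"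
    using c(2) by (auto simp: covers_def)
  ultimately show ?thesis
    using epi_kernel_extend[OF E Y EY] by blast
qed

end

context unique_simple_factor
begin

text \<open>When one more conjugate cuts the intersection down, the new quotient is isomorphic to
  that of \<open>M\<close> by this conjugate. If the factor \<open>S\<close> were lost at this step,
  the quotient would be \<open>S\<close>, and conjugating back so would be \<open>M\<close> modulo
  \<open>E\<close>, although \<open>E\<close> still covers the factor.\<close>

lemma covers_Int_conj_sets:
  assumes M: "M \<lhd> G" and E: "max_norm_in G E M" and c: "covers M" "covers E"
    and A: "finite A" "A \<subseteq> carrier G"
  shows "norm_in G (M \<inter> (\<Inter>g \<in> A. conj_set G g E)) M \<and> covers (M \<inter> (\<Inter>g \<in> A. conj_set G g E))"
  using A
proof (induction A rule: finite_induct)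
  case empty
  then show ?case
    using norm_in_refl[OF normal_imp_subgroup[OF M]] c(1) by simp
next
  case (insert g A)
  let ?I = "M \<inter> (\<Inter>g \<in> A. conj_set G g E)" and ?E = "conj_set G g E"
  have I: "norm_in G ?I M" "covers ?I"
    using insert by auto
  have g: "g \<in> carrier G"
    using insert.prems by simp
  have Ms: "subgroup M G" and Is: "subgroup ?I G" and IM: "?I \<subseteq> M"
    using I(1) by (auto simp: norm_in_def)
  have Msn: "subnormal_in G (carrier G) M"
    using norm_in_imp_subnormal M norm_in_carrier_iff by blast
  then have Isn: "subnormal_in G (carrier G) ?I"
    using subnormal_in.step I(1) by blast
  have E': "max_norm_in G ?E M"
    by (rule max_norm_in_conj_set[OF E M g])
  then have E'n: "norm_in G ?E M" and E's: "subgroup ?E G"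
    and E'max: "\<And>K. norm_in G K M \<Longrightarrow> ?E \<subseteq> K \<Longrightarrow> K = ?E \<or> K = M"
    by (auto simp: max_norm_in_def norm_in_def)
  have Ec: "E \<subseteq> carrier G"
    using E subgroup.subset[of E G] by (simp add: max_norm_in_def norm_in_def)
  have no: False if "epi_kernel G S M ?E f" for f
  proof -
    obtain f' where "epi_kernel G S M (conj_set G (inv g) ?E) f'"
      using epi_kernel_conj_set[OF \<open>epi_kernel G S M ?E f\<close> M] g by blast
    then have "epi_kernel G S M E f'"
      using conj_set_inv(1)[OF g Ec] by simp
    then show False
      using factor_imp_covers(2)[OF Msn] c(2) by blast
  qed
  have eq: "M \<inter> (\<Inter>x \<in> insert g A. conj_set G x E) = ?I \<inter> ?E"
    by auto
  have "norm_in G (?I \<inter> ?E) M"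
  proof -
    have "subgroup (?I \<inter> ?E) G"
      by (rule subgroups_Inter_pair[OF Is E's])
    then show ?thesis
      using I(1) E'n unfolding norm_in_def by blast
  qed
  moreover have "covers (?I \<inter> ?E)"
  proof (cases "?I \<subseteq> ?E")
    case True
    then show ?thesis
      using I(2) by (simp add: Int_absorb2)
  next
    case False
    then have EI: "?E <#> ?I = M"
      using subnormal_in_max_norm_in[OF E' norm_in_imp_subnormal[OF I(1)]] by blast
    \<comment> \<open>As \<open>?E <#> ?I = M\<close>, this is the maximality of \<open>?E\<close>
      in \<open>M\<close> carried over: an intermediate \<open>K\<close> is compared through
      \<open>?E <#> K\<close>, which is normal in \<open>M\<close>.\<close>
    have "max_norm_in G (?I \<inter> ?E) ?I"
      unfolding max_norm_in_def
    proof (intro conjI allI impI)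
      show "norm_in G (?I \<inter> ?E) ?I"
        using norm_in_Int[OF E'n Is] IM by (simp add: Int_absorb2)
      show "?I \<inter> ?E \<noteq> ?I"
        using False by blast
      fix K assume K: "norm_in G K ?I" "?I \<inter> ?E \<subseteq> K"
      have Ks: "subgroup K G" and KI: "K \<subseteq> ?I"
        using K(1) by (auto simp: norm_in_def)
      have "norm_in G (?E <#> K) M"
        by (rule norm_in_set_mult[OF E'n K(1) EI])
      then have "?E <#> K = ?E \<or> ?E <#> K = M"
        using E'max subset_set_mult(1)[OF E's Ks] by blast
      then show "K = ?I \<inter> ?E \<or> K = ?I"
      proof
        assume "?E <#> K = ?E"
        then have "K \<subseteq> ?E"
          using subset_set_mult(2)[OF E's Ks] by simp
        then show ?thesis
          using KI K(2) by blast
      next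
        assume EK: "?E <#> K = M"
        have "x \<in> K" if x: "x \<in> ?I" for x
        proof -
          have "x \<in> ?E <#> K"
            using x IM EK by blast
          then obtain e k where ek: "e \<in> ?E" "k \<in> K" "x = e \<otimes> k"
            using mem_set_mult_iff by blast
          have ec: "e \<in> carrier G" and kc: "k \<in> carrier G"
            using subgroup.mem_carrier[OF E's ek(1)] subgroup.mem_carrier[OF Ks ek(2)] .
          have "x \<otimes> inv k = e"
            using ek(3) ec kc by (simp add: m_assoc)
          moreover have "x \<otimes> inv k \<in> ?I"
            using subgroup.m_closed[OF Is x] subgroup.m_inv_closed[OF Is] ek(2) KI by blast
          ultimately have "e \<in> K"
            using ek(1) K(2) by blast
          then show ?thesis
            using ek(2,3) subgroup.m_closed[OF Ks] by simp
        qed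
        then show ?thesis
          using KI by blast
      qed
    qed
    then have max: "max_norm_in G (?I \<inter> ?E) ?I" .
    show ?thesis
    proof (rule ccontr)
      assume "\<not> covers (?I \<inter> ?E)"
      then obtain f where "epi_kernel G S ?I (?I \<inter> ?E) f"
        using covers_imp_factor[OF Isn max I(2)] by blast
      then show False
        using epi_kernel_extend[OF E' Is EI, of "?I \<inter> ?E" f] no by blast
    qed
  qed
  ultimately show ?case
    unfolding eq by blast
qed

text \<open>\<open>M\<close> is a smallest normal subgroup having \<open>S\<close> as a composition factor, and \<open>E\<close> is any maximal normal
  subgroup of \<open>M\<close>. If \<open>E\<close> still had the factor \<open>S\<close>, so would the intersection of its conjugates,
  against minimality; and two distinct conjugates of \<open>E\<close> would yield \<open>S\<close> twice.\<close>

theorem normal_factor_exists: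
  "\<exists>M E f. M \<lhd> G \<and> E \<lhd> G \<and> epi_kernel G S M E f"
proof -
  define P where "P = (\<lambda>M. M \<lhd> G \<and> covers M)"
  have "P (carrier G)"
  proof -
    have "norm_in G (h i) (h (Suc i))" "h i \<noteq> h (Suc i)"
      using h_max[OF i(1)] by (auto simp: max_norm_in_def)
    moreover have "h (Suc i) \<subseteq> carrier G"
      using subgroup.subset[OF h_subgroup[of "Suc i"]] i(1) by simp
    ultimately have "covers (carrier G)"
      by (auto simp: covers_def norm_in_def)
    then show ?thesis
      using norm_in_refl[OF subgroup_self] by (simp add: P_def norm_in_carrier_iff)
  qed
  then obtain M where M: "P M" and min: "\<And>M'. P M' \<Longrightarrow> card M \<le> card M'"
    using ex_has_least_nat[of P "carrier G" card] by blast
  then have MG: "M \<lhd> G" and Mc: "covers M"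
    by (auto simp: P_def)
  have Ms: "subgroup M G" and MC: "M \<subseteq> carrier G"
    using normal_imp_subgroup[OF MG] subgroup.subset[of M G] by auto
  have Msn: "subnormal_in G (carrier G) M"
    using norm_in_imp_subnormal MG norm_in_carrier_iff by blast
  have "M \<noteq> {\<one>}"
    using Mc h_subgroup[of i] subgroup.one_closed[of "h i" G] i(1) by (auto simp: covers_def)
  then obtain E where E: "max_norm_in G E M"
    using max_norm_in_exists[OF fin Ms] by blast
  then have Es: "subgroup E G" and EM: "E \<subseteq> M" "E \<noteq> M" and En: "norm_in G E M"
    by (auto simp: max_norm_in_def norm_in_def)
  have Ec: "E \<subseteq> carrier G"
    using subgroup.subset[OF Es] .
  show ?thesis
  proof (cases "covers E")
    case True
    let ?I = "M \<inter> (\<Inter>g \<in> carrier G. conj_set G g E)"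
    have I: "norm_in G ?I M" "covers ?I"
      using covers_Int_conj_sets[OF MG E Mc True fin] by auto
    have Is: "subgroup ?I G"
      using I(1) by (simp add: norm_in_def)
    have "?I \<lhd> G"
    proof (rule normalI_conj_set[OF Is])
      fix a assume a: "a \<in> carrier G"
      show "conj_set G a ?I \<subseteq> ?I"
      proof
        fix x assume x: "x \<in> conj_set G a ?I"
        have "x \<in> M"
          using x conj_set_mono[of ?I M a] normal_conj_set[OF MG a] by blast
        moreover have "x \<in> conj_set G g E" if g: "g \<in> carrier G" for g
        proof -
          have "inv a \<otimes> g \<in> carrier G"
            using a g by simp
          then have "?I \<subseteq> conj_set G (inv a \<otimes> g) E"
            by blast
          then have "conj_set G a ?I \<subseteq> conj_set G a (conj_set G (inv a \<otimes> g) E)"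
            by (rule conj_set_mono)
          also have "\<dots> = conj_set G g E"
            using conj_set_mult[OF a \<open>inv a \<otimes> g \<in> carrier G\<close> Ec] a g by (simp add: m_assoc[symmetric])
          finally show ?thesis
            using x by blast
        qed
        ultimately show "x \<in> ?I"
          by blast
      qed
    qed
    then have "card M \<le> card ?I"
      using min[of ?I] I(2) by (simp add: P_def)
    moreover have "?I \<subseteq> E"
      using conj_set_one[OF Ec] by blast
    then have "?I \<subset> M"
      using EM by blast
    then have "card ?I < card M"
      using finite_subset[OF MC fin] psubset_card_mono by blast
    ultimately show ?thesis
      by simp
  next
    case False
    then obtain f where f: "epi_kernel G S M E f"
      using covers_imp_factor[OF Msn E Mc] by blast
    have "conj_set G g E = E" if g: "g \<in> carrier G" for g
    proof (rule ccontr)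
      let ?E = "conj_set G g E"
      assume ne: "?E \<noteq> E"
      obtain f' where f': "epi_kernel G S M ?E f'"
        using epi_kernel_conj_set[OF f MG g] by blast
      have E': "max_norm_in G ?E M"
        by (rule epi_kernel_max[OF f' Ms])
      have Esn: "subnormal_in G (carrier G) E"
        using subnormal_in.step[OF Msn En] .
      have "\<not> E \<subseteq> ?E"
      proof
        assume "E \<subseteq> ?E"
        moreover have "norm_in G ?E M" "?E \<noteq> M"
          using E' by (auto simp: max_norm_in_def)
        ultimately show False
          using E ne unfolding max_norm_in_def by blast
      qed
      then have EE: "?E <#> E = M"
        using subnormal_in_max_norm_in[OF E' norm_in_imp_subnormal[OF En]] by blast
      have "epi_kernel G S E (E \<inter> ?E) f'"
        by (rule epi_kernel_restrict[OF f' Ms EM(1) EE])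
      then show False
        using factor_imp_covers(1)[OF Esn] False by blast
    qed
    then have "E \<lhd> G"
      using normalI_conj_set[OF Es] by simp
    then show ?thesis
      using MG f by blast
  qed
qed

end

section \<open>The automorphism group and the action on the chief factor\<close>

lemma carrier_AutoGroup: "carrier (AutoGroup S) = auto S"
  by (simp add: AutoGroup_def)

lemma mult_AutoGroup:
  "f \<in> auto S \<Longrightarrow> g \<in> auto S \<Longrightarrow> f \<otimes>\<^bsub>AutoGroup S\<^esub> g = compose (carrier S) f g"
  by (simp add: AutoGroup_def BijGroup_def auto_def)

lemma one_AutoGroup: "\<one>\<^bsub>AutoGroup S\<^esub> = (\<lambda>x \<in> carrier S. x)"
  by (simp add: AutoGroup_def BijGroup_def)

lemma autoI:
  assumes "\<And>x. x \<in> carrier S \<Longrightarrow> f x \<in> carrier S" "f \<in> extensional (carrier S)"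
    "\<And>x y. x \<in> carrier S \<Longrightarrow> y \<in> carrier S \<Longrightarrow> f (x \<otimes>\<^bsub>S\<^esub> y) = f x \<otimes>\<^bsub>S\<^esub> f y"
    "bij_betw f (carrier S) (carrier S)"
  shows "f \<in> auto S"
  using assms by (auto simp: auto_def hom_def Bij_def)

context group_and_simple
begin

text \<open>\<open>\<theta>\<close> is the conjugation action of \<open>G\<close> on \<open>M / E\<close>, transported to \<open>S\<close> along \<open>f\<close>.\<close>

theorem conj_action_hom:
  assumes M: "M \<lhd> G" and E: "E \<lhd> G" and f: "epi_kernel G S M E f"
  shows "\<exists>\<theta>. \<theta> \<in> hom G (AutoGroup S) \<and> Inn S \<subseteq> \<theta> ` carrier G"
proof -
  interpret M: normal M G by fact
  interpret E: normal E G by fact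
  note D = epi_kernelD[OF f M.subgroup_axioms]
  define r where "r = (\<lambda>s. SOME m. m \<in> M \<and> f m = s)"
  have r: "r s \<in> M" "f (r s) = s" if "s \<in> carrier S" for s
  proof -
    have "s \<in> f ` M"
      using that D(5) by simp
    then have "\<exists>m. m \<in> M \<and> f m = s"
      by auto
    then have "r s \<in> M \<and> f (r s) = s"
      unfolding r_def by (rule someI_ex)
    then show "r s \<in> M" "f (r s) = s"
      by auto
  qed
  have c: "g \<otimes> m \<otimes> inv g \<in> M" if "g \<in> carrier G" "m \<in> M" for g m
    using M.inv_op_closed2[OF that] .
  define \<theta> where "\<theta> = (\<lambda>g. \<lambda>s \<in> carrier S. f (g \<otimes> r s \<otimes> inv g))"
  \<comment> \<open>The representative does not matter: \<open>r (f m)\<close> and \<open>m\<close>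
    differ by an element of \<open>E\<close>, which stays in \<open>E\<close> under conjugation by
    \<open>g\<close>.\<close>
  have \<theta>f: "\<theta> g (f m) = f (g \<otimes> m \<otimes> inv g)" if g: "g \<in> carrier G" and m: "m \<in> M" for g m
  proof -
    let ?x = "r (f m)"
    have x: "?x \<in> M" "f ?x = f m"
      using r D(3) m by auto
    have "f (inv m \<otimes> ?x) = \<one>\<^bsub>S\<^esub>"
      using D(1)[of "inv m" ?x] D(2)[of m] D(3)[of m] x m by simp
    then have "inv m \<otimes> ?x \<in> E"
      using D(4)[of "inv m \<otimes> ?x"] x m by simp
    then have e: "g \<otimes> (inv m \<otimes> ?x) \<otimes> inv g \<in> E"
      using E.inv_op_closed2 g by blast
    have "g \<otimes> ?x \<otimes> inv g = (g \<otimes> m \<otimes> inv g) \<otimes> (g \<otimes> (inv m \<otimes> ?x) \<otimes> inv g)"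
    proof -
      have "inv g \<otimes> (g \<otimes> (inv m \<otimes> (?x \<otimes> inv g))) = inv m \<otimes> (?x \<otimes> inv g)"
        using g m x by (simp add: m_assoc[symmetric])
      moreover have "m \<otimes> (inv m \<otimes> (?x \<otimes> inv g)) = ?x \<otimes> inv g"
        using g m x by (simp add: m_assoc[symmetric])
      ultimately show ?thesis
        using g m x by (simp add: m_assoc)
    qed
    then have "f (g \<otimes> ?x \<otimes> inv g) = f (g \<otimes> m \<otimes> inv g) \<otimes>\<^bsub>S\<^esub> f (g \<otimes> (inv m \<otimes> ?x) \<otimes> inv g)"
      using D(1) c g m x by simp
    also have "\<dots> = f (g \<otimes> m \<otimes> inv g)"
      using D(4)[of "g \<otimes> (inv m \<otimes> ?x) \<otimes> inv g"] e D(6) D(3) c g m by auto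
    finally show ?thesis
      using D(3) m by (simp add: \<theta>_def)
  qed
  have S_ex: "\<exists>m \<in> M. s = f m" if "s \<in> carrier S" for s
  proof -
    have "s \<in> f ` M"
      using that D(5) by simp
    then show ?thesis
      by auto
  qed
  have \<theta>c: "\<theta> g s \<in> carrier S" if "g \<in> carrier G" "s \<in> carrier S" for g s
    using that r D(3) c by (simp add: \<theta>_def)
  have \<theta>m: "\<theta> (g \<otimes> k) s = \<theta> g (\<theta> k s)" if gk: "g \<in> carrier G" "k \<in> carrier G" and s: "s \<in> carrier S" for g k s
  proof -
    obtain m where m: "m \<in> M" "s = f m"
      using S_ex s by blast
    have "(g \<otimes> k) \<otimes> m \<otimes> inv (g \<otimes> k) = g \<otimes> (k \<otimes> m \<otimes> inv k) \<otimes> inv g"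
      using gk m(1) by (simp add: inv_mult_group m_assoc)
    then show ?thesis
      using \<theta>f gk m c by simp
  qed
  have \<theta>1: "\<theta> \<one> s = s" if "s \<in> carrier S" for s
    using \<theta>f[OF one_closed] S_ex[OF that] by auto
  have ext: "\<theta> g \<in> extensional (carrier S)" for g
    by (simp add: \<theta>_def)
  have \<theta>a: "\<theta> g \<in> auto S" if g: "g \<in> carrier G" for g
  proof (rule autoI)
    show "\<theta> g (x \<otimes>\<^bsub>S\<^esub> y) = \<theta> g x \<otimes>\<^bsub>S\<^esub> \<theta> g y" if xy: "x \<in> carrier S" "y \<in> carrier S" for x y
    proof -
      obtain m k where m: "m \<in> M" "x = f m" "k \<in> M" "y = f k"
        using S_ex xy by metis
      have "inv g \<otimes> (g \<otimes> (k \<otimes> inv g)) = k \<otimes> inv g"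
        using g m by (simp add: m_assoc[symmetric])
      then have "g \<otimes> (m \<otimes> k) \<otimes> inv g = (g \<otimes> m \<otimes> inv g) \<otimes> (g \<otimes> k \<otimes> inv g)"
        using g m by (simp add: m_assoc)
      then have "f (g \<otimes> (m \<otimes> k) \<otimes> inv g) = f (g \<otimes> m \<otimes> inv g) \<otimes>\<^bsub>S\<^esub> f (g \<otimes> k \<otimes> inv g)"
        using D(1) c g m by simp
      then have "\<theta> g (f (m \<otimes> k)) = \<theta> g x \<otimes>\<^bsub>S\<^esub> \<theta> g y"
        using \<theta>f[OF g] m by simp
      then show ?thesis
        using D(1) m by simp
    qed
    show "bij_betw (\<theta> g) (carrier S) (carrier S)"
    proof (rule bij_betw_byWitness[where f' = "\<theta> (inv g)"])
      show "\<forall>a \<in> carrier S. \<theta> (inv g) (\<theta> g a) = a" "\<forall>a \<in> carrier S. \<theta> g (\<theta> (inv g) a) = a"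
        using \<theta>m[of "inv g" g] \<theta>m[of g "inv g"] \<theta>1 g by auto
    qed (use \<theta>c g in auto)
  qed (use \<theta>c g ext in auto)
  have "\<theta> \<in> hom G (AutoGroup S)"
    unfolding hom_def
  proof (intro CollectI conjI ballI)
    show "\<theta> \<in> carrier G \<rightarrow> carrier (AutoGroup S)"
      using \<theta>a by (auto simp: carrier_AutoGroup)
    show "\<theta> (g \<otimes> k) = \<theta> g \<otimes>\<^bsub>AutoGroup S\<^esub> \<theta> k" if gk: "g \<in> carrier G" "k \<in> carrier G" for g k
      unfolding mult_AutoGroup[OF \<theta>a[OF gk(1)] \<theta>a[OF gk(2)]]
      by (rule extensionalityI[OF ext compose_extensional]) (use \<theta>m gk in \<open>simp add: compose_def\<close>)
  qed
  moreover have "Inn S \<subseteq> \<theta> ` carrier G"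
  proof
    fix a assume "a \<in> Inn S"
    then obtain s where s: "s \<in> carrier S" "a = (\<lambda>x \<in> carrier S. s \<otimes>\<^bsub>S\<^esub> x \<otimes>\<^bsub>S\<^esub> inv\<^bsub>S\<^esub> s)"
      by (auto simp: Inn_def)
    then obtain g where g: "g \<in> M" "s = f g"
      using S_ex by blast
    \<comment> \<open>An element of \<open>M\<close> acts on the chief factor as conjugation by its
      own image under \<open>f\<close>.\<close>
    have "a = \<theta> g"
    proof (rule extensionalityI[OF _ ext])
      show "a \<in> extensional (carrier S)"
        by (simp add: s(2))
      fix x assume x: "x \<in> carrier S"
      then obtain m where m: "m \<in> M" "x = f m"
        using S_ex by blast
      show "a x = \<theta> g x"
        using x \<theta>f[of g m] g m D(1)[of "g \<otimes> m" "inv g"] D(1)[of g m] D(2)[of g] by (simp add: s(2))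
    qed
    then show "a \<in> \<theta> ` carrier G"
      using g(1) by auto
  qed
  ultimately show ?thesis
    by blast
qed

end

section \<open>Automorphisms of nonabelian simple groups\<close>

context simple_group
begin

definition inner :: "'a \<Rightarrow> 'a \<Rightarrow> 'a" where
  "inner s = (\<lambda>x \<in> carrier G. s \<otimes> x \<otimes> inv s)"

lemma inner_auto:
  assumes s: "s \<in> carrier G"
  shows "inner s \<in> auto G"
proof (rule autoI)
  have *: "inv s \<otimes> (s \<otimes> z) = z" "s \<otimes> (inv s \<otimes> z) = z" if "z \<in> carrier G" for z
    using that s by (simp_all add: m_assoc[symmetric])
  show "inner s (x \<otimes> y) = inner s x \<otimes> inner s y" if "x \<in> carrier G" "y \<in> carrier G" for x y
    using that s by (simp add: inner_def m_assoc *)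
  show "bij_betw (inner s) (carrier G) (carrier G)"
    by (rule bij_betw_byWitness[where f' = "\<lambda>x. inv s \<otimes> x \<otimes> s"])
      (use s in \<open>auto simp: inner_def m_assoc *\<close>)
qed (use s in \<open>auto simp: inner_def\<close>)

lemma Inn_eq: "Inn G = inner ` carrier G"
  by (simp add: Inn_def inner_def[abs_def])

lemma inner_hom: "inner \<in> hom G (AutoGroup G)"
  unfolding hom_def
proof (intro CollectI conjI ballI)
  show "inner \<in> carrier G \<rightarrow> carrier (AutoGroup G)"
    using inner_auto by (auto simp: carrier_AutoGroup)
  show "inner (s \<otimes> t) = inner s \<otimes>\<^bsub>AutoGroup G\<^esub> inner t" if st: "s \<in> carrier G" "t \<in> carrier G" for s t
    unfolding mult_AutoGroup[OF inner_auto[OF st(1)] inner_auto[OF st(2)]]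
    using st by (auto simp: inner_def compose_def fun_eq_iff inv_mult_group m_assoc)
qed

lemma inner_group_hom: "group_hom G (AutoGroup G) inner"
  by (simp add: group_hom_def group_hom_axioms_def inner_hom AutoGroup)

lemma auto_apply:
  assumes "\<alpha> \<in> auto G"
  shows "\<And>x. x \<in> carrier G \<Longrightarrow> \<alpha> x \<in> carrier G"
    "\<And>x y. x \<in> carrier G \<Longrightarrow> y \<in> carrier G \<Longrightarrow> \<alpha> (x \<otimes> y) = \<alpha> x \<otimes> \<alpha> y"
    "\<And>x. x \<in> carrier G \<Longrightarrow> \<alpha> (inv x) = inv (\<alpha> x)"
proof -
  have "\<alpha> \<in> hom G G"
    using assms by (simp add: auto_def)
  then interpret group_hom G G \<alpha>
    by unfold_locales
  show "\<And>x. x \<in> carrier G \<Longrightarrow> \<alpha> x \<in> carrier G"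
    "\<And>x y. x \<in> carrier G \<Longrightarrow> y \<in> carrier G \<Longrightarrow> \<alpha> (x \<otimes> y) = \<alpha> x \<otimes> \<alpha> y"
    "\<And>x. x \<in> carrier G \<Longrightarrow> \<alpha> (inv x) = inv (\<alpha> x)"
    by simp_all
qed

lemma auto_conj_inner:
  assumes \<alpha>: "\<alpha> \<in> auto G" and s: "s \<in> carrier G"
  shows "\<alpha> \<otimes>\<^bsub>AutoGroup G\<^esub> inner s \<otimes>\<^bsub>AutoGroup G\<^esub> inv\<^bsub>AutoGroup G\<^esub> \<alpha> = inner (\<alpha> s)"
proof -
  interpret A: group "AutoGroup G"
    by (rule AutoGroup)
  note D = auto_apply[OF \<alpha>]
  have "\<alpha> \<otimes>\<^bsub>AutoGroup G\<^esub> inner s = inner (\<alpha> s) \<otimes>\<^bsub>AutoGroup G\<^esub> \<alpha>"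
    unfolding mult_AutoGroup[OF \<alpha> inner_auto[OF s]] mult_AutoGroup[OF inner_auto[OF D(1)[OF s]] \<alpha>]
    using D s by (auto simp: inner_def compose_def fun_eq_iff)
  moreover have "\<alpha> \<in> carrier (AutoGroup G)" "inner (\<alpha> s) \<in> carrier (AutoGroup G)"
    using \<alpha> inner_auto[OF D(1)[OF s]] by (simp_all add: carrier_AutoGroup)
  ultimately show ?thesis
    by (simp add: A.m_assoc)
qed

lemma Inn_normal: "Inn G \<lhd> AutoGroup G"
proof -
  interpret A: group "AutoGroup G"
    by (rule AutoGroup)
  interpret I: group_hom G "AutoGroup G" inner
    by (rule inner_group_hom)
  show ?thesis
  proof (rule A.normalI_conj_set)
    show "subgroup (Inn G) (AutoGroup G)"
      using I.subgroup_img_is_subgroup[OF subgroup_self] by (simp add: Inn_eq)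
    show "conj_set (AutoGroup G) a (Inn G) \<subseteq> Inn G" if "a \<in> carrier (AutoGroup G)" for a
      using that auto_conj_inner auto_apply(1) by (auto simp: conj_set_def Inn_eq carrier_AutoGroup)
  qed
qed

lemma center_trivial:
  assumes "\<not> comm_group G" and z: "z \<in> carrier G" "\<And>x. x \<in> carrier G \<Longrightarrow> z \<otimes> x = x \<otimes> z"
  shows "z = \<one>"
proof -
  let ?Z = "{z \<in> carrier G. \<forall>x \<in> carrier G. z \<otimes> x = x \<otimes> z}"
  have "subgroup ?Z G"
  proof (rule subgroupI)
    show "inv a \<in> ?Z" if a: "a \<in> ?Z" for a
    proof -
      have "inv a \<otimes> x = x \<otimes> inv a" if x: "x \<in> carrier G" for x
      proof -
        have ax: "a \<in> carrier G" "a \<otimes> x = x \<otimes> a"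
          using a x by auto
        have "inv a \<otimes> x = inv a \<otimes> (x \<otimes> a) \<otimes> inv a"
          using ax(1) x by (simp add: m_assoc)
        also have "\<dots> = inv a \<otimes> (a \<otimes> x) \<otimes> inv a"
          by (simp only: ax(2))
        also have "\<dots> = x \<otimes> inv a"
          using ax(1) x by (simp add: m_assoc[symmetric])
        finally show ?thesis .
      qed
      then show ?thesis
        using a by simp
    qed
    show "a \<otimes> b \<in> ?Z" if ab: "a \<in> ?Z" "b \<in> ?Z" for a b
    proof -
      have "(a \<otimes> b) \<otimes> x = x \<otimes> (a \<otimes> b)" if x: "x \<in> carrier G" for x
      proof -
        have c: "a \<in> carrier G" "b \<in> carrier G" and e: "a \<otimes> x = x \<otimes> a" "b \<otimes> x = x \<otimes> b"
          using ab x by auto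
        have "(a \<otimes> b) \<otimes> x = a \<otimes> (b \<otimes> x)"
          using c x by (rule m_assoc)
        also have "\<dots> = (a \<otimes> x) \<otimes> b"
          unfolding e(2) using c x by (simp add: m_assoc)
        also have "\<dots> = x \<otimes> (a \<otimes> b)"
          unfolding e(1) using c x by (simp add: m_assoc)
        finally show ?thesis .
      qed
      moreover have "a \<in> carrier G" "b \<in> carrier G"
        using ab by auto
      ultimately show ?thesis
        using m_closed[of a b] by blast
    qed
    show "?Z \<subseteq> carrier G"
      by blast
    have "\<one> \<in> ?Z"
      by simp
    then show "?Z \<noteq> {}"
      by blast
  qed
  moreover have "conj_set G a ?Z \<subseteq> ?Z" if a: "a \<in> carrier G" for a
  proof -
    have "a \<otimes> z \<otimes> inv a = z" if z: "z \<in> ?Z" for z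
    proof -
      have c: "z \<in> carrier G" and e: "a \<otimes> z = z \<otimes> a"
        using z a by auto
      show ?thesis
        unfolding e using c a by (simp add: m_assoc)
    qed
    then show ?thesis
      unfolding conj_set_def by auto
  qed
  ultimately have "?Z \<lhd> G"
    by (rule normalI_conj_set)
  moreover have "?Z \<noteq> carrier G"
  proof
    assume Z: "?Z = carrier G"
    have "comm_group G"
    proof (rule group_comm_groupI)
      fix x y assume "x \<in> carrier G" "y \<in> carrier G"
      then show "x \<otimes> y = y \<otimes> x"
        using Z by blast
    qed
    then show False
      using assms(1) by blast
  qed
  ultimately have "?Z = {\<one>}"
    using no_real_normal_subgroup by blast
  then show ?thesis
    using z by blast
qed

lemma inner_inj:
  assumes "\<not> comm_group G"
  shows "inj_on inner (carrier G)"
proof -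
  interpret I: group_hom G "AutoGroup G" inner
    by (rule inner_group_hom)
  have "z = \<one>" if z: "z \<in> carrier G" "inner z = \<one>\<^bsub>AutoGroup G\<^esub>" for z
  proof (rule center_trivial[OF assms z(1)])
    fix x assume x: "x \<in> carrier G"
    have "inner z x = x"
      using x by (simp add: z(2) one_AutoGroup)
    then have "z \<otimes> x \<otimes> inv z \<otimes> z = x \<otimes> z"
      using x by (simp add: inner_def)
    then show "z \<otimes> x = x \<otimes> z"
      using x z(1) by (simp add: m_assoc)
  qed
  then show ?thesis
    using I.inj_on_one_iff by blast
qed

text \<open>The fixed points of the conjugation action form the centre, which is trivial; so the
  order would be congruent to 1 modulo \<open>p\<close> while being a positive power of
  \<open>p\<close>.\<close>

lemma not_p_group:
  assumes "\<not> comm_group G" "finite (carrier G)" "Factorial_Ring.prime p"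
  shows "card (carrier G) \<noteq> p ^ k"
proof
  assume c: "card (carrier G) = p ^ k"
  have "card (carrier G) mod p = card {x \<in> carrier G. \<forall>g \<in> carrier G. g \<otimes> x \<otimes> inv g = x} mod p"
  proof (rule p_group_fixed_points[OF assms(3)])
    show "order G = p ^ k"
      using c by (simp add: order_def)
  qed (use assms(2) in \<open>auto simp: inv_mult_group m_assoc\<close>)
  moreover have "{x \<in> carrier G. \<forall>g \<in> carrier G. g \<otimes> x \<otimes> inv g = x} = {\<one>}"
  proof -
    have "x = \<one>" if x: "x \<in> carrier G" "\<forall>g \<in> carrier G. g \<otimes> x \<otimes> inv g = x" for x
    proof (rule center_trivial[OF assms(1) x(1)])
      fix g assume g: "g \<in> carrier G"
      then have "g \<otimes> x \<otimes> inv g \<otimes> g = x \<otimes> g"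
        using x(2) by simp
      then show "x \<otimes> g = g \<otimes> x"
        using x(1) g by (simp add: m_assoc)
    qed
    then show ?thesis
      by auto
  qed
  ultimately have "card (carrier G) mod p = 1 mod p"
    by simp
  moreover have "k \<noteq> 0"
    using c order_gt_one by (cases k) (auto simp: order_def)
  then have "card (carrier G) mod p = 0"
    using c by simp
  ultimately show False
    using assms(3) prime_gt_1_nat by fastforce
qed

text \<open>If \<alpha> in \<open>J\<close> moves \<open>s\<close>, the commutator of \<alpha> with
  \<open>inner s\<close> is \<open>inner (\<alpha> s \<otimes> inv s)\<close>, a nontrivial inner
  automorphism in \<open>J\<close>. So \<open>J\<close> pulls back along \<open>inner\<close> to a
  nontrivial normal subgroup of the simple group.\<close>

lemma normal_contains_Inn:
  assumes B: "subgroup B (AutoGroup G)" "Inn G \<subseteq> B"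
    and J: "J \<lhd> (AutoGroup G)\<lparr>carrier := B\<rparr>" "J \<noteq> {\<one>\<^bsub>AutoGroup G\<^esub>}"
  shows "Inn G \<subseteq> J"
proof -
  interpret A: group "AutoGroup G"
    by (rule AutoGroup)
  interpret I: group_hom G "AutoGroup G" inner
    by (rule inner_group_hom)
  interpret J: normal J "(AutoGroup G)\<lparr>carrier := B\<rparr>" by fact
  have Js: "subgroup J (AutoGroup G)" and JB: "J \<subseteq> B"
    using A.incl_subgroup[OF B(1) J.subgroup_axioms] J.subset by auto
  have conj: "a \<otimes>\<^bsub>AutoGroup G\<^esub> j \<otimes>\<^bsub>AutoGroup G\<^esub> inv\<^bsub>AutoGroup G\<^esub> a \<in> J" if "a \<in> B" "j \<in> J" for a j
    using J.inv_op_closed2[of a j] that A.m_inv_consistent[OF B(1) that(1)] by simp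
  have BA: "b \<in> auto G" if "b \<in> B" for b
    using subgroup.mem_carrier[OF B(1) that] by (simp add: carrier_AutoGroup)
  have inB: "inner s \<in> B" if "s \<in> carrier G" for s
    using B(2) that by (auto simp: Inn_eq)
  let ?K = "{s \<in> carrier G. inner s \<in> J}"
  have "subgroup ?K G"
  proof (rule subgroupI)
    show "?K \<noteq> {}"
      using subgroup.one_closed[OF Js] by (auto intro!: exI[of _ \<one>])
  qed (use subgroup.m_closed[OF Js] subgroup.m_inv_closed[OF Js] in auto)
  moreover have "conj_set G a ?K \<subseteq> ?K" if "a \<in> carrier G" for a
    using that conj[OF inB] by (auto simp: conj_set_def)
  ultimately have K: "?K \<lhd> G"
    by (rule normalI_conj_set)
  have "\<one>\<^bsub>AutoGroup G\<^esub> \<in> J"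
    using subgroup.one_closed[OF Js] .
  then obtain \<alpha> where \<alpha>: "\<alpha> \<in> J" "\<alpha> \<noteq> \<one>\<^bsub>AutoGroup G\<^esub>"
    using J(2) by blast
  have \<alpha>a: "\<alpha> \<in> auto G"
    using \<alpha>(1) JB BA by blast
  have "\<exists>s \<in> carrier G. \<alpha> s \<noteq> s"
  proof (rule ccontr)
    assume "\<not> (\<exists>s \<in> carrier G. \<alpha> s \<noteq> s)"
    then have "\<alpha> = \<one>\<^bsub>AutoGroup G\<^esub>"
      unfolding one_AutoGroup
      using \<alpha>a by (intro extensionalityI[of _ "carrier G"]) (auto simp: auto_def Bij_def)
    then show False
      using \<alpha>(2) by blast
  qed
  then obtain s where s: "s \<in> carrier G" "\<alpha> s \<noteq> s"
    by blast
  have \<alpha>s: "\<alpha> s \<in> carrier G"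
    using auto_apply(1)[OF \<alpha>a s(1)] .
  have "inner (\<alpha> s) \<otimes>\<^bsub>AutoGroup G\<^esub> inv\<^bsub>AutoGroup G\<^esub> inner s = \<alpha> \<otimes>\<^bsub>AutoGroup G\<^esub>
      (inner s \<otimes>\<^bsub>AutoGroup G\<^esub> inv\<^bsub>AutoGroup G\<^esub> \<alpha> \<otimes>\<^bsub>AutoGroup G\<^esub> inv\<^bsub>AutoGroup G\<^esub> inner s)"
    unfolding auto_conj_inner[OF \<alpha>a s(1), symmetric]
    using subgroup.mem_carrier[OF Js \<alpha>(1)] I.hom_closed[OF s(1)] by (simp add: A.m_assoc)
  moreover have "\<dots> \<in> J"
    using \<alpha>(1) conj[OF inB[OF s(1)]] subgroup.m_closed[OF Js] subgroup.m_inv_closed[OF Js] by blast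
  ultimately have "inner (\<alpha> s \<otimes> inv s) \<in> J"
    using \<alpha>s s(1) by simp
  then have "\<alpha> s \<otimes> inv s \<in> ?K"
    using \<alpha>s s(1) by simp
  moreover have "\<alpha> s \<otimes> inv s \<noteq> \<one>"
    using \<alpha>s s inv_equality[of "\<alpha> s" "inv s"] by auto
  ultimately have "?K = carrier G"
    using no_real_normal_subgroup[OF K] by blast
  then show ?thesis
    by (auto simp: Inn_eq)
qed

text \<open>Otherwise \<open>Q\<close> is a normal \<open>p\<close>-subgroup of \<open>B\<close>. If
  it is trivial, \<open>B\<close> is cyclic and the simple group, embedded by \<open>inner\<close>,
  is abelian; if not, \<open>Q\<close> contains all inner automorphisms and the simple group is a
  \<open>p\<close>-group.\<close>

lemma hypo_elementary_proper:
  assumes nc: "\<not> comm_group G" and fin: "finite (carrier G)" and p: "Factorial_Ring.prime p"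
    and B: "subgroup B (AutoGroup G)" "Inn G \<subseteq> B"
    and Q: "subgroup Q ((AutoGroup G)\<lparr>carrier := B\<rparr>)" "card Q = p ^ k"
    and h: "h \<in> B" "conj_set ((AutoGroup G)\<lparr>carrier := B\<rparr>) h Q = Q"
  shows "generate ((AutoGroup G)\<lparr>carrier := B\<rparr>) (Q \<union> {h}) \<noteq> B"
proof
  let ?A = "(AutoGroup G)\<lparr>carrier := B\<rparr>"
  assume gen: "generate ?A (Q \<union> {h}) = B"
  interpret Au: group "AutoGroup G"
    by (rule AutoGroup)
  interpret A: group ?A
    using B(1) Au.subgroup_imp_group by blast
  interpret I: group_hom G "AutoGroup G" inner
    by (rule inner_group_hom)
  have QB: "Q \<subseteq> B"
    using subgroup.subset[OF Q(1)] by simp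
  let ?N = "normalizer_in ?A B Q"
  have "subgroup ?N ?A"
    using A.normalizer_in_subgroup[OF A.subgroup_self, of Q] QB by simp
  moreover have "Q \<union> {h} \<subseteq> ?N"
    using A.conj_set_self[OF Q(1)] QB h by (auto simp: normalizer_in_def)
  ultimately have "B \<subseteq> ?N"
    using A.generate_subgroup_incl[of "Q \<union> {h}" ?N] gen by simp
  then have "Q \<lhd> ?A"
    using A.normalI_conj_set[OF Q(1)] by (auto simp: normalizer_in_def)
  show False
  proof (cases "Q = {\<one>\<^bsub>AutoGroup G\<^esub>}")
    case True
    have "Q \<union> {h} \<subseteq> generate ?A {h}"
      using True generate.one[of ?A "{h}"] generate.incl[of h "{h}" ?A] by simp
    then have "B \<subseteq> generate ?A {h}"
      using A.generate_subgroup_incl[OF _ A.generate_is_subgroup[of "{h}"], of "Q \<union> {h}"] gen h(1) by simp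
    then have pow: "\<exists>n::int. b = h [^]\<^bsub>?A\<^esub> n" if "b \<in> B" for b
      using that A.generate_pow[of h] h(1) by auto
    have comm: "a \<otimes>\<^bsub>AutoGroup G\<^esub> b = b \<otimes>\<^bsub>AutoGroup G\<^esub> a" if ab: "a \<in> B" "b \<in> B" for a b
    proof -
      obtain m n :: int where "a = h [^]\<^bsub>?A\<^esub> m" "b = h [^]\<^bsub>?A\<^esub> n"
        using pow[OF ab(1)] pow[OF ab(2)] by blast
      then have "a \<otimes>\<^bsub>?A\<^esub> b = b \<otimes>\<^bsub>?A\<^esub> a"
        using h(1) A.int_pow_mult[of h m n] A.int_pow_mult[of h n m] by (simp add: add.commute)
      then show ?thesis
        by simp
    qed
    have "comm_group G"
    proof (rule group_comm_groupI)
      fix x y assume xy: "x \<in> carrier G" "y \<in> carrier G"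
      then have "inner x \<in> B" "inner y \<in> B"
        using B(2) by (auto simp: Inn_eq)
      then have "inner (x \<otimes> y) = inner (y \<otimes> x)"
        using comm xy by simp
      then show "x \<otimes> y = y \<otimes> x"
        using inj_onD[OF inner_inj[OF nc]] xy by simp
    qed
    then show False
      using nc by blast
  next
    case False
    then have IQ: "Inn G \<subseteq> Q"
      using normal_contains_Inn[OF B \<open>Q \<lhd> ?A\<close>] by simp
    have "subgroup Q (AutoGroup G)"
      using Au.incl_subgroup[OF B(1) Q(1)] .
    then have "card (Inn G) dvd p ^ k"
      using Au.card_subgroup_dvd[OF normal_imp_subgroup[OF Inn_normal] _ IQ] Q(2) by simp
    moreover have "card (Inn G) = card (carrier G)"
      using card_image[OF inner_inj[OF nc]] by (simp add: Inn_eq)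
    ultimately obtain j where "card (carrier G) = p ^ j"
      using divides_primepow_nat[OF p] by auto
    then show False
      using not_p_group[OF nc fin p] by blast
  qed
qed

lemma derived_self:
  assumes "\<not> comm_group G"
  shows "(derived G ^^ n) (carrier G) = carrier G"
proof -
  have "derived G (carrier G) \<lhd> G"
    using derived_is_normal[OF normal_self] .
  moreover have "derived G (carrier G) \<noteq> {\<one>}"
  proof
    assume d: "derived G (carrier G) = {\<one>}"
    have "comm_group G"
    proof (rule group_comm_groupI)
      fix x y assume xy: "x \<in> carrier G" "y \<in> carrier G"
      have "x \<otimes> y \<otimes> inv x \<otimes> inv y \<in> derived G (carrier G)"
        unfolding derived_def by (rule generate.incl) (use xy in blast)
      then have 1: "x \<otimes> y \<otimes> inv x \<otimes> inv y = \<one>"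
        using d by simp
      have "x \<otimes> y = (x \<otimes> y \<otimes> inv x \<otimes> inv y) \<otimes> (y \<otimes> x)"
      proof -
        have "inv y \<otimes> (y \<otimes> x) = x"
          using xy by (simp add: m_assoc[symmetric])
        then show ?thesis
          using xy by (simp add: m_assoc)
      qed
      then show "x \<otimes> y = y \<otimes> x"
        using 1 xy by simp
    qed
    then show False
      using assms by blast
  qed
  ultimately have "derived G (carrier G) = carrier G"
    using no_real_normal_subgroup by blast
  then show ?thesis
    by (induction n) simp_all
qed

text \<open>The simple group is perfect, hence so is its image under \<open>inner\<close>, and the
  derived series of \<open>B\<close> never drops below it.\<close>

lemma derived_Inn_nontrivial:
  assumes nc: "\<not> comm_group G" and B: "Inn G \<subseteq> B"
  shows "(derived (AutoGroup G) ^^ n) B \<noteq> {\<one>\<^bsub>AutoGroup G\<^esub>}"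
proof
  assume d: "(derived (AutoGroup G) ^^ n) B = {\<one>\<^bsub>AutoGroup G\<^esub>}"
  interpret Au: group "AutoGroup G"
    by (rule AutoGroup)
  interpret I: group_hom G "AutoGroup G" inner
    by (rule inner_group_hom)
  have "(derived (AutoGroup G) ^^ n) (Inn G) = inner ` ((derived G ^^ n) (carrier G))"
    using I.exp_of_derived_img[of "carrier G" n] by (simp add: Inn_eq)
  then have "(derived (AutoGroup G) ^^ n) (Inn G) = Inn G"
    by (simp only: derived_self[OF nc] Inn_eq)
  then have "Inn G \<subseteq> (derived (AutoGroup G) ^^ n) B"
    using Au.mono_exp_of_derived[OF B, of n] by simp
  then have I1: "inner ` carrier G \<subseteq> {\<one>\<^bsub>AutoGroup G\<^esub>}"
    using d by (simp add: Inn_eq)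
  have "x = \<one>" if x: "x \<in> carrier G" for x
  proof -
    have "inner x \<in> {\<one>\<^bsub>AutoGroup G\<^esub>}"
      using I1 x by (rule subsetD[OF _ imageI])
    then have "inner x = inner \<one>"
      by simp
    then show ?thesis
      using inj_onD[OF inner_inj[OF nc]] x by simp
  qed
  then show False
    using simple_not_triv one_closed by blast
qed

end

section \<open>Quotient maps and cyclic quotients\<close>

context group
begin

lemma quotient_map:
  assumes N: "N \<lhd> G"
  shows "group_hom G (G Mod N) (\<lambda>a. N #> a)"
    and "(\<lambda>a. N #> a) ` carrier G = carrier (G Mod N)"
    and "kernel G (G Mod N) (\<lambda>a. N #> a) = N"
proof -
  interpret N: normal N G by fact
  show "group_hom G (G Mod N) (\<lambda>a. N #> a)"
    by (simp add: group_hom_def group_hom_axioms_def N.factorgroup_is_group N.r_coset_hom_Mod)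
  show "(\<lambda>a. N #> a) ` carrier G = carrier (G Mod N)"
    by (simp add: carrier_FactGroup)
  show "kernel G (G Mod N) (\<lambda>a. N #> a) = N"
    using coset_join1[OF _ _ N.subgroup_axioms] coset_join2[OF _ N.subgroup_axioms]
    by (auto simp: kernel_def)
qed

lemma norm_in_iff_normal:
  assumes M: "subgroup M G"
  shows "norm_in G N M \<longleftrightarrow> N \<lhd> G\<lparr>carrier := M\<rparr>"
proof -
  interpret M: group "G\<lparr>carrier := M\<rparr>"
    using M subgroup_imp_group by blast
  have sub: "subgroup N (G\<lparr>carrier := M\<rparr>) \<longleftrightarrow> subgroup N G \<and> N \<subseteq> M"
    using subgroup_incl[of N M] incl_subgroup[OF M, of N] subgroup.subset[of N "G\<lparr>carrier := M\<rparr>"] M by auto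
  have conj: "m \<otimes> n \<otimes> inv\<^bsub>G\<lparr>carrier := M\<rparr>\<^esub> m = m \<otimes> n \<otimes> inv m" if "m \<in> M" for m n
    using m_inv_consistent[OF M that] by simp
  show ?thesis
    unfolding M.normal_inv_iff sub norm_in_def using M conj by auto
qed

text \<open>The generator of \<open>W\<close> is the power of least positive exponent lying in \<open>W\<close>.\<close>

lemma subgroup_of_cyclic:
  assumes cyc: "cyclic_group G" and fin: "finite (carrier G)" and W: "subgroup W G"
  shows "\<exists>z \<in> W. \<forall>w \<in> W. \<exists>n::int. w = z [^] n"
proof -
  interpret W: subgroup W G by fact
  obtain x where x: "x \<in> carrier G" "carrier G = range (\<lambda>n::int. x [^] n)"
    using cyc cyclic_group by auto
  define P where "P = (\<lambda>m::nat. m > 0 \<and> x [^] m \<in> W)"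
  have "P (order G)"
    using pow_order_eq_1[OF x(1)] fin order_gt_0_iff_finite by (simp add: P_def)
  then have Pm: "P (LEAST m. P m)" and least: "\<And>k. P k \<Longrightarrow> (LEAST m. P m) \<le> k"
    by (auto intro: LeastI Least_le)
  define m where "m = (LEAST m. P m)"
  have m: "m > 0" "x [^] m \<in> W" "\<And>k. P k \<Longrightarrow> m \<le> k"
    using Pm least by (auto simp: m_def P_def)
  show ?thesis
  proof (intro bexI[of _ "x [^] m"] ballI)
    show "x [^] m \<in> W" by (rule m(2))
    fix w assume w: "w \<in> W"
    then have "w \<in> range (\<lambda>n::int. x [^] n)"
      using x(2) by auto
    then obtain n :: int where n: "w = x [^] n"
      by blast
    define q k where "q = n div int m" and "k = nat (n mod int m)"
    have nk: "n = int m * q + int k"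
      using m(1) by (simp add: q_def k_def)
    have xm: "(x [^] m) [^] q = x [^] (int m * q)"
      using x(1) int_pow_pow[of x "int m" q] by (simp add: int_pow_int)
    have wk: "w = (x [^] m) [^] q \<otimes> x [^] k"
      using x(1) int_pow_mult[OF x(1), of "int m * q" "int k"] by (simp add: n nk xm int_pow_int)
    have qW: "(x [^] m) [^] q \<in> W"
      using subgroup_int_pow_closed[OF W m(2)] .
    have "inv ((x [^] m) [^] q) \<otimes> w = x [^] k"
      using x(1) qW unfolding wk by (simp add: m_assoc[symmetric])
    then have "x [^] k \<in> W"
      using w qW W.m_closed W.m_inv_closed by metis
    moreover have "k < m"
      using m(1) by (simp add: k_def nat_less_iff)
    ultimately have "k = 0"
      using m(3)[of k] by (auto simp: P_def)
    then show "\<exists>n::int. w = (x [^] m) [^] n"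
      using wk x(1) by auto
  qed
qed

end

text \<open>\<open>g\<close> lifts a generator of the image, which is cyclic as a subgroup of a
  cyclic group. Surjectivity is not assumed, since the map will be the restriction to
  \<open>B\<close> of the projection from the automorphism group.\<close>

lemma (in group_hom) cyclic_image_generator:
  assumes "cyclic_group H" "finite (carrier H)"
  shows "\<exists>g \<in> carrier G. \<forall>K. subgroup K G \<longrightarrow> kernel G H h \<subseteq> K \<longrightarrow> g \<in> K \<longrightarrow> K = carrier G"
proof -
  obtain z where z: "z \<in> h ` carrier G" "\<And>w. w \<in> h ` carrier G \<Longrightarrow> \<exists>n::int. w = z [^]\<^bsub>H\<^esub> n"
    using H.subgroup_of_cyclic[OF assms img_is_subgroup] by blast
  obtain g where g: "g \<in> carrier G" "z = h g"
    using z(1) by blast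
  have "K = carrier G" if K: "subgroup K G" "kernel G H h \<subseteq> K" "g \<in> K" for K
  proof
    show "K \<subseteq> carrier G"
      using subgroup.subset[OF K(1)] .
    show "carrier G \<subseteq> K"
    proof
      fix x assume x: "x \<in> carrier G"
      obtain n :: int where "h x = z [^]\<^bsub>H\<^esub> n"
        using z(2)[of "h x"] x by blast
      then have n: "h x = h (g [^] n)"
        using g hom_int_pow by simp
      have gn: "g [^] n \<in> K" "g [^] n \<in> carrier G"
        using G.subgroup_int_pow_closed[OF K(1,3)] g(1) by auto
      have "x \<otimes> inv (g [^] n) \<in> kernel G H h"
        using x gn(2) n by (simp add: kernel_def)
      then have "x \<otimes> inv (g [^] n) \<otimes> g [^] n \<in> K"
        using K(2) gn(1) subgroup.m_closed[OF K(1)] by blast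
      then show "x \<in> K"
        using x gn(2) by (simp add: G.m_assoc)
    qed
  qed
  then show ?thesis
    using g(1) by blast
qed

context simple_group
begin

lemma finite_auto:
  assumes "finite (carrier G)"
  shows "finite (auto G)"
proof (rule finite_subset)
  show "auto G \<subseteq> (carrier G \<rightarrow>\<^sub>E carrier G)"
    by (auto simp: auto_def Bij_def PiE_def bij_betw_def)
  show "finite (carrier G \<rightarrow>\<^sub>E carrier G)"
    using assms by (rule finite_PiE) (use assms in simp)
qed

text \<open>Being cyclic modulo \<open>p\<close> passes from Out to the subgroup given by
  \<open>B\<close> and on to its quotient by \<open>J\<close>. If \<open>T\<close> is the preimage
  of the largest normal \<open>p\<close>-subgroup of Out, then \<open>B\<close> modulo
  \<open>B \<inter> T\<close> embeds in a cyclic group, and \<open>L\<close> is the product of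
  \<open>B \<inter> T\<close> with \<open>J\<close>.\<close>

lemma cyclic_mod_p_extension:
  assumes fin: "finite (carrier G)" and p: "Factorial_Ring.prime p" and cyc: "cyclic_mod_p p (OutGroup G)"
    and B: "subgroup B (AutoGroup G)" "Inn G \<subseteq> B"
    and J: "J \<lhd> (AutoGroup G)\<lparr>carrier := B\<rparr>" "Inn G \<subseteq> J"
  shows "\<exists>L g k. L \<lhd> (AutoGroup G)\<lparr>carrier := B\<rparr> \<and> J \<subseteq> L \<and> card L = card J * p ^ k \<and> g \<in> B \<and>
    (\<forall>K. subgroup K ((AutoGroup G)\<lparr>carrier := B\<rparr>) \<longrightarrow> L \<subseteq> K \<longrightarrow> g \<in> K \<longrightarrow> K = B)"
proof -
  let ?Au = "AutoGroup G" and ?A = "(AutoGroup G)\<lparr>carrier := B\<rparr>"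
  interpret Au: group ?Au
    by (rule AutoGroup)
  interpret A: group ?A
    using B(1) Au.subgroup_imp_group by blast
  have finAu: "finite (carrier ?Au)"
    using finite_auto[OF fin] by (simp add: carrier_AutoGroup)
  have finH: "finite H" if "subgroup H ?Au" for H
    using finite_subset[OF subgroup.subset[OF that] finAu] .
  let ?q = "\<lambda>a. Inn G #>\<^bsub>?Au\<^esub> a"
  interpret q: group_hom ?Au "OutGroup G" ?q
    unfolding OutGroup_def by (rule Au.quotient_map(1)[OF Inn_normal])
  have qsurj: "?q ` carrier ?Au = carrier (OutGroup G)"
    and qker: "kernel ?Au (OutGroup G) ?q = Inn G"
    unfolding OutGroup_def by (rule Au.quotient_map(2,3)[OF Inn_normal])+
  obtain P k where P: "P \<lhd> OutGroup G" "card P = p ^ k" "cyclic_group (OutGroup G Mod P)"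
    using cyc by (auto simp: cyclic_mod_p_def is_O_p_def is_p_subgroup_def)
  interpret P: normal P "OutGroup G" by fact
  let ?r = "\<lambda>a. P #>\<^bsub>OutGroup G\<^esub> a"
  interpret r: group_hom "OutGroup G" "OutGroup G Mod P" ?r
    by (rule q.H.quotient_map(1)[OF P(1)])
  define T where "T = q.preimage P"
  have T: "subgroup T ?Au" and cardT: "card T = p ^ k * card (Inn G)" and IT: "Inn G \<subseteq> T"
    using q.subgroup_preimage[OF P.subgroup_axioms] q.card_preimage[OF finAu qsurj P.subgroup_axioms]
      q.kernel_subset_preimage[OF P.subgroup_axioms] P(2) by (simp_all add: T_def qker)
  have Tn: "T \<lhd> ?Au"
  proof (rule Au.normalI_conj_set[OF T])
    fix a assume a: "a \<in> carrier ?Au"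
    have "a \<otimes>\<^bsub>?Au\<^esub> t \<otimes>\<^bsub>?Au\<^esub> inv\<^bsub>?Au\<^esub> a \<in> T" if t: "t \<in> T" for t
    proof -
      have t': "t \<in> carrier ?Au" "?q t \<in> P"
        using t by (auto simp: T_def q.preimage_def)
      have "?q (a \<otimes>\<^bsub>?Au\<^esub> t \<otimes>\<^bsub>?Au\<^esub> inv\<^bsub>?Au\<^esub> a) \<in> P"
        using P.inv_op_closed2[OF q.hom_closed[OF a] t'(2)] a t'(1) by simp
      then show ?thesis
        using a t'(1) by (simp add: T_def q.preimage_def)
    qed
    then show "conj_set ?Au a T \<subseteq> T"
      by (auto simp: conj_set_def)
  qed
  let ?TB = "B \<inter> T"
  have TBn: "norm_in ?Au ?TB B"
  proof -
    have "norm_in ?Au T (carrier ?Au)"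
      using Tn Au.norm_in_carrier_iff by blast
    then have "norm_in ?Au (B \<inter> T) (B \<inter> carrier ?Au)"
      by (rule Au.norm_in_Int) (rule B(1))
    then show ?thesis
      using subgroup.subset[OF B(1)] by (simp add: Int_absorb2)
  qed
  have Jn: "norm_in ?Au J B"
    using J(1) Au.norm_in_iff_normal[OF B(1)] by blast
  have Js: "subgroup J ?Au" and JB: "J \<subseteq> B" and TBs: "subgroup ?TB ?Au"
    using Jn TBn by (auto simp: norm_in_def)
  have Is: "subgroup (Inn G) ?Au"
    using normal_imp_subgroup[OF Inn_normal] .
  define L where "L = ?TB <#>\<^bsub>?Au\<^esub> J"
  have TBB: "?TB <#>\<^bsub>?Au\<^esub> B = B"
  proof
    show "?TB <#>\<^bsub>?Au\<^esub> B \<subseteq> B"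
      using subgroup.m_closed[OF B(1)] by (auto simp: set_mult_def)
    show "B \<subseteq> ?TB <#>\<^bsub>?Au\<^esub> B"
      using Au.subset_set_mult(2)[OF TBs B(1)] .
  qed
  have Ln: "norm_in ?Au L B"
    unfolding L_def by (rule Au.norm_in_set_mult[OF TBn Jn TBB])
  then have LA: "L \<lhd> ?A"
    using Au.norm_in_iff_normal[OF B(1)] by blast
  have JL: "J \<subseteq> L" and TL: "?TB \<subseteq> L"
    unfolding L_def using Au.subset_set_mult[OF TBs Js] by auto
  have "\<exists>j. card L = card J * p ^ j"
  proof -
    have c0: "card ?TB * card J = card L * card (?TB \<inter> J)"
      unfolding L_def by (rule Au.card_set_mult[OF TBs Js finH[OF TBs] finH[OF Js]])
    have TBJ: "subgroup (?TB \<inter> J) ?Au"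
      by (rule Au.subgroups_Inter_pair[OF TBs Js])
    have "card (?TB \<inter> J) dvd card ?TB"
      by (rule Au.card_subgroup_dvd[OF TBJ TBs]) blast
    then obtain d where d: "card ?TB = card (?TB \<inter> J) * d"
      by (auto elim: dvdE)
    have "card (Inn G) dvd card (?TB \<inter> J)"
      by (rule Au.card_subgroup_dvd[OF Is TBJ]) (use B(2) IT J(2) in blast)
    then obtain c where c: "card (?TB \<inter> J) = card (Inn G) * c"
      by (auto elim: dvdE)
    have "card ?TB dvd card T"
      by (rule Au.card_subgroup_dvd[OF TBs T]) blast
    then obtain b where b: "card T = card ?TB * b"
      by (auto elim: dvdE)
    have pos: "card (Inn G) > 0" "card (?TB \<inter> J) > 0"
      using finH[OF Is] finH[OF TBJ] Is TBJ subgroup_nonempty[of ?Au] by (auto simp: card_gt_0_iff)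
    \<comment> \<open>\<open>d\<close>, the index of \<open>?TB \<inter> J\<close> in
      \<open>?TB\<close>, divides the index p^k of \<open>Inn G\<close> in \<open>T\<close>, because
      \<open>Inn G\<close> lies in \<open>?TB \<inter> J\<close>. By the product formula
      \<open>d\<close> is also the index of \<open>J\<close> in \<open>L\<close>.\<close>
    have "card (Inn G) * p ^ k = card (Inn G) * (d * (c * b))"
      using cardT b c d by (simp only: mult_ac)
    then have "p ^ k = d * (c * b)"
      using pos(1) by simp
    then have "d dvd p ^ k"
      by simp
    then obtain j where j: "d = p ^ j"
      using divides_primepow_nat[OF p] by auto
    have "card (?TB \<inter> J) * (d * card J) = card (?TB \<inter> J) * card L"
      using c0 d by (simp only: mult_ac)
    then have "d * card J = card L"
      using pos(2) mult_cancel1 by simp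
    then have "card L = card J * d"
      by (simp only: mult.commute)
    then show ?thesis
      using j by blast
  qed
  then obtain j where j: "card L = card J * p ^ j"
    by blast
  let ?\<pi> = "\<lambda>a. ?r (?q a)"
  have \<pi>: "group_hom ?A (OutGroup G Mod P) ?\<pi>"
  proof -
    have "?\<pi> \<in> hom ?A (OutGroup G Mod P)"
      unfolding hom_def
    proof (intro CollectI conjI ballI)
      show "?\<pi> \<in> carrier ?A \<rightarrow> carrier (OutGroup G Mod P)"
        using subgroup.mem_carrier[OF B(1)] by auto
      show "?\<pi> (x \<otimes>\<^bsub>?A\<^esub> y) = ?\<pi> x \<otimes>\<^bsub>OutGroup G Mod P\<^esub> ?\<pi> y"
        if "x \<in> carrier ?A" "y \<in> carrier ?A" for x y
        using that subgroup.mem_carrier[OF B(1)] q.hom_mult[of x y] r.hom_mult[of "?q x" "?q y"] by simp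
    qed
    then show ?thesis
      by (simp add: group_hom_def group_hom_axioms_def A.is_group r.H.is_group)
  qed
  have ker: "kernel ?A (OutGroup G Mod P) ?\<pi> = ?TB"
  proof -
    have "?r (?q a) = P \<longleftrightarrow> a \<in> T" if "a \<in> B" for a
      using subgroup.mem_carrier[OF B(1) that] q.H.coset_join1[OF _ _ P.subgroup_axioms, of "?q a"]
        q.H.coset_join2[OF _ P.subgroup_axioms, of "?q a"] q.hom_closed[of a]
      by (auto simp: T_def q.preimage_def)
    then show ?thesis
      by (auto simp: kernel_def)
  qed
  have "finite (carrier (OutGroup G))"
    using finAu qsurj finite_imageI by metis
  then have "finite (carrier (OutGroup G Mod P))"
    by (simp add: carrier_FactGroup)
  then obtain g where g: "g \<in> B" "\<And>K. subgroup K ?A \<Longrightarrow> ?TB \<subseteq> K \<Longrightarrow> g \<in> K \<Longrightarrow> K = B"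
    using group_hom.cyclic_image_generator[OF \<pi> P(3)] ker by auto
  \<comment> \<open>\<open>g\<close> generates \<open>B\<close> over \<open>?TB\<close>, hence also
    over the larger \<open>L\<close>.\<close>
  show ?thesis
    using LA JL j g TL by blast
qed

end

section \<open>Nonsolvability\<close>

text \<open>The target of \<theta> is cut down to its image \<open>B\<close>, so that the transfer
  along an epimorphism applies; its two hypotheses are then verified separately.\<close>

lemma (in group_and_simple) mobius_sum_zero:
  assumes fin: "finite (carrier G)" "finite (carrier S)" and nc: "\<not> comm_group S"
    and p: "Factorial_Ring.prime p" and cyc: "cyclic_mod_p p (OutGroup S)"
    and \<theta>: "\<theta> \<in> hom G (AutoGroup S)" "Inn S \<subseteq> \<theta> ` carrier G"
    and N: "N \<lhd> G" "solvable (G Mod N)"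
  shows "(\<Sum>U | subgroup U G \<and> U <#> N = carrier G. subgroup_mobius G U * int (card U)) = 0"
proof -
  let ?Au = "AutoGroup S"
  define B where "B = \<theta> ` carrier G"
  let ?A = "?Au\<lparr>carrier := B\<rparr>"
  interpret Au: group ?Au
    by (rule S.AutoGroup)
  interpret T: group_hom G ?Au \<theta>
    using \<theta>(1) by unfold_locales
  have B: "subgroup B ?Au" "Inn S \<subseteq> B"
    using T.img_is_subgroup \<theta>(2) by (auto simp: B_def)
  interpret A: group ?A
    using B(1) Au.subgroup_imp_group by blast
  interpret h: group_hom G ?A \<theta>
    using \<theta>(1) by unfold_locales (auto simp: hom_def B_def)
  interpret N: normal N G by fact
  have surj: "\<theta> ` carrier G = carrier ?A"
    by (simp add: B_def)
  have finA: "finite (carrier ?A)"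
    using fin(1) by (simp add: B_def)
  have ker: "kernel G ?A \<theta> = kernel G ?Au \<theta>"
    by (simp add: kernel_def)
  show ?thesis
  proof (rule h.sum_mobius_supplements_zero[OF fin(1) surj N(1)])
    fix J assume J: "J \<lhd> ?A" "J \<noteq> {\<one>\<^bsub>?A\<^esub>}"
    have IJ: "Inn S \<subseteq> J"
      using S.normal_contains_Inn[OF B J(1)] J(2) by simp
    obtain L g k where *: "L \<lhd> ?A \<and> J \<subseteq> L \<and> card L = card J * p ^ k \<and> g \<in> B \<and>
        (\<forall>K. subgroup K ?A \<longrightarrow> L \<subseteq> K \<longrightarrow> g \<in> K \<longrightarrow> K = B)"
      using S.cyclic_mod_p_extension[OF fin(2) p cyc B J(1) IJ] by (elim exE)
    then have L: "L \<lhd> ?A" "J \<subseteq> L" "card L = card J * p ^ k" "g \<in> B"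
      and gen: "\<And>K. subgroup K ?A \<Longrightarrow> L \<subseteq> K \<Longrightarrow> g \<in> K \<Longrightarrow> K = B"
      by simp_all
    have w: "(\<Sum>V | subgroup V ?A \<and> Q \<subseteq> V \<and> a \<in> V. subgroup_mobius G (h.preimage V)) = 0"
      if Q: "subgroup Q ?A" "card Q = p ^ j" and a: "a \<in> carrier ?A" "conj_set ?A a Q = Q" for Q a j
    proof -
      have QB: "Q \<subseteq> B"
        using subgroup.subset[OF Q(1)] by simp
      \<comment> \<open>\<open>Q\<close> contains the identity, so \<open>?R\<close> contains the
        kernel, and the subgroups of \<open>G\<close> above \<open>?R\<close> are exactly the
        preimages of the \<open>V\<close> above \<open>Q \<union> {a}\<close>. They have Moebius sum
        0, as \<open>?R\<close> generates a proper subgroup.\<close>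
      let ?R = "h.preimage (Q \<union> {a})"
      have Rc: "?R \<subseteq> carrier G"
        by (auto simp: h.preimage_def)
      have imR: "\<theta> ` ?R = Q \<union> {a}"
        by (rule h.image_preimage[OF surj]) (use QB a in simp)
      have iff: "?R \<subseteq> h.preimage V \<longleftrightarrow> Q \<union> {a} \<subseteq> V" if "V \<subseteq> carrier ?A" for V
      proof
        assume "?R \<subseteq> h.preimage V"
        then have "\<theta> ` ?R \<subseteq> \<theta> ` h.preimage V"
          by (rule image_mono)
        then show "Q \<union> {a} \<subseteq> V"
          using imR h.image_preimage[OF surj that] by simp
      qed (auto simp: h.preimage_def)
      have "generate G ?R \<noteq> carrier G"
      proof
        assume *: "generate G ?R = carrier G"
        let ?V = "generate ?A (Q \<union> {a})"
        have V: "subgroup ?V ?A"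
          by (rule A.generate_is_subgroup) (use QB a in simp)
        have "?R \<subseteq> h.preimage ?V"
          using iff[OF subgroup.subset[OF V]] generate.incl[of _ "Q \<union> {a}" ?A] by blast
        then have "carrier G \<subseteq> h.preimage ?V"
          using generate_subgroup_incl[OF _ h.subgroup_preimage[OF V]] * by metis
        then have "\<theta> ` carrier G \<subseteq> ?V"
          by (auto simp: h.preimage_def)
        then have "?V = B"
          using subgroup.subset[OF V] by (auto simp: B_def)
        then show False
          using S.hypo_elementary_proper[OF nc fin(2) p B Q] a by simp
      qed
      then have "(\<Sum>U | subgroup U G \<and> ?R \<subseteq> U. subgroup_mobius G U) = 0"
        by (rule sum_mobius_above_subset[OF fin(1) Rc])
      moreover have "(\<Sum>V | subgroup V ?A \<and> Q \<subseteq> V \<and> a \<in> V. subgroup_mobius G (h.preimage V)) =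
          (\<Sum>U | subgroup U G \<and> ?R \<subseteq> U. subgroup_mobius G U)"
      proof (rule sum.reindex_bij_witness[where i = "\<lambda>U. \<theta> ` U" and j = h.preimage])
        show hp: "\<theta> ` h.preimage V = V" if "V \<in> {V. subgroup V ?A \<and> Q \<subseteq> V \<and> a \<in> V}" for V
          using that by (intro h.image_preimage[OF surj] subgroup.subset) simp
        show "h.preimage V \<in> {U. subgroup U G \<and> ?R \<subseteq> U}"
          if "V \<in> {V. subgroup V ?A \<and> Q \<subseteq> V \<and> a \<in> V}" for V
          using that h.subgroup_preimage[of V] iff[of V] subgroup.subset[of V ?A] by simp
        have kR: "kernel G ?A \<theta> \<subseteq> ?R"
          using subgroup.one_closed[OF Q(1)] by (auto simp: kernel_def h.preimage_def)
        show ph: "h.preimage (\<theta> ` U) = U" if "U \<in> {U. subgroup U G \<and> ?R \<subseteq> U}" for U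
          using that kR by (intro h.preimage_image) auto
        show "\<theta> ` U \<in> {V. subgroup V ?A \<and> Q \<subseteq> V \<and> a \<in> V}"
          if U: "U \<in> {U. subgroup U G \<and> ?R \<subseteq> U}" for U
        proof -
          have "subgroup (\<theta> ` U) ?A"
            using U h.subgroup_img_is_subgroup by simp
          moreover have "Q \<union> {a} \<subseteq> \<theta> ` U"
            using U imR image_mono[of ?R U \<theta>] by simp
          ultimately show ?thesis
            by simp
        qed
      qed simp
      ultimately show ?thesis
        by simp
    qed
    show "(\<Sum>V | subgroup V ?A \<and> V <#>\<^bsub>?A\<^esub> J = carrier ?A.
        subgroup_mobius G (h.preimage V) * int (card V)) = 0"
    proof (rule A.sum_weights_supplements_zero[OF finA p J(1) L(1-3)])
      show "g \<in> carrier ?A"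
        using L(4) by simp
      show "K = carrier ?A" if "subgroup K ?A" "L \<subseteq> K" "g \<in> K" for K
        using gen[OF that] by simp
    qed (rule w)
  next
    fix U assume U: "subgroup U G" "U <#> N = carrier G" "\<theta> ` U = carrier ?A"
    \<comment> \<open>\<open>U\<close> maps onto the solvable quotient by \<open>N\<close>, so some
      term of its derived series lies in \<open>U \<inter> N\<close>. If that were in the kernel,
      the same term of the derived series of \<theta>(U) = B would be trivial.\<close>
    show "\<not> U \<inter> N \<subseteq> kernel G ?A \<theta>"
    proof
      assume UN: "U \<inter> N \<subseteq> kernel G ?A \<theta>"
      interpret U: subgroup U G by fact
      let ?q = "\<lambda>a. N #> a"
      interpret q: group_hom G "G Mod N" ?q
        by (rule quotient_map(1)[OF N(1)])
      have "?q ` U = carrier (G Mod N)"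
      proof
        show "?q ` U \<subseteq> carrier (G Mod N)"
          using U.mem_carrier by (auto simp: carrier_FactGroup)
        show "carrier (G Mod N) \<subseteq> ?q ` U"
        proof
          fix c assume "c \<in> carrier (G Mod N)"
          then obtain g where g: "g \<in> carrier G" "c = N #> g"
            by (auto simp: carrier_FactGroup)
          then have "g \<in> U <#> N"
            using U(2) by simp
          then obtain u n where un: "u \<in> U" "n \<in> N" "g = u \<otimes> n"
            by (auto simp: set_mult_def)
          have "?q n = \<one>\<^bsub>G Mod N\<^esub>"
            using coset_join2[OF _ N.subgroup_axioms un(2)] un(2) by simp
          then have "?q g = ?q u"
            using q.hom_mult[of u n] un q.H.r_one[OF q.hom_closed[OF U.mem_carrier[OF un(1)]]] by simp
          then show "c \<in> ?q ` U"
            using g(2) un(1) by blast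
        qed
      qed
      moreover obtain n where "(derived (G Mod N) ^^ n) (carrier (G Mod N)) = {\<one>\<^bsub>G Mod N\<^esub>}"
        using N(2) q.H.solvable_iff_trivial_derived_seq by blast
      ultimately have 1: "?q ` ((derived G ^^ n) U) = {N}"
        using q.exp_of_derived_img[OF U.subset, of n] by simp
      let ?D = "(derived G ^^ n) U"
      have D: "subgroup ?D G"
        by (rule exp_of_derived_is_subgroup[OF U(1)])
      have DU: "(derived G ^^ m) U \<subseteq> U" for m
      proof (induction m)
        case (Suc m)
        then show ?case
          using derived_incl[OF Suc U(1)] by simp
      qed simp
      have "?D \<subseteq> N"
      proof
        fix d assume d: "d \<in> ?D"
        then have "N #> d = N"
          using 1 by blast
        then show "d \<in> N"
          using coset_join1[OF _ subgroup.mem_carrier[OF D d] N.subgroup_axioms] by blast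
      qed
      then have "?D \<subseteq> kernel G ?Au \<theta>"
        using DU[of n] UN ker by blast
      then have "\<theta> ` ?D \<subseteq> {\<one>\<^bsub>?Au\<^esub>}"
        by (auto simp: kernel_def)
      moreover have "\<theta> \<one> \<in> \<theta> ` ?D"
        using subgroup.one_closed[OF D] by (rule imageI)
      ultimately have "\<theta> ` ?D = {\<one>\<^bsub>?Au\<^esub>}"
        by auto
      then have "(derived ?Au ^^ n) B = {\<one>\<^bsub>?Au\<^esub>}"
        using T.exp_of_derived_img[OF U.subset, of n] U(3) by simp
      then show False
        using S.derived_Inn_nontrivial[OF nc B(2)] by blast
    qed
  qed
qed

section \<open>From composition factors to maximal normal subgroups\<close>

lemma (in group) max_norm_in_simple_quotient:
  assumes M: "subgroup M G" and N: "N \<lhd> G\<lparr>carrier := M\<rparr>" and simple: "simple_group (G\<lparr>carrier := M\<rparr> Mod N)"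
  shows "max_norm_in G N M"
proof -
  let ?M = "G\<lparr>carrier := M\<rparr>"
  interpret M: group ?M
    using M subgroup_imp_group by blast
  interpret N: normal N ?M by fact
  interpret Q: simple_group "?M Mod N"
    by (rule simple)
  let ?q = "\<lambda>a. N #>\<^bsub>?M\<^esub> a"
  interpret q: group_hom ?M "?M Mod N" ?q
    by (rule M.quotient_map(1)[OF N])
  have qsurj: "?q ` carrier ?M = carrier (?M Mod N)"
    by (rule M.quotient_map(2)[OF N])
  have ker: "a \<in> N" if "a \<in> M" "?q a = N" for a
    using M.coset_join1[OF that(2) _ N.subgroup_axioms] that(1) by simp
  have "N \<noteq> M"
  proof
    assume NM: "N = M"
    have "?q a = N" if "a \<in> M" for a
      using M.coset_join2[OF _ N.subgroup_axioms, of a] that NM by simp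
    then have "carrier (?M Mod N) \<subseteq> {\<one>\<^bsub>?M Mod N\<^esub>}"
      unfolding qsurj[symmetric] by auto
    then show False
      using Q.simple_not_triv Q.one_closed by blast
  qed
  moreover have "K = N \<or> K = M" if K: "norm_in G K M" "N \<subseteq> K" for K
  proof -
    have KM: "K \<lhd> ?M" and KsM: "K \<subseteq> M" and Ks: "subgroup K G"
      using K(1) norm_in_iff_normal[OF M] by (auto simp: norm_in_def)
    have "?q ` K \<lhd> ?M Mod N"
      by (rule normal.surj_hom_normal_subgroup[OF KM q.group_hom_axioms qsurj])
    then have "?q ` K = carrier (?M Mod N) \<or> ?q ` K = {\<one>\<^bsub>?M Mod N\<^esub>}"
      by (rule Q.no_real_normal_subgroup)
    then show ?thesis
    proof
      assume qK: "?q ` K = {\<one>\<^bsub>?M Mod N\<^esub>}"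
      have "K \<subseteq> N"
      proof
        fix x assume x: "x \<in> K"
        then have "?q x \<in> {\<one>\<^bsub>?M Mod N\<^esub>}"
          unfolding qK[symmetric] by (rule imageI)
        then show "x \<in> N"
          using ker[of x] x KsM by auto
      qed
      then show ?thesis
        using K(2) by blast
    next
      assume qK: "?q ` K = carrier (?M Mod N)"
      have "M \<subseteq> K"
      proof
        fix x assume x: "x \<in> M"
        then have "?q x \<in> ?q ` K"
          unfolding qK using q.hom_closed[of x] by simp
        then obtain y where y: "y \<in> K" "?q x = ?q y"
          by blast
        have "x \<in> ?q y"
          using M.rcos_self[of x N] N.subgroup_axioms x unfolding y(2)[symmetric] by simp
        then obtain n where "n \<in> N" "x = n \<otimes> y"
          by (auto simp: r_coset_def)
        then show "x \<in> K"
          using K(2) y(1) subgroup.m_closed[OF Ks] by blast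
      qed
      then show ?thesis
        using KsM by blast
    qed
  qed
  ultimately show ?thesis
    using N norm_in_iff_normal[OF M] by (auto simp: max_norm_in_def)
qed

text \<open>Compose the isomorphism with the quotient map in one direction; use the first
  isomorphism theorem in the other.\<close>

lemma (in group_and_simple) quotient_iso_iff_epi_kernel:
  assumes M: "subgroup M G" and N: "N \<lhd> G\<lparr>carrier := M\<rparr>"
  shows "G\<lparr>carrier := M\<rparr> Mod N \<cong> S \<longleftrightarrow> (\<exists>f. epi_kernel G S M N f)"
proof
  let ?M = "G\<lparr>carrier := M\<rparr>"
  interpret M: group ?M
    using M subgroup_imp_group by blast
  interpret N: normal N ?M by fact
  let ?q = "\<lambda>a. N #>\<^bsub>?M\<^esub> a"
  interpret q: group_hom ?M "?M Mod N" ?q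
    by (rule M.quotient_map(1)[OF N])
  {
    assume "?M Mod N \<cong> S"
    then obtain \<phi> where \<phi>: "\<phi> \<in> iso (?M Mod N) S"
      by (auto simp: is_iso_def)
    interpret \<phi>: group_hom "?M Mod N" S \<phi>
      using \<phi> by unfold_locales (simp add: iso_def)
    have bij: "bij_betw \<phi> (carrier (?M Mod N)) (carrier S)"
      using \<phi> by (simp add: iso_def)
    have "epi_kernel G S M N (\<lambda>a. \<phi> (?q a))"
      unfolding epi_kernel_def
    proof (intro conjI)
      show "(\<lambda>a. \<phi> (?q a)) \<in> hom ?M S"
        unfolding hom_def
      proof (intro CollectI conjI ballI)
        show "(\<lambda>a. \<phi> (?q a)) \<in> carrier ?M \<rightarrow> carrier S"
          using \<phi>.hom_closed q.hom_closed by blast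
        show "\<phi> (?q (x \<otimes>\<^bsub>?M\<^esub> y)) = \<phi> (?q x) \<otimes>\<^bsub>S\<^esub> \<phi> (?q y)"
          if "x \<in> carrier ?M" "y \<in> carrier ?M" for x y
          using q.hom_mult[OF that] \<phi>.hom_mult[OF q.hom_closed[OF that(1)] q.hom_closed[OF that(2)]] by simp
      qed
      have "(\<lambda>a. \<phi> (?q a)) ` M = \<phi> ` (?q ` carrier ?M)"
        by (simp add: image_image)
      then show "(\<lambda>a. \<phi> (?q a)) ` M = carrier S"
        using M.quotient_map(2)[OF N] bij by (simp add: bij_betw_def)
      have "\<phi> (?q a) = \<one>\<^bsub>S\<^esub> \<longleftrightarrow> ?q a = \<one>\<^bsub>?M Mod N\<^esub>" if "a \<in> M" for a
        using inj_onD[OF bij_betw_imp_inj_on[OF bij], of "?q a" "\<one>\<^bsub>?M Mod N\<^esub>"] q.hom_closed[of a]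
          q.H.one_closed \<phi>.hom_one that by fastforce
      then have "{a \<in> M. \<phi> (?q a) = \<one>\<^bsub>S\<^esub>} = kernel ?M (?M Mod N) ?q"
        by (auto simp: kernel_def)
      then show "{a \<in> M. \<phi> (?q a) = \<one>\<^bsub>S\<^esub>} = N"
        using M.quotient_map(3)[OF N] by simp
    qed
    then show "\<exists>f. epi_kernel G S M N f"
      by blast
  }
  {
    assume "\<exists>f. epi_kernel G S M N f"
    then obtain f where f: "epi_kernel G S M N f"
      by blast
    interpret f: group_hom ?M S f
      using epi_kernel_hom[OF f M] .
    have "kernel ?M S f = N" "f ` carrier ?M = carrier S"
      using f by (auto simp: kernel_def epi_kernel_def)
    then show "?M Mod N \<cong> S"
      using f.FactGroup_iso_set by (auto simp: is_iso_def)
  }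
qed

theorem theorem4p1:
  fixes G :: "('a, 'b) monoid_scheme" and S :: "('c, 'd) monoid_scheme" and p :: nat
  assumes "group G" and "finite (carrier G)"
    and "simple_group S" and "finite (carrier S)" and "\<not> comm_group S"
    and "Factorial_Ring.prime p" and "cyclic_mod_p p (OutGroup S)"
    and "\<exists>Hs. composition_series G Hs \<and>
           card {i. Suc i < length Hs \<and> comp_factor G Hs i \<cong> S} = 1"
  shows "\<forall>N. beta_kernel G N \<longrightarrow> \<not> solvable (G Mod N)"
proof (intro allI impI notI)
  fix N assume beta: "beta_kernel G N" and sol: "solvable (G Mod N)"
  interpret group_and_simple G S
    using assms(1,3) by (simp add: group_and_simple_def)
  obtain Hs where Hs: "composition_series G Hs"
    and card: "card {i. Suc i < length Hs \<and> comp_factor G Hs i \<cong> S} = 1"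
    using assms(8) by blast
  obtain i where i: "{i. Suc i < length Hs \<and> comp_factor G Hs i \<cong> S} = {i}"
    using card card_1_singletonE by blast
  \<comment> \<open>\<open>n\<close> counts the factors of the series, one fewer than its terms;
    \<open>j < n\<close> then says that \<open>Hs ! Suc j\<close> exists.\<close>
  define n where "n = length Hs - 1"
  have ne: "Hs \<noteq> []"
    using Hs by (simp add: composition_series_def)
  have lt: "j < n \<longleftrightarrow> Suc j < length Hs" for j
    using ne by (auto simp: n_def)
  have sub: "subgroup (Hs ! j) G" if "j < length Hs" for j
    using Hs that by (simp add: composition_series_def)
  have step: "Hs ! j \<lhd> G\<lparr>carrier := Hs ! Suc j\<rparr>" "simple_group (G\<lparr>carrier := Hs ! Suc j\<rparr> Mod Hs ! j)"
    if "j < n" for j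
    using Hs that by (simp_all add: composition_series_def lt comp_factor_def)
  have iso: "comp_factor G Hs j \<cong> S \<longleftrightarrow> (\<exists>f. epi_kernel G S (Hs ! Suc j) (Hs ! j) f)" if "j < n" for j
    using quotient_iso_iff_epi_kernel[OF sub step(1)] that by (simp add: comp_factor_def lt)
  interpret unique_simple_factor G S "\<lambda>j. Hs ! j" n i
  proof
    show "finite (carrier G)"
      by (rule assms(2))
    show "Hs ! 0 = {\<one>\<^bsub>G\<^esub>}" "Hs ! n = carrier G"
      using Hs ne by (simp_all add: composition_series_def n_def hd_conv_nth last_conv_nth)
    show "max_norm_in G (Hs ! j) (Hs ! Suc j)" if "j < n" for j
      using max_norm_in_simple_quotient[OF sub step] that by (simp add: lt)
    have "i \<in> {i. Suc i < length Hs \<and> comp_factor G Hs i \<cong> S}"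
      using i by blast
    then show "i < n" "\<exists>f. epi_kernel G S (Hs ! Suc i) (Hs ! i) f"
      using iso[of i] by (simp_all add: lt)
    show "j = i" if "j < n" "epi_kernel G S (Hs ! Suc j) (Hs ! j) f" for j f
    proof -
      have "j \<in> {i. Suc i < length Hs \<and> comp_factor G Hs i \<cong> S}"
        using that iso[of j] by (auto simp: lt)
      then show ?thesis
        unfolding i by simp
    qed
  qed
  obtain M E f where "M \<lhd> G" "E \<lhd> G" "epi_kernel G S M E f"
    using normal_factor_exists by blast
  then obtain \<theta> where \<theta>: "\<theta> \<in> hom G (AutoGroup S)" "Inn S \<subseteq> \<theta> ` carrier G"
    using conj_action_hom by blast
  have N: "N \<lhd> G" "m_GN G N \<noteq> 0"
    using beta by (auto simp: beta_kernel_def)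
  let ?S = "{U. subgroup U G \<and> U <#>\<^bsub>G\<^esub> N = carrier G}"
  \<comment> \<open>Up to the factor 1 / |G| this rational sum is \<open>m_GN G N\<close>; it is the
    image of an integer sum.\<close>
  have "(\<Sum>U \<in> ?S. of_nat (card U) * of_int (subgroup_mobius G U)) =
      (of_int (\<Sum>U \<in> ?S. subgroup_mobius G U * int (card U)) :: rat)"
    by (simp add: mult.commute)
  also have "\<dots> = 0"
    using mobius_sum_zero[OF assms(2,4,5,6,7) \<theta> N(1) sol] by simp
  finally have "m_GN G N = 0"
    by (simp add: m_GN_def)
  then show False
    using N(2) by blast
qed

end
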